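(* Consider the correlated Gaussian sequence model $U=\beta_0+\Sigma_0^{1/2}\mathsf Z_n\in\mathbb R^n$ described in the context. Suppose there exists $M>1$ such that $\mathrm{supp}(G_0)\subset[-M,M]$ and $\sigma_{0,j}^2\in[1/M,M]$ for all $j\in[n]$. Let $\hat G_n\in\arg\max_{G\in\mathscr G}\frac1n\sum_{j}\log\varphi_{G;\sigma_{0,j}}(U_j)$ be the exact maximum composite marginal likelihood estimator. Then for any $D>0$ there exists $c_1=c_1(M,D)>1$ such that if $n_\ast\ge(\log n)^{c_1}$, then with probability at least $1-c_1n^{-D}$, $$0\le\mathrm{Reg}_n(\hat G_n,G_0)\le n_\ast^{-1}(\log n)^{c_1}.$$
   Context: $\mathscr G$ is the set of all probability distributions on $\mathbb R$. $\varphi_\sigma$ is the density of $\mathcal N(0,\sigma^2)$ and $\varphi_{G;\sigma}(x)=\int\varphi_\sigma(x-u)\,G(\mathrm du)$. Model. $\beta_0\in\mathbb R^n$ has i.i.d. entries with distribution $G_0\in\mathscr G$, $\mathsf Z_n\sim\mathcal N(0,I_n)$ is independent of $\beta_0$, $\Sigma_0\in\mathbb R^{n\times n}$ is a (deterministic, otherwise arbitrary) covariance matrix, and $U=\beta_0+\Sigma_0^{1/2}\mathsf Z_n$. $\sigma_{0,j}^2=(\Sigma_0)_{jj}$; $\mathrm{Cor}_{\Sigma_0}=\mathfrak D^{-1/2}\Sigma_0\mathfrak D^{-1/2}$ with $\mathfrak D$ the diagonal part of $\Sigma_0$; $n_\ast=n/\|\mathrm{Cor}_{\Sigma_0}\|_{\mathrm{op}}$.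 Regret. For $G\in\mathscr G$, $s>0$, $u\in\mathbb R$, the posterior mean is $m_{G,s}(u)=\frac1{\varphi_{G;s}(u)}\int\theta\,\varphi_s(u-\theta)\,G(\mathrm d\theta)$. For a deterministic $G$, $$\mathrm{Reg}_n(G,G_0)=\frac1n\sum_{j\in[n]}\Big(\mathbb E\big(m_{G,\sigma_{0,j}}(X_j^\circ)-\theta_j^\circ\big)^2-\mathbb E\big(m_{G_0,\sigma_{0,j}}(X_j^\circ)-\theta_j^\circ\big)^2\Big),$$ where $\theta_j^\circ\sim G_0$ and $X_j^\circ=\theta_j^\circ+\sigma_{0,j}\mathsf Z_j^\circ$ with $\mathsf Z_j^\circ\sim\mathcal N(0,1)$ independent of $\theta_j^\circ$. $\mathrm{Reg}_n(\hat G_n,G_0)$ is this function evaluated at $G=\hat G_n$ (i.e. with fresh draws independent of $U$). *)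

theory Defs
  imports "HOL-Probability.Probability" "Jordan_Normal_Form.Matrix"
begin

no_notation inner (infix \<open>\<bullet>\<close> 70)
no_notation vec_nth (infixl \<open>$\<close> 90)

text \<open>
  Probability distributions on the real line are the measures satisfying the library predicate
  \<^const>\<open>real_distribution\<close>. The second argument of \<^const>\<open>normal_density\<close> is the standard
  deviation, so the density of $N(0,s^2)$ at \<open>x\<close> is \<open>normal_density 0 s x\<close>.
\<close>

definition supp :: "real measure \<Rightarrow> real set" where
  "supp G = {x. \<forall>T. open T \<and> x \<in> T \<longrightarrow> measure G T > 0}"

definition std_normal :: "real measure" where
  "std_normal = density lborel std_normal_density"


subsection \<open>Matrices\<close>

definition pos_semidef :: "nat \<Rightarrow> real mat \<Rightarrow> bool" where
  "pos_semidef n A \<longleftrightarrow> A \<in> carrier_mat n n \<and> transpose_mat A = A \<and>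
     (\<forall>v \<in> carrier_vec n. v \<bullet> (A *\<^sub>v v) \<ge> 0)"

text \<open>A positive semidefinite matrix \<open>A\<close> has exactly one positive semidefinite root \<open>S\<close>.\<close>

definition psd_sqrt :: "nat \<Rightarrow> real mat \<Rightarrow> real mat \<Rightarrow> bool" where
  "psd_sqrt n A S \<longleftrightarrow> pos_semidef n S \<and> S * S = A"

definition euclid_norm :: "real vec \<Rightarrow> real" where
  "euclid_norm v = sqrt (v \<bullet> v)"

definition op_norm :: "nat \<Rightarrow> real mat \<Rightarrow> real" where
  "op_norm n A = (SUP v \<in> {v \<in> carrier_vec n. euclid_norm v = 1}. euclid_norm (A *\<^sub>v v))"

definition correlation_mat :: "nat \<Rightarrow> real mat \<Rightarrow> real mat" where
  "correlation_mat n Cov =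
     (let R = mat_diag n (\<lambda>i. 1 / sqrt (Cov $$ (i, i))) in R * Cov * R)"

definition n_star :: "nat \<Rightarrow> real mat \<Rightarrow> real" where
  "n_star n Cov = real n / op_norm n (correlation_mat n Cov)"

definition marginal_sd :: "real mat \<Rightarrow> nat \<Rightarrow> real" where
  "marginal_sd Cov j = sqrt (Cov $$ (j, j))"


subsection \<open>The correlated Gaussian sequence model\<close>

text \<open>
  Coordinates are indexed by \<open>{..<n}\<close>. The sample space consists of the pairs \<open>(\<beta>, z)\<close> and carries
  the joint law of $(\beta_0, \mathsf Z_n)$: all \<open>2 * n\<close> coordinates are independent, those
  of \<open>\<beta>\<close> with distribution \<open>G0\<close> and those of \<open>z\<close> standard normal. Fixing this concrete
  realisation loses no generality, because statements about \<open>U\<close> depend only on this joint law; it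
  allows constants to be chosen before, and hence independently of, the probability space.
\<close>

definition model :: "nat \<Rightarrow> real measure \<Rightarrow> ((nat \<Rightarrow> real) \<times> (nat \<Rightarrow> real)) measure" where
  "model n G0 = (\<Pi>\<^sub>M i\<in>{..<n}. G0) \<Otimes>\<^sub>M (\<Pi>\<^sub>M i\<in>{..<n}. std_normal)"

text \<open>Here \<open>S\<close> is the square root of the covariance matrix.\<close>

definition observation :: "nat \<Rightarrow> real mat \<Rightarrow> (nat \<Rightarrow> real) \<times> (nat \<Rightarrow> real) \<Rightarrow> real vec" where
  "observation n S = (\<lambda>(\<beta>, z). Matrix.vec n \<beta> + S *\<^sub>v Matrix.vec n z)"


subsection \<open>Mixture densities, the estimator and the regret\<close>

definition mixture_density :: "real measure \<Rightarrow> real \<Rightarrow> real \<Rightarrow> real" where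
  "mixture_density G s x = (\<integral>u. normal_density 0 s (x - u) \<partial>G)"

definition composite_loglik :: "nat \<Rightarrow> (nat \<Rightarrow> real) \<Rightarrow> real vec \<Rightarrow> real measure \<Rightarrow> real" where
  "composite_loglik n s u G = (1 / real n) * (\<Sum>j<n. ln (mixture_density G (s j) (u $ j)))"

definition npmle_set :: "nat \<Rightarrow> (nat \<Rightarrow> real) \<Rightarrow> real vec \<Rightarrow> real measure set" where
  "npmle_set n s u = {G. real_distribution G \<and>
     (\<forall>H. real_distribution H \<longrightarrow> composite_loglik n s u H \<le> composite_loglik n s u G)}"

definition posterior_mean :: "real measure \<Rightarrow> real \<Rightarrow> real \<Rightarrow> real" where
  "posterior_mean G s u =
     (1 / mixture_density G s u) * (\<integral>\<theta>. \<theta> * normal_density 0 s (u - \<theta>) \<partial>G)"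

text \<open>
  For \<open>s > 0\<close> and probability distributions \<open>G\<close>, \<open>G0\<close> with \<open>G0\<close> compactly supported the
  integrand in \<open>bayes_risk\<close> is integrable: the mixture density of \<open>G\<close> is at least
  $c\,e^{-(|x|+K)^2/(2s^2)}$ for some $c, K > 0$, hence the posterior mean grows at most linearly.
\<close>

definition bayes_risk :: "real measure \<Rightarrow> real measure \<Rightarrow> real \<Rightarrow> real" where
  "bayes_risk G G0 s =
     (\<integral>(\<theta>, z). (posterior_mean G s (\<theta> + s * z) - \<theta>)\<^sup>2 \<partial>(G0 \<Otimes>\<^sub>M std_normal))"

definition regret :: "nat \<Rightarrow> (nat \<Rightarrow> real) \<Rightarrow> real measure \<Rightarrow> real measure \<Rightarrow> real" where
  "regret n s G G0 = (1 / real n) * (\<Sum>j<n. bayes_risk G G0 (s j) - bayes_risk G0 G0 (s j))"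

end

theory Submission
  imports Defs
begin

text \<open>
  Write \<open>p\<close> for the operator norm of the correlation matrix. If \<open>X\<close> is a Gaussian vector with unit
  variances and correlation matrix at most \<open>p\<close> times the identity, then
  $E \prod_j g_j(X_j)^{1/p} \le \prod_j (E g_j(X_j))^{1/p}$: along the heat flow the product of the powers
  $1/p$ of the conditional expectations of the $g_j(X_j)$ is a supermartingale. Applied to square roots
  of likelihood ratios this turns the classical proof of the Hellinger rate of a maximum likelihood
  estimator for independent data into one for correlated data, with \<open>n\<close> replaced by
  $n_\ast = n/p$; the union bound runs over classes of mixing measures with nearly equal truncated
  moments. By Tweedie's formula the regret is a weighted distance of the
  scores $f'/f$, and repeated integration by parts bounds it by the squared Hellinger distance up to
  logarithms.
\<close>

section \<open>Derivatives of Gaussian densities and of Gaussian mixtures\<close>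

text \<open>The exponent 1/p is forced by a second-order balance. Over a short time, and up to a
  common factor, the product with exponent \<alpha> gains \<alpha>^2 times the variance of sum_j b_j
  X_j, at most \<alpha>^2 p sum_j b_j^2, and loses \<alpha> sum_j b_j^2 by concavity; \<alpha> = 1/p
  makes the two cancel. The price appears in Markov's inequality, where a total squared Hellinger
  distance E is felt only as E/(2p). Two obstacles shape the rest. The estimator may put mass
  arbitrarily far away: classes are therefore built from moments truncated at a radius of order log
  n, and its posterior mean is controlled only because the likelihood forces some mass near the
  origin. Moreover the prior's mixture density is bounded below only by exp(-c (log n)^2) on the
  relevant range. A floor \<rho> of that size enters K integrations by parts as \<rho>^(-1/(2K)), so
  K must be of order (log n)^2 to make it a constant. The number of classes costs (log n)^5 and the
  score bound (log n)^8, whence the power 13.\<close>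

lemma one_le_two_pi_mult:
  fixes x :: real
  assumes "x \<ge> 1"
  shows "1 \<le> 2 * pi * x"
proof -
  have "1 * 1 \<le> 2 * pi * x" using pi_ge_two assms by (intro mult_mono) auto
  then show ?thesis by simp
qed

text \<open>The derivatives of the centred normal density \<phi>: differentiating
  \<open>\<phi>' = - (x / s\<^sup>2) * \<phi>\<close> repeatedly leaves this three-term recursion,
  which is the one behind the Hermite polynomials.\<close>

fun gauss_deriv :: "nat \<Rightarrow> real \<Rightarrow> real \<Rightarrow> real" where
  "gauss_deriv 0 s x = normal_density 0 s x"
| "gauss_deriv (Suc 0) s x = - (x / s\<^sup>2) * normal_density 0 s x"
| "gauss_deriv (Suc (Suc k)) s x =
     - (x * gauss_deriv (Suc k) s x + real (Suc k) * gauss_deriv k s x) / s\<^sup>2"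

lemma normal_density_has_deriv:
  assumes "s > 0"
  shows "(normal_density 0 s has_real_derivative - (x / s\<^sup>2) * normal_density 0 s x) (at x)"
  unfolding normal_density_def using assms
  by (auto intro!: derivative_eq_intros simp: power2_eq_square field_simps)

lemma gauss_deriv_has_deriv:
  assumes "s > 0"
  shows "(gauss_deriv k s has_real_derivative gauss_deriv (Suc k) s x) (at x)"
proof -
  \<comment> \<open>The recursion reaches back two orders, so two consecutive orders are carried
    through the induction.\<close>
  have "(gauss_deriv k s has_real_derivative gauss_deriv (Suc k) s x) (at x) \<and>
    (gauss_deriv (Suc k) s has_real_derivative gauss_deriv (Suc (Suc k)) s x) (at x)"
  proof (induction k)
    case 0
    have e0: "gauss_deriv 0 s = normal_density 0 s" by (rule ext) simp
    have e1: "gauss_deriv (Suc 0) s = (\<lambda>x. - (x / s\<^sup>2) * normal_density 0 s x)" by (rule ext) simp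
    show ?case unfolding e0 e1
      using assms normal_density_has_deriv[OF assms]
      by (auto intro!: derivative_eq_intros simp: field_simps)
  next
    case (Suc k)
    have e: "gauss_deriv (Suc (Suc k)) s =
      (\<lambda>x. - (x * gauss_deriv (Suc k) s x + real (Suc k) * gauss_deriv k s x) / s\<^sup>2)"
      by (rule ext) simp
    have "(gauss_deriv (Suc (Suc k)) s has_real_derivative gauss_deriv (Suc (Suc (Suc k))) s x) (at x)"
      unfolding e using Suc assms
      by (auto intro!: derivative_eq_intros simp del: gauss_deriv.simps(3)
          simp: gauss_deriv.simps(3)[of "Suc k"] field_simps)
    with Suc show ?case by blast
  qed
  then show ?thesis by blast
qed

lemma borel_measurable_gauss_deriv [measurable]:
  "gauss_deriv k s \<in> borel_measurable borel"
proof (induction k rule: induct_nat_012)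
  case 0
  have "gauss_deriv 0 s = normal_density 0 s" by (rule ext) simp
  then show ?case by simp
next
  case 1
  have "gauss_deriv (Suc 0) s = (\<lambda>x. - (x / s\<^sup>2) * normal_density 0 s x)" by (rule ext) simp
  then show ?case by simp
next
  case (ge2 n)
  have e: "gauss_deriv (Suc (Suc n)) s =
      (\<lambda>x. - (x * gauss_deriv (Suc n) s x + real (Suc n) * gauss_deriv n s x) / s\<^sup>2)"
      by (rule ext) simp
  show ?case unfolding e using ge2 by measurable
qed

lemma power_le_fact_mult_exp:
  fixes x :: real
  assumes "x \<ge> 0"
  shows "x ^ k \<le> fact k * exp x"
proof -
  have "(\<Sum>n\<in>{k}. x ^ n /\<^sub>R fact n) \<le> (\<Sum>n. x ^ n /\<^sub>R fact n)"
    using assms exp_converges[of x] by (intro sum_le_suminf) (auto simp: sums_iff)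
  then show ?thesis using exp_converges[of x] by (simp add: sums_iff field_simps)
qed

text \<open>Completing the square: doubling the variance frees a Gaussian factor that beats any
  exponential in \<bar>x\<bar> at the price of a constant. All later absorptions of polynomial
  factors go through this.\<close>

lemma exp_abs_mult_normal_density_le:
  assumes "\<sigma> > 0"
  shows "exp (k * \<bar>x\<bar>) * normal_density 0 \<sigma> x
    \<le> sqrt 2 * exp (k\<^sup>2 * \<sigma>\<^sup>2) * normal_density 0 (sqrt 2 * \<sigma>) x"
proof -
  have "0 \<le> (\<bar>x\<bar> / (2 * \<sigma>) - k * \<sigma>)\<^sup>2" by simp
  also have "\<dots> = x\<^sup>2 / (4 * \<sigma>\<^sup>2) - k * \<bar>x\<bar> + k\<^sup>2 * \<sigma>\<^sup>2"
    using assms by (simp add: power2_diff power_divide power_mult_distrib)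
  finally have "k * \<bar>x\<bar> - x\<^sup>2 / (2 * \<sigma>\<^sup>2) \<le> k\<^sup>2 * \<sigma>\<^sup>2 - x\<^sup>2 / (4 * \<sigma>\<^sup>2)"
    by (simp add: field_simps)
  then have "exp (k * \<bar>x\<bar>) * exp (- x\<^sup>2 / (2 * \<sigma>\<^sup>2)) \<le> exp (k\<^sup>2 * \<sigma>\<^sup>2) * exp (- x\<^sup>2 / (4 * \<sigma>\<^sup>2))"
    by (simp flip: exp_add)
  then have "exp (k * \<bar>x\<bar>) * exp (- x\<^sup>2 / (2 * \<sigma>\<^sup>2)) / sqrt (2 * pi * \<sigma>\<^sup>2)
     \<le> exp (k\<^sup>2 * \<sigma>\<^sup>2) * exp (- x\<^sup>2 / (4 * \<sigma>\<^sup>2)) / sqrt (2 * pi * \<sigma>\<^sup>2)"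
    by (rule divide_right_mono) simp
  moreover have "sqrt (2 * pi * (sqrt 2 * \<sigma>)\<^sup>2) = sqrt 2 * sqrt (2 * pi * \<sigma>\<^sup>2)"
    by (simp add: real_sqrt_mult[symmetric] power_mult_distrib algebra_simps)
  ultimately show ?thesis
    unfolding normal_density_def using assms by (simp add: power_mult_distrib mult.assoc)
qed

text \<open>Envelopes and constants defined in this locale mention only \<open>M\<close>, not
  \<open>s\<close>, so every bound stated with them is uniform over the noise levels of the
  coordinates.\<close>

locale noise_level =
  fixes M s :: real
  assumes M1: "M > 1" and s0: "s > 0" and s2_lower: "1 / M \<le> s\<^sup>2" and s2_upper: "s\<^sup>2 \<le> M"
begin

lemma inv_s2_le: "1 / s\<^sup>2 \<le> M"
  using s2_lower s0 M1 by (simp add: field_simps)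

lemma normal_density_le: "normal_density 0 s x \<le> M * normal_density 0 (sqrt M) x"
proof -
  have "exp (- x\<^sup>2 / (2 * s\<^sup>2)) \<le> exp (- x\<^sup>2 / (2 * M))"
    using s2_upper s0 M1 by (auto intro!: divide_left_mono)
  moreover have "1 / sqrt (2 * pi * s\<^sup>2) \<le> M / sqrt (2 * pi * M)"
  proof -
    have "1 / sqrt (2 * pi * s\<^sup>2) = sqrt (1 / (2 * pi * s\<^sup>2))" by (simp add: real_sqrt_divide)
    also have "\<dots> \<le> sqrt (M / (2 * pi))"
      using inv_s2_le s0 M1 by (intro real_sqrt_le_mono) (simp add: field_simps)
    also have "\<dots> = sqrt (M\<^sup>2 / (2 * pi * M))" using M1 by (simp add: power2_eq_square)
    also have "\<dots> = M / sqrt (2 * pi * M)" using M1 by (simp only: real_sqrt_divide) simp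
    finally show ?thesis .
  qed
  ultimately have "1 / sqrt (2 * pi * s\<^sup>2) * exp (- x\<^sup>2 / (2 * s\<^sup>2))
      \<le> M / sqrt (2 * pi * M) * exp (- x\<^sup>2 / (2 * M))"
    using M1 by (intro mult_mono) auto
  then show ?thesis using M1 by (simp add: normal_density_def)
qed

definition gauss_env :: "real \<Rightarrow> real" where
  "gauss_env x = normal_density 0 (sqrt 2 * sqrt M) x"

text \<open>One factorial comes from the recursion, the other from bounding
  \<open>(1 + \<bar>x\<bar>) ^ k\<close> by \<open>fact k * exp (1 + \<bar>x\<bar>)\<close>; the
  prefactor is the cost of absorbing that exponential into the wider Gaussian. The k-th root grows
  like k^2, which decides the power of the logarithm in \<open>interpolation\<close>.\<close>

definition gauss_const :: "nat \<Rightarrow> real" where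
  "gauss_const k = sqrt 2 * M * exp (1 + M) * (2 * M) ^ k * (fact k)\<^sup>2"

lemma gauss_const_pos: "gauss_const k > 0"
  unfolding gauss_const_def using M1 by simp

lemma gauss_env_nonneg [simp]: "0 \<le> gauss_env x"
  by (simp add: gauss_env_def)

lemma gauss_env_measurable [measurable]: "gauss_env \<in> borel_measurable borel"
  unfolding gauss_env_def[abs_def] by simp

lemma gauss_env_integrable: "integrable lborel gauss_env" "(\<integral>x. gauss_env x \<partial>lborel) = 1"
  using M1 by (auto simp: gauss_env_def[abs_def])

lemma gauss_env_le_1: "gauss_env x \<le> 1"
proof -
  have "1 \<le> 2 * pi * (2 * M)" by (rule one_le_two_pi_mult) (use M1 in simp)
  then have "1 \<le> sqrt (2 * pi * (2 * M))" by simp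
  then have "1 / sqrt (2 * pi * (2 * M)) * exp (- x\<^sup>2 / (2 * (2 * M))) \<le> 1 * 1"
    using M1 by (intro mult_mono) auto
  then show ?thesis unfolding gauss_env_def normal_density_def using M1
    by (simp add: power_mult_distrib)
qed

text \<open>Each order contributes 1 / s^2, at most \<open>M\<close>; the base \<open>2 * M\<close>
  instead leaves room for adding the two terms of the recursion.\<close>

lemma gauss_deriv_poly_bound:
  "\<bar>gauss_deriv k s x\<bar> \<le> (2 * M) ^ k * fact k * (1 + \<bar>x\<bar>) ^ k * normal_density 0 s x"
proof (induction k rule: induct_nat_012)
  case 0
  then show ?case using s0 by simp
next
  case 1
  have "\<bar>x\<bar> / s\<^sup>2 \<le> M * \<bar>x\<bar>" using mult_right_mono[OF inv_s2_le, of "\<bar>x\<bar>"] by simp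
  also have "\<dots> \<le> 2 * M * (1 + \<bar>x\<bar>)" using M1 by (simp add: algebra_simps)
  finally have "\<bar>x\<bar> / s\<^sup>2 * normal_density 0 s x \<le> 2 * M * (1 + \<bar>x\<bar>) * normal_density 0 s x"
    by (rule mult_right_mono) simp
  then show ?case by (simp add: abs_mult)
next
  case (ge2 k)
  define \<phi> where "\<phi> = normal_density 0 s x"
  have \<phi>: "\<phi> \<ge> 0" by (simp add: \<phi>_def)
  define y where "y = 1 + \<bar>x\<bar>"
  have y: "1 \<le> y" "\<bar>x\<bar> \<le> y" by (auto simp: y_def)
  define a where "a = (2 * M) ^ k * fact k * y ^ k * \<phi>"
  have a0: "a \<ge> 0" using M1 y \<phi> by (simp add: a_def)
  have b1: "\<bar>gauss_deriv k s x\<bar> \<le> a" using ge2(1) by (simp add: a_def y_def \<phi>_def)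
  have b2: "\<bar>gauss_deriv (Suc k) s x\<bar> \<le> 2 * M * (1 + real k) * y * a"
    using ge2(2) by (simp add: a_def y_def \<phi>_def algebra_simps)
  have "\<bar>gauss_deriv (Suc (Suc k)) s x\<bar> =
     \<bar>x * gauss_deriv (Suc k) s x + real (Suc k) * gauss_deriv k s x\<bar> * (1 / s\<^sup>2)"
    unfolding gauss_deriv.simps(3) abs_divide abs_minus_cancel
    by (simp only: abs_power2 times_divide_eq_right mult_1_right)
  also have "\<dots> \<le> (y * (2 * M * (1 + real k) * y * a) + (1 + real k) * a) * M"
  proof (intro mult_mono inv_s2_le)
    have "\<bar>x * gauss_deriv (Suc k) s x\<bar> \<le> y * (2 * M * (1 + real k) * y * a)"
      unfolding abs_mult using y b2 by (intro mult_mono) auto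
    moreover have "\<bar>real (Suc k) * gauss_deriv k s x\<bar> \<le> (1 + real k) * a"
      unfolding abs_mult using b1 by (intro mult_mono) auto
    ultimately show "\<bar>x * gauss_deriv (Suc k) s x + real (Suc k) * gauss_deriv k s x\<bar>
       \<le> y * (2 * M * (1 + real k) * y * a) + (1 + real k) * a" by linarith
  qed (use M1 y a0 in auto)
  also have "\<dots> \<le> (2 * M) * (2 * M) * (2 + real k) * (1 + real k) * y * y * a"
  proof -
    have "(1 + real k) * a * M \<le> (2 * M) * M * (1 + real k) * y * y * a"
    proof -
      have "1 \<le> y * y" using y by (metis mult_le_cancel_left1 mult_mono order_trans zero_le_one le_numeral_extra(4) mult_1)
      then have "1 \<le> 2 * M * (y * y)" using M1
        by (smt (verit) mult_le_cancel_left1 mult_less_cancel_right1)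
      then have "1 * ((1 + real k) * a * M) \<le> 2 * M * (y * y) * ((1 + real k) * a * M)"
        using a0 M1 by (intro mult_right_mono) auto
      then show ?thesis by (simp add: mult_ac)
    qed
    moreover define c where "c = M * M * (1 + real k) * y * y * a"
    moreover have "0 \<le> c" "0 \<le> real k * c" using M1 y a0 by (auto simp: c_def)
    moreover have "(2 * M) * (2 * M) * (2 + real k) * (1 + real k) * y * y * a = 8 * c + 4 * (real k * c)"
      by (simp add: c_def algebra_simps)
    moreover have "(y * (2 * M * (1 + real k) * y * a) + (1 + real k) * a) * M
      = 2 * c + (1 + real k) * a * M"
      by (simp add: c_def algebra_simps)
    moreover have "(2 * M) * M * (1 + real k) * y * y * a = 2 * c" by (simp add: c_def)
    ultimately show ?thesis by linarith
  qed
  also have "\<dots> = (2 * M) ^ Suc (Suc k) * fact (Suc (Suc k)) * y ^ Suc (Suc k) * \<phi>"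
    by (simp add: a_def mult_ac)
  finally show ?case by (simp add: y_def \<phi>_def)
qed

lemma gauss_deriv_le_env: "\<bar>gauss_deriv k s x\<bar> \<le> gauss_const k * gauss_env x"
proof -
  have p: "(1 + \<bar>x\<bar>) ^ k \<le> fact k * exp (1 + \<bar>x\<bar>)"
    by (rule power_le_fact_mult_exp) simp
  have "normal_density 0 s x * exp (1 + \<bar>x\<bar>)
      \<le> M * normal_density 0 (sqrt M) x * exp (1 + \<bar>x\<bar>)"
    using normal_density_le by (intro mult_right_mono) auto
  also have "\<dots> = M * exp 1 * (exp (1 * \<bar>x\<bar>) * normal_density 0 (sqrt M) x)"
    by (simp add: exp_add mult_ac)
  also have "\<dots> \<le> M * exp 1 * (sqrt 2 * exp (1\<^sup>2 * (sqrt M)\<^sup>2) * normal_density 0 (sqrt 2 * sqrt M) x)"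
    using M1 by (intro mult_left_mono exp_abs_mult_normal_density_le) auto
  finally have n: "normal_density 0 s x * exp (1 + \<bar>x\<bar>) \<le> sqrt 2 * M * exp (1 + M) * gauss_env x"
    using M1 by (simp add: gauss_env_def exp_add mult_ac)
  have "\<bar>gauss_deriv k s x\<bar> \<le> (2 * M) ^ k * fact k * (1 + \<bar>x\<bar>) ^ k * normal_density 0 s x"
    by (rule gauss_deriv_poly_bound)
  also have "\<dots> \<le> (2 * M) ^ k * fact k * (fact k * exp (1 + \<bar>x\<bar>)) * normal_density 0 s x"
    using p M1 by (intro mult_mono mult_left_mono mult_right_mono) auto
  also have "\<dots> = (2 * M) ^ k * (fact k)\<^sup>2 * (normal_density 0 s x * exp (1 + \<bar>x\<bar>))"
    by (simp add: power2_eq_square mult_ac)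
  also have "\<dots> \<le> (2 * M) ^ k * (fact k)\<^sup>2 * (sqrt 2 * M * exp (1 + M) * gauss_env x)"
    using n M1 by (intro mult_left_mono) auto
  finally show ?thesis by (simp add: gauss_const_def mult_ac)
qed

lemma gauss_deriv_bounded: "\<bar>gauss_deriv k s x\<bar> \<le> gauss_const k"
  using gauss_deriv_le_env[of k x] gauss_const_pos[of k] gauss_env_le_1[of x]
  by (smt (verit) mult_left_le)

end

section \<open>Differentiation of mixtures through uniform Taylor bounds\<close>

lemma taylor_second_order_bound:
  fixes f :: "real \<Rightarrow> real"
  assumes d1: "\<And>x. (f has_real_derivative f1 x) (at x)"
    and d2: "\<And>x. (f1 has_real_derivative f2 x) (at x)"
    and b: "\<And>x. \<bar>f2 x\<bar> \<le> C"
  shows "\<bar>f (x + h) - f x - f1 x * h\<bar> \<le> C * h\<^sup>2"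
proof -
  have lip: "\<bar>f1 y - f1 x\<bar> \<le> C * \<bar>y - x\<bar>" for y
  proof -
    have "norm (f1 y - f1 x) \<le> C * norm (y - x)"
      by (rule field_differentiable_bound[of UNIV f1 f2]) (use d2 b in auto)
    then show ?thesis by simp
  qed
  have C0: "C \<ge> 0" using b[of 0] by linarith
  have "norm ((\<lambda>t. f t - f1 x * t) (x + h) - (\<lambda>t. f t - f1 x * t) x) \<le> (C * \<bar>h\<bar>) * norm ((x + h) - x)"
  proof (rule field_differentiable_bound[of "closed_segment x (x + h)" _ "\<lambda>t. f1 t - f1 x"])
    fix t assume t: "t \<in> closed_segment x (x + h)"
    show "((\<lambda>t. f t - f1 x * t) has_field_derivative f1 t - f1 x) (at t within closed_segment x (x + h))"
      by (auto intro!: derivative_eq_intros has_field_derivative_at_within[OF d1])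
    have "\<bar>t - x\<bar> \<le> \<bar>h\<bar>" using t by (auto simp: closed_segment_eq_real_ivl split: if_splits)
    then show "norm (f1 t - f1 x) \<le> C * \<bar>h\<bar>"
      using lip[of t] C0 by (smt (verit) mult_left_mono real_norm_def)
  qed auto
  then show ?thesis by (simp add: algebra_simps power2_eq_square abs_mult_self_eq mult.assoc)
qed

text \<open>The counterpart of the preceding bound. A quadratic error that is uniform in the mixing
  variable survives integration against a probability measure, so the pair yields differentiation
  under the integral sign.\<close>

lemma has_real_derivative_quadratic_error:
  fixes f :: "real \<Rightarrow> real"
  assumes "\<And>h. \<bar>f (x + h) - f x - D * h\<bar> \<le> C * h\<^sup>2"
  shows "(f has_real_derivative D) (at x)"
proof -
  have "((\<lambda>h. (f (x + h) - f x) / h - D) \<longlongrightarrow> 0) (at 0)"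
  proof (rule Lim_null_comparison)
    show "\<forall>\<^sub>F h in at 0. norm ((f (x + h) - f x) / h - D) \<le> C * \<bar>h\<bar>"
    proof (rule eventually_at_topological[THEN iffD2], intro exI[of _ UNIV] conjI ballI impI)
      fix h :: real assume "h \<noteq> 0"
      have "norm ((f (x + h) - f x) / h - D) = \<bar>f (x + h) - f x - D * h\<bar> / \<bar>h\<bar>"
        using \<open>h \<noteq> 0\<close> by (simp add: field_simps flip: abs_divide)
      also have "\<dots> \<le> C * h\<^sup>2 / \<bar>h\<bar>" by (intro divide_right_mono assms) auto
      also have "\<dots> = C * \<bar>h\<bar>" using \<open>h \<noteq> 0\<close>
        by (metis (no_types, opaque_lifting) abs_eq_0 nonzero_mult_div_cancel_right power2_abs power2_eq_square times_divide_eq_right)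
      finally show "norm ((f (x + h) - f x) / h - D) \<le> C * \<bar>h\<bar>" .
    qed auto
    show "((\<lambda>h. C * \<bar>h\<bar>) \<longlongrightarrow> 0) (at 0)"
      by (auto intro!: tendsto_eq_intros)
  qed
  then show ?thesis by (simp add: DERIV_def LIM_zero_iff)
qed

lemma convolution_prob_integral:
  fixes \<psi> :: "real \<Rightarrow> real"
  assumes G: "real_distribution G" and \<psi>: "integrable lborel \<psi>"
  shows "integrable (G \<Otimes>\<^sub>M lborel) (\<lambda>(u, x). \<psi> (x - u))"
    and "integrable lborel (\<lambda>x. \<integral>u. \<psi> (x - u) \<partial>G)"
    and "(\<integral>x. (\<integral>u. \<psi> (x - u) \<partial>G) \<partial>lborel) = (\<integral>x. \<psi> x \<partial>lborel)"
proof -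
  interpret G: real_distribution G by (rule G)
  interpret P: pair_sigma_finite G lborel ..
  have [measurable]: "\<psi> \<in> borel_measurable borel" using \<psi> by auto
  have tr: "integrable lborel (\<lambda>x. \<phi> (x - u))" "(\<integral>x. \<phi> (x - u) \<partial>lborel) = (\<integral>x. \<phi> x \<partial>lborel)"
    if "integrable lborel \<phi>" for \<phi> :: "real \<Rightarrow> real" and u
    using lborel_integrable_real_affine[OF that, of 1 "- u"] lborel_integral_real_affine[of 1 \<phi> "- u"] by simp_all
  show i: "integrable (G \<Otimes>\<^sub>M lborel) (\<lambda>(u, x). \<psi> (x - u))"
    by (rule P.Fubini_integrable) (use tr[of "\<lambda>x. \<bar>\<psi> x\<bar>"] tr[OF \<psi>] \<psi> in auto)
  show "integrable lborel (\<lambda>x. \<integral>u. \<psi> (x - u) \<partial>G)"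
    using P.integrable_snd[of "\<lambda>u x. \<psi> (x - u)"] i by simp
  have "(\<integral>x. (\<integral>u. \<psi> (x - u) \<partial>G) \<partial>lborel) = (\<integral>u. (\<integral>x. \<psi> (x - u) \<partial>lborel) \<partial>G)"
    by (rule P.Fubini_integral) (rule i)
  also have "\<dots> = (\<integral>x. \<psi> x \<partial>lborel)" using tr[OF \<psi>] G.prob_space by simp
  finally show "(\<integral>x. (\<integral>u. \<psi> (x - u) \<partial>G) \<partial>lborel) = (\<integral>x. \<psi> x \<partial>lborel)" .
qed

text \<open>For \<open>k = 0\<close> the mixture density. The kernel is differentiated, not the
  mixture, so the value makes sense before any smoothness of the mixture is known;
  \<open>mix_has_deriv\<close> then identifies it with the k-th derivative.\<close>

definition mix :: "nat \<Rightarrow> real measure \<Rightarrow> real \<Rightarrow> real \<Rightarrow> real" where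
  "mix k G s x = (\<integral>u. gauss_deriv k s (x - u) \<partial>G)"

lemma mixture_density_eq_mix: "mixture_density G s = mix 0 G s"
  by (rule ext) (simp add: mixture_density_def mix_def)

context noise_level
begin

lemma gauss_env_sq_le: "x\<^sup>2 * gauss_env x \<le> 4 * M"
proof -
  have "x\<^sup>2 / (4 * M) \<le> exp (x\<^sup>2 / (4 * M))"
    using exp_ge_add_one_self[of "x\<^sup>2 / (4 * M)"] by linarith
  then have "x\<^sup>2 \<le> 4 * M * exp (x\<^sup>2 / (4 * M))" using M1 by (simp add: field_simps)
  from mult_right_mono[OF this, of "exp (- (x\<^sup>2 / (4 * M)))"]
  have "x\<^sup>2 * exp (- (x\<^sup>2 / (4 * M))) \<le> 4 * M" by (simp add: mult.assoc mult_exp_exp)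
  moreover have "1 / sqrt (2 * pi * (2 * M)) \<le> 1"
  proof -
    have "1 \<le> 2 * pi * (2 * M)" by (rule one_le_two_pi_mult) (use M1 in simp)
    then show ?thesis by simp
  qed
  ultimately have "1 / sqrt (2 * pi * (2 * M)) * (x\<^sup>2 * exp (- (x\<^sup>2 / (4 * M)))) \<le> 1 * (4 * M)"
    using M1 by (intro mult_mono[of _ 1 _ "4 * M"]) auto
  then show ?thesis using M1
    by (simp add: gauss_env_def normal_density_def power_mult_distrib mult_ac)
qed

lemma gauss_deriv_integrable: "integrable lborel (gauss_deriv k s)"
  by (rule Bochner_Integration.integrable_bound[of _ "\<lambda>x. gauss_const k * gauss_env x"])
     (use gauss_env_integrable in \<open>auto intro!: AE_I2 order_trans[OF gauss_deriv_le_env]\<close>)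

lemma mix_0_pos: assumes "real_distribution G" shows "mix 0 G s x > 0"
proof -
  interpret G: real_distribution G by fact
  have "(\<integral>u. gauss_deriv 0 s (x - u) \<partial>G) > 0"
    using s0 normal_density_pos gauss_deriv_bounded[of 0]
    by (intro G.integral_less_AE_space[of "\<lambda>_. 0", simplified])
       (auto intro!: G.integrable_const_bound[where B = "gauss_const 0"] simp: G.emeasure_space_1[simplified] simp del: abs_of_nonneg)
  then show ?thesis by (simp add: mix_def)
qed

context
  fixes G :: "real measure"
  assumes G: "real_distribution G"
begin

interpretation G: real_distribution G by (rule G)

lemma mix_integrand_integrable: "integrable G (\<lambda>u. gauss_deriv k s (x - u))"
  by (rule G.integrable_const_bound[where B = "gauss_const k"]) (use gauss_deriv_bounded in auto)

lemma abs_mix_le: "\<bar>mix k G s x\<bar> \<le> gauss_const k"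
proof -
  have "\<bar>mix k G s x\<bar> \<le> (\<integral>u. \<bar>gauss_deriv k s (x - u)\<bar> \<partial>G)"
    unfolding mix_def by (rule integral_abs_bound)
  also have "\<dots> \<le> gauss_const k"
    using gauss_deriv_bounded mix_integrand_integrable by (intro G.integral_le_const) auto
  finally show ?thesis .
qed

lemma mix_has_deriv: "(mix k G s has_real_derivative mix (Suc k) G s x) (at x)"
proof (rule has_real_derivative_quadratic_error)
  fix h
  have eq: "mix k G s (x + h) - mix k G s x - mix (Suc k) G s x * h =
     (\<integral>u. gauss_deriv k s ((x - u) + h) - gauss_deriv k s (x - u) - gauss_deriv (Suc k) s (x - u) * h \<partial>G)"
    unfolding mix_def using mix_integrand_integrable[of k "x + h"] mix_integrand_integrable
    by (simp add: algebra_simps)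
  have b: "\<bar>gauss_deriv k s ((x - u) + h) - gauss_deriv k s (x - u) - gauss_deriv (Suc k) s (x - u) * h\<bar>
     \<le> gauss_const (Suc (Suc k)) * h\<^sup>2" for u
    by (rule taylor_second_order_bound) (use gauss_deriv_has_deriv s0 gauss_deriv_bounded in blast)+
  have i: "integrable G (\<lambda>u. gauss_deriv k s ((x - u) + h) - gauss_deriv k s (x - u) - gauss_deriv (Suc k) s (x - u) * h)"
    by (rule G.integrable_const_bound[OF AE_I2]) (use b in auto)
  show "\<bar>mix k G s (x + h) - mix k G s x - mix (Suc k) G s x * h\<bar> \<le> gauss_const (Suc (Suc k)) * h\<^sup>2"
    unfolding eq
    by (rule order_trans[OF integral_abs_bound])
       (use b i in \<open>auto intro!: G.integral_le_const\<close>)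
qed

lemma continuous_mix: "continuous_on A (mix k G s)"
  by (meson DERIV_continuous_on mix_has_deriv has_field_derivative_at_within)

lemma borel_measurable_mix [measurable]: "mix k G s \<in> borel_measurable borel"
  by (intro borel_measurable_continuous_onI continuous_mix)

lemma mix_integrable: "integrable lborel (mix k G s)"
  using convolution_prob_integral(2)[OF G gauss_deriv_integrable[of k]] by (simp add: mix_def[abs_def])

lemma integral_abs_mix_le: "(\<integral>x. \<bar>mix k G s x\<bar> \<partial>lborel) \<le> gauss_const k"
proof -
  have a: "integrable lborel (\<lambda>x. \<bar>gauss_deriv k s x\<bar>)" using gauss_deriv_integrable by auto
  have "(\<integral>x. \<bar>mix k G s x\<bar> \<partial>lborel) \<le> (\<integral>x. (\<integral>u. \<bar>gauss_deriv k s (x - u)\<bar> \<partial>G) \<partial>lborel)"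
    using integrable_abs[OF mix_integrable[of k]] convolution_prob_integral(2)[OF G a]
    by (intro integral_mono) (auto simp: mix_def[abs_def] intro: integral_abs_bound)
  also have "\<dots> = (\<integral>x. \<bar>gauss_deriv k s x\<bar> \<partial>lborel)" by (rule convolution_prob_integral(3)[OF G a])
  also have "\<dots> \<le> (\<integral>x. gauss_const k * gauss_env x \<partial>lborel)"
    using a gauss_env_integrable gauss_deriv_le_env by (intro integral_mono) auto
  also have "\<dots> = gauss_const k" using gauss_env_integrable by simp
  finally show ?thesis .
qed

lemma integral_mix_0: "(\<integral>x. mix 0 G s x \<partial>lborel) = 1"
  using convolution_prob_integral(3)[OF G gauss_deriv_integrable[of 0]] s0 by (simp add: mix_def[abs_def])

text \<open>Supplies the vanishing boundary terms of the integrations by parts. An arbitrary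
  sequence tending to infinity in modulus lets one statement serve both ends of the line. Domination
  is by a constant, since the mixing measure is finite.\<close>

lemma mix_tendsto_0:
  assumes X: "filterlim X at_infinity sequentially"
  shows "(\<lambda>n::nat. mix k G s (X n)) \<longlonglongrightarrow> 0"
proof -
  have "(\<lambda>n. \<integral>u. gauss_deriv k s (X n - u) \<partial>G) \<longlonglongrightarrow> (\<integral>u. 0 \<partial>G)"
  proof (rule integral_dominated_convergence[where w = "\<lambda>_. gauss_const k"])
    show "AE u in G. (\<lambda>n. gauss_deriv k s (X n - u)) \<longlonglongrightarrow> 0"
    proof (rule AE_I2)
      fix u
      have 1: "filterlim (\<lambda>n. X n - u) at_infinity sequentially"
        using filterlim_compose[OF tendsto_add_filterlim_at_infinity'[OF filterlim_ident tendsto_const[of "- u"]] X] by simp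
      have 2: "(\<lambda>n. inverse (X n - u)) \<longlonglongrightarrow> 0"
        by (rule filterlim_compose[OF tendsto_inverse_0 1])
      have 3: "(\<lambda>n. 4 * M * gauss_const k * (inverse (X n - u))\<^sup>2) \<longlonglongrightarrow> 0"
        using tendsto_mult[OF tendsto_const[of "4 * M * gauss_const k"] tendsto_power[OF 2, of 2]] by simp
      have ev: "\<forall>\<^sub>F n in sequentially. norm (gauss_deriv k s (X n - u)) \<le> 4 * M * gauss_const k * (inverse (X n - u))\<^sup>2"
        using filterlim_at_infinity_imp_eventually_ne[OF 1, of 0]
      proof eventually_elim
        case (elim n)
        have "gauss_env (X n - u) \<le> 4 * M * (inverse (X n - u))\<^sup>2"
          using gauss_env_sq_le[of "X n - u"] elim
          by (simp add: power_inverse field_simps zero_less_power2)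
        then have "gauss_const k * gauss_env (X n - u) \<le> gauss_const k * (4 * M * (inverse (X n - u))\<^sup>2)"
          using gauss_const_pos by (intro mult_left_mono) (auto intro: less_imp_le)
        with gauss_deriv_le_env[of k "X n - u"] show ?case by (simp add: mult_ac)
      qed
      show "(\<lambda>n. gauss_deriv k s (X n - u)) \<longlonglongrightarrow> 0"
        by (rule Lim_null_comparison[OF ev 3])
    qed
  qed (use gauss_deriv_bounded in auto)
  then show ?thesis by (simp add: mix_def)
qed

end

end

section \<open>Controlling the score difference by the Hellinger distance\<close>

lemma Cauchy_Schwarz_integral:
  fixes f g :: "'a \<Rightarrow> real"
  assumes [measurable]: "f \<in> borel_measurable N" "g \<in> borel_measurable N"
    and f: "integrable N (\<lambda>x. (f x)\<^sup>2)" and g: "integrable N (\<lambda>x. (g x)\<^sup>2)"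
  shows "integrable N (\<lambda>x. f x * g x)"
    and "\<bar>\<integral>x. f x * g x \<partial>N\<bar> \<le> sqrt (\<integral>x. (f x)\<^sup>2 \<partial>N) * sqrt (\<integral>x. (g x)\<^sup>2 \<partial>N)"
proof -
  have "\<bar>a * b\<bar> \<le> a\<^sup>2 + b\<^sup>2" for a b :: real
  proof -
    have "2 * (\<bar>a\<bar> * \<bar>b\<bar>) \<le> a\<^sup>2 + b\<^sup>2" using sum_squares_bound[of "\<bar>a\<bar>" "\<bar>b\<bar>"] by simp
    moreover have "0 \<le> \<bar>a\<bar> * \<bar>b\<bar>" by simp
    ultimately show ?thesis unfolding abs_mult by linarith
  qed
  then show i: "integrable N (\<lambda>x. f x * g x)"
    by (intro Bochner_Integration.integrable_bound[OF Bochner_Integration.integrable_add[OF f g]]) auto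
  define A B C where "A = (\<integral>x. (f x)\<^sup>2 \<partial>N)" and "B = (\<integral>x. (g x)\<^sup>2 \<partial>N)" and "C = (\<integral>x. f x * g x \<partial>N)"
  have q: "0 \<le> A + 2 * t * C + t\<^sup>2 * B" for t
  proof -
    have "0 \<le> (\<integral>x. (f x + t * g x)\<^sup>2 \<partial>N)" by simp
    also have "\<dots> = (\<integral>x. (f x)\<^sup>2 + 2 * t * (f x * g x) + t\<^sup>2 * (g x)\<^sup>2 \<partial>N)"
      by (intro Bochner_Integration.integral_cong) (auto simp: power2_eq_square algebra_simps)
    also have "\<dots> = A + 2 * t * C + t\<^sup>2 * B"
      using f g i by (simp add: A_def B_def C_def)
    finally show ?thesis .
  qed
  have B0: "B \<ge> 0" by (simp add: B_def)
  have "C\<^sup>2 \<le> A * B"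
  proof (cases "B = 0")
    case True
    have "C = 0"
    proof (rule ccontr)
      assume "C \<noteq> 0"
      with q[of "- (A + 1) / (2 * C)"] True show False by (simp add: field_simps)
    qed
    then show ?thesis using True by simp
  next
    case False
    with q[of "- C / B"] B0 show ?thesis by (simp add: field_simps power2_eq_square)
  qed
  then have "\<bar>C\<bar> \<le> sqrt (A * B)" by (rule real_le_rsqrt[of "\<bar>C\<bar>", simplified])
  then show "\<bar>\<integral>x. f x * g x \<partial>N\<bar> \<le> sqrt (\<integral>x. (f x)\<^sup>2 \<partial>N) * sqrt (\<integral>x. (g x)\<^sup>2 \<partial>N)"
    by (simp add: A_def B_def C_def real_sqrt_mult)
qed

text \<open>The form in which integration by parts is used: the integrand is recognised as a total
  derivative, integrated over \<open>{- real n..real n}\<close>, and the boundary values vanish in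
  the limit.\<close>

lemma integral_deriv_eq_0:
  fixes F :: "real \<Rightarrow> real"
  assumes d: "\<And>x. (F has_real_derivative F' x) (at x)"
    and c: "continuous_on UNIV F'" and i: "integrable lborel F'"
    and l1: "(\<lambda>n::nat. F (real n)) \<longlonglongrightarrow> 0" and l2: "(\<lambda>n::nat. F (- real n)) \<longlonglongrightarrow> 0"
  shows "(\<integral>x. F' x \<partial>lborel) = 0"
proof (rule LIMSEQ_unique)
  have m: "F' \<in> borel_measurable borel" by (rule borel_measurable_continuous_onI[OF c])
  show "(\<lambda>n::nat. \<integral>x. F' x * indicator {- real n..real n} x \<partial>lborel) \<longlonglongrightarrow> (\<integral>x. F' x \<partial>lborel)"
  proof (rule integral_dominated_convergence[where w = "\<lambda>x. \<bar>F' x\<bar>"])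
    show "AE x in lborel. (\<lambda>n::nat. F' x * indicator {- real n..real n} x) \<longlonglongrightarrow> F' x"
    proof (rule AE_I2, rule tendsto_eventually)
      fix x :: real
      have "\<forall>\<^sub>F n in sequentially. \<bar>x\<bar> \<le> real n"
        using eventually_ge_at_top[of "nat \<lceil>\<bar>x\<bar>\<rceil>"] by eventually_elim linarith
      then show "\<forall>\<^sub>F n in sequentially. F' x * indicator {- real n..real n} x = F' x"
        by eventually_elim (auto simp: abs_le_iff)
    qed
  qed (use i m in \<open>auto simp: indicator_def\<close>)
  have "(\<integral>x. F' x * indicator {- real n..real n} x \<partial>lborel) = F (real n) - F (- real n)" for n :: nat
    by (rule integral_FTC_Icc_real) (use d c in \<open>auto intro: continuous_on_interior\<close>)
  with tendsto_diff[OF l1 l2]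
  show "(\<lambda>n::nat. \<integral>x. F' x * indicator {- real n..real n} x \<partial>lborel) \<longlonglongrightarrow> 0" by simp
qed

text \<open>
  Under the recursion, the ratio of consecutive terms drops by at most \<open>T\<close> in each step. If the first
  ratio exceeded \<open>K * T + Q\<close>, all of the first \<open>K\<close> ratios would exceed \<open>Q\<close>.
\<close>

lemma first_ratio_bound:
  fixes a :: "nat \<Rightarrow> real"
  assumes nonneg: "\<And>k. a k \<ge> 0"
    and rec: "\<And>k. (a (Suc k))\<^sup>2 \<le> a k * (a (Suc (Suc k)) + T * a (Suc k))"
    and T: "T \<ge> 0" and Q: "Q > 0" and \<tau>: "\<tau> > 0" and K: "K \<ge> 1"
    and aK: "a K \<le> Q ^ K * \<tau>"
  shows "a 1 \<le> (real K * T + Q) * max (a 0) \<tau>"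
proof (rule ccontr)
  assume "\<not> ?thesis"
  then have big: "a 1 > (real K * T + Q) * max (a 0) \<tau>" by simp
  have KT: "real K * T + Q > 0" using T Q by (simp add: add_nonneg_pos)
  have "0 < (real K * T + Q) * max (a 0) \<tau>" using KT \<tau> by (auto simp: max_def)
  with big have a1: "a 1 > 0" by linarith
  have a0: "a 0 > 0" using rec[of 0] a1 nonneg[of 0]
    by (smt (verit, del_insts) One_nat_def mult_eq_0_iff zero_less_power2)
  have step: "j < K \<Longrightarrow> a j > 0 \<and> a (Suc j) \<ge> (real (K - j) * T + Q) * a j" for j
  proof (induction j)
    case 0
    have "(real K * T + Q) * a 0 \<le> (real K * T + Q) * max (a 0) \<tau>" using KT by (intro mult_left_mono) auto
    with big a0 show ?case by simp
  next
    case (Suc j)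
    then have IH: "a j > 0" "a (Suc j) \<ge> (real (K - j) * T + Q) * a j" by auto
    have "real (K - j) * T + Q > 0" using T Q by (simp add: add_nonneg_pos)
    with IH have p: "a (Suc j) > 0" by (smt (verit) mult_pos_pos)
    have "((real (K - j) * T + Q) * a j) * a (Suc j) \<le> (a (Suc j))\<^sup>2"
      unfolding power2_eq_square using IH p by (intro mult_right_mono) auto
    also note rec[of j]
    finally have "(real (K - j) * T + Q) * a (Suc j) \<le> a (Suc (Suc j)) + T * a (Suc j)"
      using IH(1) by (simp add: mult_ac)
    moreover have "real (K - j) = real (K - Suc j) + 1" using Suc.prems by linarith
    ultimately show ?case using p by (simp add: algebra_simps)
  qed
  have "j < K \<Longrightarrow> a (Suc j) > Q ^ Suc j * \<tau>" for j
  proof (induction j)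
    case 0
    have "Q * \<tau> \<le> (real K * T + Q) * max (a 0) \<tau>" using T Q \<tau> by (intro mult_mono) auto
    with big show ?case by simp
  next
    case (Suc j)
    have "Q ^ Suc (Suc j) * \<tau> < Q * a (Suc j)" using Suc Q by simp
    also have "\<dots> \<le> (real (K - Suc j) * T + Q) * a (Suc j)" using T nonneg by (intro mult_right_mono) auto
    also have "\<dots> \<le> a (Suc (Suc j))" using step[OF Suc.prems] by simp
    finally show ?case .
  qed
  from this[of "K - 1"] K aK show False by simp
qed

text \<open>Squared Hellinger distance without the factor 1/2, so the affinity of the two densities
  is \<open>1 - hell2 G H s / 2\<close>.\<close>

definition hell2 :: "real measure \<Rightarrow> real measure \<Rightarrow> real \<Rightarrow> real" where
  "hell2 G H s = (\<integral>x. (sqrt (mix 0 G s x) - sqrt (mix 0 H s x))\<^sup>2 \<partial>lborel)"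

section \<open>Weighted norms of the derivatives of a density difference\<close>

context noise_level
begin

text \<open>The score \<open>v / s\<^sup>2\<close> is unbounded, but beyond \<open>T\<close> the
  derivative of the density is itself tiny. Averaging preserves such a bound, so every mixture,
  whatever the support of its mixing measure, has a logarithmic derivative of at most
  \<open>M * T\<close> up to a small additive error.\<close>

lemma gauss_deriv_1_le:
  assumes "T \<ge> 0"
  shows "\<bar>gauss_deriv 1 s v\<bar> \<le> M * T * gauss_deriv 0 s v + gauss_const 1 * exp (- T\<^sup>2 / (4 * M))"
proof (cases "\<bar>v\<bar> \<le> T")
  case True
  have "\<bar>v\<bar> / s\<^sup>2 \<le> T * M" using mult_mono[OF True inv_s2_le] assms s0 by simp
  then have "\<bar>v\<bar> / s\<^sup>2 * normal_density 0 s v \<le> T * M * normal_density 0 s v" by (rule mult_right_mono) simp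
  moreover have "0 \<le> gauss_const 1 * exp (- T\<^sup>2 / (4 * M))" using gauss_const_pos[of 1] by simp
  ultimately show ?thesis by (simp add: abs_mult mult_ac)
next
  case False
  then have "T\<^sup>2 \<le> v\<^sup>2" using assms by (metis abs_le_square_iff abs_of_nonneg linorder_not_le less_imp_le)
  have "1 \<le> 2 * pi * (2 * M)" by (rule one_le_two_pi_mult) (use M1 in simp)
  then have "1 / sqrt (2 * pi * (2 * M)) * exp (- v\<^sup>2 / (4 * M)) \<le> 1 * exp (- T\<^sup>2 / (4 * M))"
    using M1 \<open>T\<^sup>2 \<le> v\<^sup>2\<close> by (intro mult_mono) (auto intro!: divide_right_mono)
  then have "gauss_env v \<le> exp (- T\<^sup>2 / (4 * M))"
    using M1 by (simp add: gauss_env_def normal_density_def power_mult_distrib)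
  then have "gauss_const 1 * gauss_env v \<le> gauss_const 1 * exp (- T\<^sup>2 / (4 * M))"
    using gauss_const_pos[of 1] by (intro mult_left_mono) auto
  moreover have "0 \<le> M * T * gauss_deriv 0 s v" using M1 assms by simp
  ultimately show ?thesis using gauss_deriv_le_env[of 1 v] by linarith
qed

lemma abs_mix_1_le:
  assumes G: "real_distribution G" and T: "T \<ge> 0"
  shows "\<bar>mix 1 G s x\<bar> \<le> M * T * mix 0 G s x + gauss_const 1 * exp (- T\<^sup>2 / (4 * M))"
proof -
  interpret G: real_distribution G by fact
  have "\<bar>mix 1 G s x\<bar> \<le> (\<integral>u. \<bar>gauss_deriv 1 s (x - u)\<bar> \<partial>G)"
    unfolding mix_def by (rule integral_abs_bound)
  also have "\<dots> \<le> (\<integral>u. M * T * gauss_deriv 0 s (x - u) + gauss_const 1 * exp (- T\<^sup>2 / (4 * M)) \<partial>G)"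
    using mix_integrand_integrable[OF G] gauss_deriv_1_le[OF T]
    by (intro integral_mono) (auto intro!: Bochner_Integration.integrable_add integrable_mult_right simp del: gauss_deriv.simps)
  also have "\<dots> = M * T * mix 0 G s x + gauss_const 1 * exp (- T\<^sup>2 / (4 * M))"
    using mix_integrand_integrable[OF G, of 0] G.prob_space by (simp add: mix_def del: gauss_deriv.simps)
  finally show ?thesis .
qed

context
  fixes G H :: "real measure" and \<rho> :: real
  assumes G: "real_distribution G" and H: "real_distribution H" and \<rho>: "\<rho> > 0"
begin

definition mixdiff :: "nat \<Rightarrow> real \<Rightarrow> real" where
  "mixdiff k x = mix k G s x - mix k H s x"

text \<open>The floor \<rho> bounds the weight \<open>1 / mixwt x\<close>, which makes all weighted
  norms finite, and it absorbs the additive error in \<open>abs_mix_1_le\<close>, so that the weight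
  has a bounded logarithmic derivative.\<close>

definition mixwt :: "real \<Rightarrow> real" where
  "mixwt x = mix 0 G s x + mix 0 H s x + \<rho>"

definition wnorm2 :: "nat \<Rightarrow> real" where
  "wnorm2 k = (\<integral>x. (mixdiff k x)\<^sup>2 / mixwt x \<partial>lborel)"

lemma mixwt_ge: "mixwt x \<ge> \<rho>"
  using mix_0_pos[OF G, of x] mix_0_pos[OF H, of x] by (simp add: mixwt_def)

lemma mixwt_pos: "mixwt x > 0"
  using mixwt_ge[of x] \<rho> by linarith

lemma mixdiff_measurable [measurable]: "mixdiff k \<in> borel_measurable borel"
  unfolding mixdiff_def[abs_def] using borel_measurable_mix[OF G] borel_measurable_mix[OF H] by measurable

lemma mixwt_measurable [measurable]: "mixwt \<in> borel_measurable borel"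
  unfolding mixwt_def[abs_def] using borel_measurable_mix[OF G] borel_measurable_mix[OF H] by measurable

lemma abs_mixdiff_le: "\<bar>mixdiff k x\<bar> \<le> 2 * gauss_const k"
  using abs_mix_le[OF G, of k x] abs_mix_le[OF H, of k x] by (simp add: mixdiff_def)

lemma mixdiff_integrable: "integrable lborel (mixdiff k)"
  unfolding mixdiff_def[abs_def] using mix_integrable[OF G] mix_integrable[OF H] by simp

lemma integral_abs_mixdiff_le: "(\<integral>x. \<bar>mixdiff k x\<bar> \<partial>lborel) \<le> 2 * gauss_const k"
proof -
  have "(\<integral>x. \<bar>mixdiff k x\<bar> \<partial>lborel) \<le> (\<integral>x. \<bar>mix k G s x\<bar> + \<bar>mix k H s x\<bar> \<partial>lborel)"
    using mixdiff_integrable[of k] mix_integrable[OF G, of k] mix_integrable[OF H, of k]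
    by (intro integral_mono) (auto simp: mixdiff_def)
  also have "\<dots> \<le> 2 * gauss_const k"
    using mix_integrable[OF G, of k] mix_integrable[OF H, of k]
      integral_abs_mix_le[OF G, of k] integral_abs_mix_le[OF H, of k] by simp
  finally show ?thesis .
qed

lemma mixdiff_sq_le: "(mixdiff k x)\<^sup>2 / mixwt x \<le> 2 * gauss_const k / \<rho> * \<bar>mixdiff k x\<bar>"
proof -
  have "(mixdiff k x)\<^sup>2 = \<bar>mixdiff k x\<bar> * \<bar>mixdiff k x\<bar>" by (simp add: power2_eq_square)
  also have "\<dots> \<le> 2 * gauss_const k * \<bar>mixdiff k x\<bar>" using abs_mixdiff_le by (intro mult_right_mono) auto
  finally have "(mixdiff k x)\<^sup>2 / mixwt x \<le> (2 * gauss_const k * \<bar>mixdiff k x\<bar>) / \<rho>"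
    using mixwt_ge[of x] \<rho> gauss_const_pos[of k] by (intro frac_le) auto
  then show ?thesis by simp
qed

lemma wnorm2_integrable: "integrable lborel (\<lambda>x. (mixdiff k x)\<^sup>2 / mixwt x)"
proof (rule Bochner_Integration.integrable_bound)
  show "integrable lborel (\<lambda>x. 2 * gauss_const k / \<rho> * \<bar>mixdiff k x\<bar>)"
    by (intro integrable_mult_right integrable_abs mixdiff_integrable)
  show "AE x in lborel. norm ((mixdiff k x)\<^sup>2 / mixwt x) \<le> norm (2 * gauss_const k / \<rho> * \<bar>mixdiff k x\<bar>)"
  proof (rule AE_I2)
    fix x
    have "norm ((mixdiff k x)\<^sup>2 / mixwt x) = (mixdiff k x)\<^sup>2 / mixwt x"
      using mixwt_pos[of x] by (simp add: less_imp_le)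
    also note mixdiff_sq_le
    also have "2 * gauss_const k / \<rho> * \<bar>mixdiff k x\<bar> \<le> norm (2 * gauss_const k / \<rho> * \<bar>mixdiff k x\<bar>)"
      unfolding real_norm_def by (rule abs_ge_self)
    finally show "norm ((mixdiff k x)\<^sup>2 / mixwt x) \<le> norm (2 * gauss_const k / \<rho> * \<bar>mixdiff k x\<bar>)" .
  qed
qed measurable

text \<open>A crude bound that loses a full factor 1 / \<rho>. It is applied only at the last order
  \<open>K\<close>, where a K-th root makes the loss harmless.\<close>

lemma wnorm2_le: "wnorm2 k \<le> 4 * (gauss_const k)\<^sup>2 / \<rho>"
proof -
  have "wnorm2 k \<le> (\<integral>x. 2 * gauss_const k / \<rho> * \<bar>mixdiff k x\<bar> \<partial>lborel)"
    unfolding wnorm2_def using wnorm2_integrable mixdiff_sq_le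
      integrable_mult_right[OF integrable_abs[OF mixdiff_integrable[of k]], of "2 * gauss_const k / \<rho>"]
    by (intro integral_mono) auto
  also have "\<dots> = 2 * gauss_const k / \<rho> * (\<integral>x. \<bar>mixdiff k x\<bar> \<partial>lborel)" by simp
  also have "\<dots> \<le> 2 * gauss_const k / \<rho> * (2 * gauss_const k)"
    using integral_abs_mixdiff_le[of k] gauss_const_pos[of k] \<rho> by (intro mult_left_mono) auto
  finally show ?thesis by (simp add: power2_eq_square)
qed

lemma hell2_integrable: "integrable lborel (\<lambda>x. (sqrt (mix 0 G s x) - sqrt (mix 0 H s x))\<^sup>2)"
proof (rule Bochner_Integration.integrable_bound[OF Bochner_Integration.integrable_add[OF mix_integrable[OF G, of 0] mix_integrable[OF H, of 0]]])
  show "AE x in lborel. norm ((sqrt (mix 0 G s x) - sqrt (mix 0 H s x))\<^sup>2) \<le> norm (mix 0 G s x + mix 0 H s x)"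
  proof (rule AE_I2)
    fix x
    have "mix 0 G s x > 0" "mix 0 H s x > 0" by (rule mix_0_pos G H)+
    moreover from this have "0 \<le> sqrt (mix 0 G s x) * sqrt (mix 0 H s x)" by simp
    ultimately have "(sqrt (mix 0 G s x) - sqrt (mix 0 H s x))\<^sup>2 \<le> mix 0 G s x + mix 0 H s x"
      unfolding power2_diff by simp
    then show "norm ((sqrt (mix 0 G s x) - sqrt (mix 0 H s x))\<^sup>2) \<le> norm (mix 0 G s x + mix 0 H s x)"
      by simp
  qed
  show "(\<lambda>x. (sqrt (mix 0 G s x) - sqrt (mix 0 H s x))\<^sup>2) \<in> borel_measurable lborel"
    using borel_measurable_mix[OF G] borel_measurable_mix[OF H] by measurable
qed

text \<open>For square roots p, q of the densities, (p^2 - q^2)^2 = (p - q)^2 (p + q)^2 and (p +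
  q)^2 is at most twice p^2 + q^2. Thus order zero of the hierarchy of weighted norms is controlled
  by the Hellinger distance.\<close>

lemma mixdiff_0_sq_le: "(mixdiff 0 x)\<^sup>2 / (mix 0 G s x + mix 0 H s x) \<le> 2 * (sqrt (mix 0 G s x) - sqrt (mix 0 H s x))\<^sup>2"
proof -
  define p q where "p = sqrt (mix 0 G s x)" and "q = sqrt (mix 0 H s x)"
  have pq: "p > 0" "q > 0" using mix_0_pos[OF G] mix_0_pos[OF H] by (auto simp: p_def q_def)
  have e: "mix 0 G s x = p\<^sup>2" "mix 0 H s x = q\<^sup>2"
    using mix_0_pos[OF G, of x] mix_0_pos[OF H, of x] by (auto simp: p_def q_def)
  have "(p + q)\<^sup>2 \<le> 2 * (p\<^sup>2 + q\<^sup>2)" using sum_squares_bound[of p q] by (simp add: power2_eq_square algebra_simps)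
  then have "(p - q)\<^sup>2 * (p + q)\<^sup>2 \<le> (p - q)\<^sup>2 * (2 * (p\<^sup>2 + q\<^sup>2))" by (intro mult_left_mono) auto
  moreover have "(p\<^sup>2 - q\<^sup>2)\<^sup>2 = (p - q)\<^sup>2 * (p + q)\<^sup>2" by (simp add: power2_eq_square algebra_simps)
  ultimately have "(p\<^sup>2 - q\<^sup>2)\<^sup>2 / (p\<^sup>2 + q\<^sup>2) \<le> 2 * (p - q)\<^sup>2"
    using pq by (simp add: pos_divide_le_eq add_pos_pos algebra_simps)
  then show ?thesis unfolding mixdiff_def e using pq by simp
qed

lemma wnorm2_0_le: "wnorm2 0 \<le> 2 * hell2 G H s"
proof -
  have "wnorm2 0 \<le> (\<integral>x. 2 * (sqrt (mix 0 G s x) - sqrt (mix 0 H s x))\<^sup>2 \<partial>lborel)"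
    unfolding wnorm2_def
  proof (rule integral_mono[OF wnorm2_integrable])
    fix x
    have "(mixdiff 0 x)\<^sup>2 / mixwt x \<le> (mixdiff 0 x)\<^sup>2 / (mix 0 G s x + mix 0 H s x)"
      using mix_0_pos[OF G, of x] mix_0_pos[OF H, of x] \<rho>
      by (intro divide_left_mono) (auto simp: mixwt_def)
    also note mixdiff_0_sq_le
    finally show "(mixdiff 0 x)\<^sup>2 / mixwt x \<le> 2 * (sqrt (mix 0 G s x) - sqrt (mix 0 H s x))\<^sup>2" .
  qed (use hell2_integrable in auto)
  then show ?thesis by (simp add: hell2_def)
qed

lemma mixdiff_has_deriv: "(mixdiff k has_real_derivative mixdiff (Suc k) x) (at x)"
  unfolding mixdiff_def[abs_def] by (intro DERIV_diff mix_has_deriv G H)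

lemma mixwt_has_deriv: "(mixwt has_real_derivative mix 1 G s x + mix 1 H s x) (at x)"
  unfolding mixwt_def[abs_def]
  by (auto intro!: derivative_eq_intros mix_has_deriv G H)

lemma mixdiff_tendsto_0:
  assumes "filterlim X at_infinity sequentially"
  shows "(\<lambda>n::nat. mixdiff k (X n)) \<longlonglongrightarrow> 0"
  unfolding mixdiff_def using tendsto_diff[OF mix_tendsto_0[OF G assms] mix_tendsto_0[OF H assms]] by simp

text \<open>Log-convexity of the weighted norms in the order of differentiation, up to a drift.
  Integrating the derivative of d_k d_{k+1} / w, where d_k is \<open>mixdiff k\<close> and w the
  weight, expresses the squared norm of d_{k+1} by a product of its neighbours and a term with w'/w,
  which \<open>T\<close> bounds; Cauchy-Schwarz does the rest.\<close>

lemma wnorm2_rec: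
  assumes T: "\<And>x. \<bar>mix 1 G s x + mix 1 H s x\<bar> \<le> T * mixwt x"
  shows "wnorm2 (Suc k) \<le> sqrt (wnorm2 k) * (sqrt (wnorm2 (Suc (Suc k))) + T * sqrt (wnorm2 (Suc k)))"
proof -
  define w' where "w' x = mix 1 G s x + mix 1 H s x" for x
  have [measurable]: "w' \<in> borel_measurable borel"
    unfolding w'_def[abs_def] using borel_measurable_mix[OF G] borel_measurable_mix[OF H] by measurable
  have T0: "T \<ge> 0" using T[of 0] mixwt_pos[of 0] by (metis abs_ge_zero order_trans zero_le_mult_iff not_less)
  define u where "u k x = mixdiff k x / sqrt (mixwt x)" for k x
  have u_meas [measurable]: "u k \<in> borel_measurable borel" for k unfolding u_def[abs_def] by measurable
  have u2: "(u k x)\<^sup>2 = (mixdiff k x)\<^sup>2 / mixwt x" for k x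
    using mixwt_pos[of x] by (simp add: u_def power_divide)
  have ui: "integrable lborel (\<lambda>x. (u k x)\<^sup>2)" for k unfolding u2 by (rule wnorm2_integrable)
  have un: "(\<integral>x. (u k x)\<^sup>2 \<partial>lborel) = wnorm2 k" for k by (simp add: u2 wnorm2_def)
  have uu: "mixdiff j x * mixdiff k x / mixwt x = u j x * u k x" for j k x
    using mixwt_pos[of x] by (simp add: u_def)
  \<comment> \<open>\<open>F'\<close> consists of the wanted square, the product of the orders k and
    k + 2, and the term \<open>R\<close> from differentiating the weight.\<close>
  define F where "F x = mixdiff k x * mixdiff (Suc k) x / mixwt x" for x
  define R where "R x = u k x * (u (Suc k) x * (w' x / mixwt x))" for x
  define F' where "F' x = (u (Suc k) x)\<^sup>2 + u k x * u (Suc (Suc k)) x - R x" for x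
  have dF: "(F has_real_derivative F' x) (at x)" for x
  proof -
    have "(F has_real_derivative (((mixdiff k x * mixdiff (Suc (Suc k)) x + mixdiff (Suc k) x * mixdiff (Suc k) x)) * mixwt x
        - mixdiff k x * mixdiff (Suc k) x * w' x) / (mixwt x * mixwt x)) (at x)"
      unfolding F_def[abs_def] using mixwt_pos[of x]
      by (intro DERIV_divide DERIV_mult' mixdiff_has_deriv mixwt_has_deriv[folded w'_def]) auto
    moreover have "((mixdiff k x * mixdiff (Suc (Suc k)) x + mixdiff (Suc k) x * mixdiff (Suc k) x) * mixwt x
        - mixdiff k x * mixdiff (Suc k) x * w' x) / (mixwt x * mixwt x) = F' x"
      using mixwt_pos[of x] by (simp add: F'_def R_def u_def power2_eq_square field_simps)
    ultimately show ?thesis by simp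
  qed
  have cF: "continuous_on UNIV F'"
  proof -
    have "continuous_on UNIV (mixdiff k)" for k
      by (meson DERIV_continuous_on mixdiff_has_deriv has_field_derivative_at_within)
    moreover have "continuous_on UNIV mixwt"
      by (meson DERIV_continuous_on mixwt_has_deriv has_field_derivative_at_within)
    moreover have "continuous_on UNIV w'" unfolding w'_def[abs_def]
      by (intro continuous_intros continuous_mix G H)
    ultimately show ?thesis unfolding F'_def[abs_def] R_def u_def using mixwt_pos
      by (intro continuous_intros ballI) (auto simp: less_imp_neq[THEN not_sym])
  qed
  have w'b: "\<bar>w' x / mixwt x\<bar> \<le> T" for x
    using T[of x] mixwt_pos[of x] by (simp add: w'_def abs_div_pos[symmetric] pos_divide_le_eq del: abs_divide)
  have v2: "(u (Suc k) x * (w' x / mixwt x))\<^sup>2 \<le> T\<^sup>2 * (u (Suc k) x)\<^sup>2" for x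
  proof -
    have "(w' x / mixwt x)\<^sup>2 \<le> T\<^sup>2" using w'b[of x] T0 by (metis abs_le_square_iff abs_of_nonneg)
    then have "(u (Suc k) x)\<^sup>2 * (w' x / mixwt x)\<^sup>2 \<le> (u (Suc k) x)\<^sup>2 * T\<^sup>2"
      by (intro mult_left_mono) auto
    then show ?thesis by (simp only: power_mult_distrib mult.commute)
  qed
  have vi: "integrable lborel (\<lambda>x. (u (Suc k) x * (w' x / mixwt x))\<^sup>2)"
    using v2 by (intro Bochner_Integration.integrable_bound[OF integrable_mult_right[OF ui[of "Suc k"], of "T\<^sup>2"]]) auto
  have vn: "sqrt (\<integral>x. (u (Suc k) x * (w' x / mixwt x))\<^sup>2 \<partial>lborel) \<le> T * sqrt (wnorm2 (Suc k))"
  proof -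
    have "(\<integral>x. (u (Suc k) x * (w' x / mixwt x))\<^sup>2 \<partial>lborel) \<le> T\<^sup>2 * wnorm2 (Suc k)"
      using integral_mono[OF vi integrable_mult_right[OF ui[of "Suc k"], of "T\<^sup>2"] v2] by (simp add: un)
    then have "sqrt (\<integral>x. (u (Suc k) x * (w' x / mixwt x))\<^sup>2 \<partial>lborel) \<le> sqrt (T\<^sup>2 * wnorm2 (Suc k))"
      by (rule real_sqrt_le_mono)
    then show ?thesis using T0 by (simp add: real_sqrt_mult)
  qed
  have um: "u k \<in> borel_measurable lborel" for k by simp
  have vm: "(\<lambda>x. u (Suc k) x * (w' x / mixwt x)) \<in> borel_measurable lborel" by measurable
  note cs1 = Cauchy_Schwarz_integral[OF um um ui[of k] ui[of "Suc (Suc k)"]]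
  note cs2 = Cauchy_Schwarz_integral[OF um vm ui[of k] vi]
  have Ri: "integrable lborel R" unfolding R_def[abs_def] by (rule cs2(1)) 
  have iF: "integrable lborel F'" unfolding F'_def[abs_def]
    using ui[of "Suc k"] cs1(1) Ri by auto
  have lim: "(\<lambda>n::nat. F (X n)) \<longlonglongrightarrow> 0" if "filterlim X at_infinity sequentially" for X
  proof (rule Lim_null_comparison)
    show "\<forall>\<^sub>F n in sequentially. norm (F (X n)) \<le> 2 * gauss_const (Suc k) / \<rho> * \<bar>mixdiff k (X n)\<bar>"
    proof (rule always_eventually, rule allI)
      fix n
      have "norm (F (X n)) \<le> \<bar>mixdiff k (X n)\<bar> * (2 * gauss_const (Suc k)) / \<rho>"
        unfolding F_def using abs_mixdiff_le[of "Suc k" "X n"] mixwt_ge[of "X n"] \<rho> gauss_const_pos[of "Suc k"]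
        by (auto simp: abs_mult intro!: frac_le mult_left_mono mult_nonneg_nonneg)
      then show "norm (F (X n)) \<le> 2 * gauss_const (Suc k) / \<rho> * \<bar>mixdiff k (X n)\<bar>" by (simp add: mult_ac)
    qed
    show "(\<lambda>n. 2 * gauss_const (Suc k) / \<rho> * \<bar>mixdiff k (X n)\<bar>) \<longlonglongrightarrow> 0"
      using tendsto_mult[OF tendsto_const tendsto_rabs[OF mixdiff_tendsto_0[OF that, of k]], of "2 * gauss_const (Suc k) / \<rho>"] by simp
  qed
  have inf1: "filterlim (\<lambda>n. real n) at_infinity sequentially"
    by (rule filterlim_at_top_imp_at_infinity[OF filterlim_real_sequentially])
  have inf2: "filterlim (\<lambda>n. - real n) at_infinity sequentially"
    using inf1 by (simp add: filterlim_at_infinity_conv_norm_at_top)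
  have "(\<integral>x. F' x \<partial>lborel) = 0"
    by (rule integral_deriv_eq_0[OF dF cF iF lim[OF inf1] lim[OF inf2]])
  then have "wnorm2 (Suc k) = (\<integral>x. R x \<partial>lborel) - (\<integral>x. u k x * u (Suc (Suc k)) x \<partial>lborel)"
    unfolding F'_def using ui[of "Suc k"] cs1(1) Ri by (simp add: un)
  also have "\<dots> \<le> sqrt (wnorm2 k) * (T * sqrt (wnorm2 (Suc k))) + sqrt (wnorm2 k) * sqrt (wnorm2 (Suc (Suc k)))"
  proof -
    have "\<bar>\<integral>x. R x \<partial>lborel\<bar> \<le> sqrt (wnorm2 k) * sqrt (\<integral>x. (u (Suc k) x * (w' x / mixwt x))\<^sup>2 \<partial>lborel)"
      using cs2(2) unfolding R_def un by simp
    also have "\<dots> \<le> sqrt (wnorm2 k) * (T * sqrt (wnorm2 (Suc k)))"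
      using vn mixwt_pos by (intro mult_left_mono) (auto simp: wnorm2_def less_imp_le)
    finally show ?thesis using cs1(2) unfolding un by linarith
  qed
  finally show ?thesis by (simp add: algebra_simps)
qed

text \<open>From a crude bound at order \<open>K\<close> alone, \<open>first_ratio_bound\<close>
  concludes that the first derivative is almost as small as the difference of the densities. The
  margin \<tau> takes over when that difference is too small for the ratio argument.\<close>

lemma wnorm2_1_le:
  assumes T0: "T \<ge> 0" and T: "2 * gauss_const 1 * exp (- T\<^sup>2 / (4 * M)) \<le> M * T * \<rho>"
    and K: "K \<ge> 1" and Q: "Q > 0" and \<tau>: "\<tau> > 0" and QK: "2 * gauss_const K / sqrt \<rho> \<le> Q ^ K * \<tau>"
  shows "wnorm2 1 \<le> (real K * (M * T) + Q)\<^sup>2 * (2 * hell2 G H s + \<tau>\<^sup>2)"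
proof -
  have w0: "wnorm2 k \<ge> 0" for k using mixwt_pos by (simp add: wnorm2_def less_imp_le)
  \<comment> \<open>The errors of the two mixtures together fit into \<open>M * T * \<rho>\<close>,
    the share of the floor in \<open>M * T * mixwt x\<close>.\<close>
  have wt: "\<bar>mix 1 G s x + mix 1 H s x\<bar> \<le> M * T * mixwt x" for x
    using abs_mix_1_le[OF G T0, of x] abs_mix_1_le[OF H T0, of x] T
    by (simp add: mixwt_def algebra_simps)
  define a where "a k = sqrt (wnorm2 k)" for k
  have a2: "(a k)\<^sup>2 = wnorm2 k" for k using w0 by (simp add: a_def)
  have "a 1 \<le> (real K * (M * T) + Q) * max (a 0) \<tau>"
  proof (rule first_ratio_bound[OF _ _ _ Q \<tau> K])
    show "(a (Suc k))\<^sup>2 \<le> a k * (a (Suc (Suc k)) + M * T * a (Suc k))" for k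
      unfolding a2 using wnorm2_rec[OF wt, of k] by (simp add: a_def)
    have "a K \<le> sqrt (4 * (gauss_const K)\<^sup>2 / \<rho>)" unfolding a_def by (rule real_sqrt_le_mono[OF wnorm2_le])
    also have "\<dots> = 2 * gauss_const K / sqrt \<rho>"
      using gauss_const_pos[of K] by (simp add: real_sqrt_divide real_sqrt_mult)
    finally show "a K \<le> Q ^ K * \<tau>" using QK by linarith
  qed (use T0 M1 w0 in \<open>auto simp: a_def\<close>)
  then have "(a 1)\<^sup>2 \<le> ((real K * (M * T) + Q) * max (a 0) \<tau>)\<^sup>2"
    using w0 by (intro power_mono) (auto simp: a_def)
  also have "\<dots> = (real K * (M * T) + Q)\<^sup>2 * (max (a 0) \<tau>)\<^sup>2" by (simp add: power_mult_distrib)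
  also have "\<dots> \<le> (real K * (M * T) + Q)\<^sup>2 * (2 * hell2 G H s + \<tau>\<^sup>2)"
  proof (intro mult_left_mono)
    show "(max (a 0) \<tau>)\<^sup>2 \<le> 2 * hell2 G H s + \<tau>\<^sup>2"
      using a2[of 0] wnorm2_0_le w0[of 0] \<tau> by (auto simp: max_def intro: add_increasing2)
  qed simp
  finally show ?thesis by (simp add: a2)
qed

end

end

section \<open>The regret as a weighted distance of posterior means\<close>

lemma normal_density_scale:
  assumes "s > 0"
  shows "normal_density 0 s (s * z) * s = std_normal_density z"
  using assms by (simp add: normal_density_def power_mult_distrib real_sqrt_mult field_simps)

text \<open>A rounded-up form of \<open>4 * M * exp (1 + M / 2 + 8 * M)\<close>, the constant that
  arises in \<open>quadratic_shift_le\<close>.\<close>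

definition regret_const :: "real \<Rightarrow> real" where
  "regret_const M = 8 * M * exp (1 + 10 * M)"

context noise_level
begin

text \<open>Tweedie's formula comes from integrating the pointwise identity \<theta> \<phi>(x -
  \<theta>) = x \<phi>(x - \<theta>) + s^2 \<phi>'(x - \<theta>). Both terms on the right are
  bounded in \<theta>, so heavy-tailed mixing measures are covered.\<close>

lemma posterior_mean_eq:
  assumes G: "real_distribution G"
  shows "posterior_mean G s x = x + s\<^sup>2 * (mix 1 G s x / mix 0 G s x)"
    and "(\<integral>\<theta>. \<theta> * normal_density 0 s (x - \<theta>) \<partial>G) = posterior_mean G s x * mix 0 G s x"
    and "integrable G (\<lambda>\<theta>. \<theta> * normal_density 0 s (x - \<theta>))"
proof -
  interpret G: real_distribution G by fact
  have e: "\<theta> * normal_density 0 s (x - \<theta>) = x * gauss_deriv 0 s (x - \<theta>) + s\<^sup>2 * gauss_deriv 1 s (x - \<theta>)" for \<theta>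
  proof -
    have "s\<^sup>2 * gauss_deriv 1 s (x - \<theta>) = - ((x - \<theta>) * normal_density 0 s (x - \<theta>))" using s0 by simp
    then show ?thesis by (simp add: algebra_simps del: gauss_deriv.simps(2))
  qed
  show "integrable G (\<lambda>\<theta>. \<theta> * normal_density 0 s (x - \<theta>))"
    unfolding e using mix_integrand_integrable[OF G] by (intro Bochner_Integration.integrable_add integrable_mult_right)
  have i: "(\<integral>\<theta>. \<theta> * normal_density 0 s (x - \<theta>) \<partial>G) = x * mix 0 G s x + s\<^sup>2 * mix 1 G s x"
    unfolding e mix_def using mix_integrand_integrable[OF G]
    by (subst Bochner_Integration.integral_add) (auto intro!: integrable_mult_right simp del: gauss_deriv.simps)
  have p: "mix 0 G s x > 0" by (rule mix_0_pos[OF G])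
  show "posterior_mean G s x = x + s\<^sup>2 * (mix 1 G s x / mix 0 G s x)"
    using p by (simp add: posterior_mean_def i mixture_density_eq_mix field_simps)
  show "(\<integral>\<theta>. \<theta> * normal_density 0 s (x - \<theta>) \<partial>G) = posterior_mean G s x * mix 0 G s x"
    using p by (simp add: posterior_mean_def mixture_density_eq_mix)
qed

lemma posterior_mean_measurable [measurable]:
  assumes G: "real_distribution G"
  shows "posterior_mean G s \<in> borel_measurable borel"
proof -
  have "posterior_mean G s = (\<lambda>x. x + s\<^sup>2 * (mix 1 G s x / mix 0 G s x))"
    by (rule ext, rule posterior_mean_eq(1)[OF G])
  then show ?thesis using borel_measurable_mix[OF G, measurable] by simp
qed

text \<open>Since (x - 2\<theta>)^2 is nonnegative, (x - \<theta>)^2 is at least x^2 / 2 -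
  \<theta>^2: a bounded shift is absorbed by doubling the variance.\<close>

lemma gauss_env_shift:
  assumes "\<bar>\<theta>\<bar> \<le> M"
  shows "normal_density 0 s (x - \<theta>) \<le> sqrt 2 * M * exp (M / 2) * gauss_env x"
proof -
  have "(x - 2 * \<theta>)\<^sup>2 = x\<^sup>2 - 4 * (x * \<theta>) + 4 * \<theta>\<^sup>2"
    by (simp add: power2_eq_square algebra_simps)
  then have "2 * (x * \<theta>) \<le> x\<^sup>2 / 2 + 2 * \<theta>\<^sup>2"
    using zero_le_power2[of "x - 2 * \<theta>"] by linarith
  moreover have "\<theta>\<^sup>2 \<le> M\<^sup>2" using power_mono[OF assms abs_ge_zero, of 2] by simp
  moreover have "(x - \<theta>)\<^sup>2 = x\<^sup>2 - 2 * (x * \<theta>) + \<theta>\<^sup>2"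
    by (simp add: power2_eq_square algebra_simps)
  ultimately have "x\<^sup>2 / 2 - M\<^sup>2 \<le> (x - \<theta>)\<^sup>2" by linarith
  then have "- (x - \<theta>)\<^sup>2 / (2 * M) \<le> (M\<^sup>2 - x\<^sup>2 / 2) / (2 * M)"
    using M1 by (intro divide_right_mono) auto
  also have "\<dots> = M / 2 + - x\<^sup>2 / (4 * M)" using M1 by (simp add: power2_eq_square field_simps)
  finally have "exp (- (x - \<theta>)\<^sup>2 / (2 * M)) \<le> exp (M / 2) * exp (- x\<^sup>2 / (4 * M))"
    by (simp flip: exp_add)
  then have "exp (- (x - \<theta>)\<^sup>2 / (2 * M)) / sqrt (2 * pi * M) \<le> exp (M / 2) * exp (- x\<^sup>2 / (4 * M)) / sqrt (2 * pi * M)"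
    by (rule divide_right_mono) (use M1 in simp)
  moreover have "sqrt (2 * pi * (2 * M)) = sqrt 2 * sqrt (2 * pi * M)"
    by (simp add: real_sqrt_mult[symmetric] algebra_simps)
  ultimately have "normal_density 0 (sqrt M) (x - \<theta>) \<le> sqrt 2 * exp (M / 2) * gauss_env x"
    using M1 by (simp add: gauss_env_def normal_density_def power_mult_distrib)
  then have "M * normal_density 0 (sqrt M) (x - \<theta>) \<le> M * (sqrt 2 * exp (M / 2) * gauss_env x)"
    using M1 by (intro mult_left_mono) auto
  with normal_density_le[of "x - \<theta>"] show ?thesis by (simp add: mult_ac)
qed

text \<open>The density of N(0, 4M). The variance \<open>M\<close> has been doubled twice: once for
  the shift by \<theta> and once for an exponential factor.\<close>

definition tail_env :: "real \<Rightarrow> real" where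
  "tail_env x = normal_density 0 (sqrt 2 * (sqrt 2 * sqrt M)) x"

lemma tail_env_integrable: "integrable lborel tail_env" "(\<integral>x. tail_env x \<partial>lborel) = 1"
  using M1 by (auto simp: tail_env_def[abs_def])

text \<open>The envelope is asked to absorb exp(2\<bar>x\<bar>): one factor exp(\<bar>x\<bar>)
  dominates the quadratic, the other is left over as the decay \<open>exp (- \<bar>x\<bar>)\<close>
  that later makes the risk outside a radius R at most of order exp(-R).\<close>

lemma quadratic_shift_le:
  assumes "\<bar>\<theta>\<bar> \<le> M"
  shows "(1 + \<bar>x\<bar>)\<^sup>2 * normal_density 0 s (x - \<theta>) \<le> regret_const M * exp (- \<bar>x\<bar>) * tail_env x"
proof -
  have q: "(1 + \<bar>x\<bar>)\<^sup>2 \<le> 2 * exp (1 + \<bar>x\<bar>)"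
    using power_le_fact_mult_exp[of "1 + \<bar>x\<bar>" 2] by (simp add: numeral_2_eq_2)
  have t: "exp (2 * \<bar>x\<bar>) * gauss_env x \<le> sqrt 2 * exp (8 * M) * tail_env x"
    using exp_abs_mult_normal_density_le[of "sqrt 2 * sqrt M" 2 x] M1
    by (simp add: gauss_env_def tail_env_def power_mult_distrib)
  have "(1 + \<bar>x\<bar>)\<^sup>2 * normal_density 0 s (x - \<theta>)
      \<le> (2 * exp (1 + \<bar>x\<bar>)) * (sqrt 2 * M * exp (M / 2) * gauss_env x)"
    using q gauss_env_shift[OF assms] by (intro mult_mono) auto
  also have "\<dots> = 2 * exp 1 * sqrt 2 * M * exp (M / 2) * exp (- \<bar>x\<bar>) * (exp (2 * \<bar>x\<bar>) * gauss_env x)"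
    by (simp add: exp_add exp_double exp_minus power2_eq_square)
  also have "\<dots> \<le> 2 * exp 1 * sqrt 2 * M * exp (M / 2) * exp (- \<bar>x\<bar>) * (sqrt 2 * exp (8 * M) * tail_env x)"
    using M1 t by (intro mult_left_mono) auto
  also have "\<dots> = (sqrt 2 * sqrt 2) * 2 * M * (exp 1 * exp (M / 2) * exp (8 * M)) * exp (- \<bar>x\<bar>) * tail_env x"
    by (simp only: mult_ac)
  also have "\<dots> = 2 * 2 * M * exp (1 + M / 2 + 8 * M) * exp (- \<bar>x\<bar>) * tail_env x"
  proof -
    have "sqrt 2 * sqrt 2 = (2::real)" by simp
    then show ?thesis by (simp only: exp_add)
  qed
  also have "\<dots> \<le> regret_const M * exp (- \<bar>x\<bar>) * tail_env x"
    unfolding regret_const_def tail_env_def using M1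
    by (intro mult_right_mono mult_mono) auto
  finally show ?thesis .
qed

context
  fixes G0 :: "real measure"
  assumes G0: "real_distribution G0" and supp: "AE \<theta> in G0. \<bar>\<theta>\<bar> \<le> M"
begin

interpretation G0: real_distribution G0 by (rule G0)

lemma mix_0_quadratic_le:
  "(1 + \<bar>x\<bar>)\<^sup>2 * mix 0 G0 s x \<le> regret_const M * exp (- \<bar>x\<bar>) * tail_env x"
proof -
  have "(1 + \<bar>x\<bar>)\<^sup>2 * mix 0 G0 s x = (\<integral>\<theta>. (1 + \<bar>x\<bar>)\<^sup>2 * gauss_deriv 0 s (x - \<theta>) \<partial>G0)"
    using mix_integrand_integrable[OF G0, of 0 x] by (simp add: mix_def)
  also have "\<dots> \<le> regret_const M * exp (- \<bar>x\<bar>) * tail_env x"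
    using supp mix_integrand_integrable[OF G0, of 0 x] quadratic_shift_le
    by (intro G0.integral_le_const) auto
  finally show ?thesis .
qed

text \<open>Substituting \<open>x = \<theta> + s * z\<close> moves the risk onto Lebesgue measure,
  where the order of integration can be exchanged. Linear growth of the rule suffices, because
  \<theta> is bounded and the noise Gaussian.\<close>

lemma bayes_risk_integral:
  assumes [measurable]: "h \<in> borel_measurable borel" and h: "\<And>x. \<bar>h x\<bar> \<le> \<Lambda> * (1 + \<bar>x\<bar>)"
  shows "integrable (G0 \<Otimes>\<^sub>M lborel) (\<lambda>(\<theta>, x). (h x - \<theta>)\<^sup>2 * normal_density 0 s (x - \<theta>))"
    and "(\<integral>(\<theta>, z). (h (\<theta> + s * z) - \<theta>)\<^sup>2 \<partial>(G0 \<Otimes>\<^sub>M std_normal)) =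
       (\<integral>\<theta>. (\<integral>x. (h x - \<theta>)\<^sup>2 * normal_density 0 s (x - \<theta>) \<partial>lborel) \<partial>G0)"
proof -
  have \<Lambda>: "\<Lambda> \<ge> 0" using h[of 0] by simp
  interpret P: pair_sigma_finite G0 lborel ..
  have sn: "prob_space std_normal" unfolding std_normal_def by (rule prob_space_normal_density) simp
  interpret N: prob_space std_normal by (rule sn)
  interpret Q: pair_sigma_finite G0 std_normal ..
  have [measurable_cong]: "sets std_normal = sets borel" by (simp add: std_normal_def)
  have b: "(h x - \<theta>)\<^sup>2 * normal_density 0 s (x - \<theta>) \<le> (\<Lambda> + M)\<^sup>2 * regret_const M * tail_env x"
    if \<theta>: "\<bar>\<theta>\<bar> \<le> M" for \<theta> x
  proof -
    have "\<bar>h x - \<theta>\<bar> \<le> \<Lambda> * (1 + \<bar>x\<bar>) + M * 1" using h[of x] \<theta> by linarith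
    also have "\<dots> \<le> \<Lambda> * (1 + \<bar>x\<bar>) + M * (1 + \<bar>x\<bar>)" using M1 by (intro add_left_mono mult_left_mono) auto
    finally have "\<bar>h x - \<theta>\<bar> \<le> (\<Lambda> + M) * (1 + \<bar>x\<bar>)" by (simp add: distrib_right)
    then have "\<bar>h x - \<theta>\<bar>\<^sup>2 \<le> ((\<Lambda> + M) * (1 + \<bar>x\<bar>))\<^sup>2" by (rule power_mono) simp
    then have "(h x - \<theta>)\<^sup>2 * normal_density 0 s (x - \<theta>) \<le> ((\<Lambda> + M) * (1 + \<bar>x\<bar>))\<^sup>2 * normal_density 0 s (x - \<theta>)"
      by (intro mult_right_mono) auto
    also have "\<dots> = (\<Lambda> + M)\<^sup>2 * ((1 + \<bar>x\<bar>)\<^sup>2 * normal_density 0 s (x - \<theta>))" by (simp add: power_mult_distrib)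
    also have "\<dots> \<le> (\<Lambda> + M)\<^sup>2 * (regret_const M * exp (- \<bar>x\<bar>) * tail_env x)"
      using quadratic_shift_le[OF \<theta>] by (intro mult_left_mono) auto
    also have "\<dots> \<le> (\<Lambda> + M)\<^sup>2 * (regret_const M * 1 * tail_env x)"
      using M1 by (intro mult_left_mono mult_right_mono) (auto simp: regret_const_def tail_env_def)
    finally show ?thesis by (simp add: mult_ac)
  qed
  define k where "k \<theta> x = (h x - \<theta>)\<^sup>2 * normal_density 0 s (x - \<theta>)" for \<theta> x
  have k0: "k \<theta> x \<ge> 0" for \<theta> x by (simp add: k_def)
  have [measurable]: "case_prod k \<in> borel_measurable (borel \<Otimes>\<^sub>M borel)" unfolding k_def[abs_def] by measurable
  have [measurable]: "k \<theta> \<in> borel_measurable borel" for \<theta> unfolding k_def[abs_def] by measurable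
  have ti: "integrable lborel (\<lambda>x. (\<Lambda> + M)\<^sup>2 * regret_const M * tail_env x)"
    using tail_env_integrable by simp
  have i1: "integrable lborel (k \<theta>)" if "\<bar>\<theta>\<bar> \<le> M" for \<theta>
    using b[OF that] k0 by (intro Bochner_Integration.integrable_bound[OF ti])
     (auto simp: k_def intro!: AE_I2 order_trans[OF _ abs_ge_self])
  have b1: "(\<integral>x. k \<theta> x \<partial>lborel) \<le> (\<Lambda> + M)\<^sup>2 * regret_const M" if "\<bar>\<theta>\<bar> \<le> M" for \<theta>
    using integral_mono[OF i1[OF that] ti b[OF that, folded k_def]] tail_env_integrable(2) by simp
  have iG: "integrable G0 (\<lambda>\<theta>. \<integral>x. k \<theta> x \<partial>lborel)"
    using supp b1 k0 by (intro G0.integrable_const_bound[where B = "(\<Lambda> + M)\<^sup>2 * regret_const M"]) auto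
  show "integrable (G0 \<Otimes>\<^sub>M lborel) (\<lambda>(\<theta>, x). (h x - \<theta>)\<^sup>2 * normal_density 0 s (x - \<theta>))"
    unfolding k_def[symmetric]
    using iG supp i1 k0 by (intro P.Fubini_integrable) auto
  have cv: "(\<integral>z. (h (\<theta> + s * z) - \<theta>)\<^sup>2 \<partial>std_normal) = (\<integral>x. k \<theta> x \<partial>lborel)"
    "\<bar>\<theta>\<bar> \<le> M \<Longrightarrow> integrable std_normal (\<lambda>z. (h (\<theta> + s * z) - \<theta>)\<^sup>2)" for \<theta>
  proof -
    have e: "std_normal_density z *\<^sub>R (h (\<theta> + s * z) - \<theta>)\<^sup>2 = s * k \<theta> (\<theta> + s * z)" for z
      using normal_density_scale[OF s0, of z] by (simp add: k_def mult_ac)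
    show "(\<integral>z. (h (\<theta> + s * z) - \<theta>)\<^sup>2 \<partial>std_normal) = (\<integral>x. k \<theta> x \<partial>lborel)"
      unfolding std_normal_def using lborel_integral_real_affine[of s "k \<theta>" \<theta>] s0
      by (subst integral_density) (auto simp: e[simplified])
    show "integrable std_normal (\<lambda>z. (h (\<theta> + s * z) - \<theta>)\<^sup>2)" if "\<bar>\<theta>\<bar> \<le> M"
      unfolding std_normal_def using lborel_integrable_real_affine[OF i1[OF that], of s \<theta>] s0
      by (subst integrable_density) (auto simp: e[simplified])
  qed
  have iQ: "integrable (G0 \<Otimes>\<^sub>M std_normal) (\<lambda>(\<theta>, z). (h (\<theta> + s * z) - \<theta>)\<^sup>2)"
    using iG cv supp by (intro Q.Fubini_integrable) auto
  show "(\<integral>(\<theta>, z). (h (\<theta> + s * z) - \<theta>)\<^sup>2 \<partial>(G0 \<Otimes>\<^sub>M std_normal)) =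
       (\<integral>\<theta>. (\<integral>x. (h x - \<theta>)\<^sup>2 * normal_density 0 s (x - \<theta>) \<partial>lborel) \<partial>G0)"
    using Q.integral_fst'[OF iQ] by (simp add: cv(1) k_def)
qed

lemma abs_posterior_mean_prior_le: "\<bar>posterior_mean G0 s x\<bar> \<le> M"
proof -
  have p: "mix 0 G0 s x > 0" by (rule mix_0_pos[OF G0])
  have "\<bar>posterior_mean G0 s x * mix 0 G0 s x\<bar> \<le> (\<integral>\<theta>. \<bar>\<theta> * normal_density 0 s (x - \<theta>)\<bar> \<partial>G0)"
    unfolding posterior_mean_eq(2)[OF G0, symmetric] by (rule integral_abs_bound)
  also have "\<dots> \<le> (\<integral>\<theta>. M * gauss_deriv 0 s (x - \<theta>) \<partial>G0)"
    using supp mix_integrand_integrable[OF G0, of 0 x] integrable_abs[OF posterior_mean_eq(3)[OF G0, of x]]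
    by (intro integral_mono_AE) (auto simp: abs_mult intro!: mult_right_mono)
  also have "\<dots> = M * mix 0 G0 s x" by (simp add: mix_def)
  finally show ?thesis using p by (simp add: abs_mult)
qed

context
  fixes G :: "real measure" and \<Lambda> :: real
  assumes G: "real_distribution G" and growth: "\<And>x. \<bar>posterior_mean G s x\<bar> \<le> \<Lambda> * (1 + \<bar>x\<bar>)"
begin

text \<open>Orthogonality: given x, the function \<open>posterior_mean G0 s\<close> is the
  conditional mean of \<theta>, so expanding the squares leaves no cross term. The two risks are
  merged into one integrand before Fubini exchanges the integrals.\<close>

lemma bayes_risk_diff:
  shows "integrable lborel (\<lambda>x. (posterior_mean G s x - posterior_mean G0 s x)\<^sup>2 * mix 0 G0 s x)"
    and "bayes_risk G G0 s - bayes_risk G0 G0 s =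
      (\<integral>x. (posterior_mean G s x - posterior_mean G0 s x)\<^sup>2 * mix 0 G0 s x \<partial>lborel)"
proof -
  interpret P: pair_sigma_finite G0 lborel ..
  define m m0 where "m = posterior_mean G s" and "m0 = posterior_mean G0 s"
  have [measurable]: "m \<in> borel_measurable borel" "m0 \<in> borel_measurable borel"
    unfolding m_def m0_def using posterior_mean_measurable G G0 by auto
  have "\<bar>m0 x\<bar> \<le> M * (1 + \<bar>x\<bar>)" for x
    using abs_posterior_mean_prior_le[of x] M1 by (auto simp: m0_def algebra_simps intro: add_increasing2)
  note b0 = bayes_risk_integral[OF \<open>m0 \<in> _\<close> this]
  note b1 = bayes_risk_integral[OF \<open>m \<in> _\<close> growth[folded m_def]]
  define k where "k \<theta> x = ((m x - \<theta>)\<^sup>2 - (m0 x - \<theta>)\<^sup>2) * normal_density 0 s (x - \<theta>)" for \<theta> x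
  have ik: "integrable (G0 \<Otimes>\<^sub>M lborel) (\<lambda>(\<theta>, x). k \<theta> x)"
    using Bochner_Integration.integrable_diff[OF b1(1) b0(1)]
    by (simp add: k_def left_diff_distrib case_prod_unfold)
  have inner: "(\<integral>\<theta>. k \<theta> x \<partial>G0) = (m x - m0 x)\<^sup>2 * mix 0 G0 s x" for x
  proof -
    have "k \<theta> x = ((m x)\<^sup>2 - (m0 x)\<^sup>2) * gauss_deriv 0 s (x - \<theta>)
        - 2 * (m x - m0 x) * (\<theta> * normal_density 0 s (x - \<theta>))" for \<theta>
      by (simp add: k_def power2_eq_square algebra_simps)
    then have "(\<integral>\<theta>. k \<theta> x \<partial>G0) = ((m x)\<^sup>2 - (m0 x)\<^sup>2) * mix 0 G0 s x - 2 * (m x - m0 x) * (m0 x * mix 0 G0 s x)"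
      using mix_integrand_integrable[OF G0, of 0 x] posterior_mean_eq(2,3)[OF G0, of x]
      by (simp add: mix_def m0_def)
    also have "\<dots> = (m x - m0 x)\<^sup>2 * mix 0 G0 s x" by (simp add: power2_eq_square algebra_simps)
    finally show ?thesis .
  qed
  show "integrable lborel (\<lambda>x. (posterior_mean G s x - posterior_mean G0 s x)\<^sup>2 * mix 0 G0 s x)"
    using P.integrable_snd[OF ik] by (simp add: inner m_def m0_def)
  have "bayes_risk G G0 s - bayes_risk G0 G0 s = (\<integral>\<theta>. (\<integral>x. k \<theta> x \<partial>lborel) \<partial>G0)"
  proof -
    have "bayes_risk G G0 s - bayes_risk G0 G0 s
       = (\<integral>p. (\<lambda>(\<theta>, x). (m x - \<theta>)\<^sup>2 * normal_density 0 s (x - \<theta>)) p \<partial>(G0 \<Otimes>\<^sub>M lborel))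
         - (\<integral>p. (\<lambda>(\<theta>, x). (m0 x - \<theta>)\<^sup>2 * normal_density 0 s (x - \<theta>)) p \<partial>(G0 \<Otimes>\<^sub>M lborel))"
      unfolding bayes_risk_def m_def[symmetric] m0_def[symmetric] b0(2) b1(2)
      using P.integral_fst[OF b0(1)] P.integral_fst[OF b1(1)] by simp
    also have "\<dots> = (\<integral>p. (\<lambda>(\<theta>, x). k \<theta> x) p \<partial>(G0 \<Otimes>\<^sub>M lborel))"
      by (subst Bochner_Integration.integral_diff[symmetric, OF b1(1) b0(1)])
         (simp add: k_def left_diff_distrib case_prod_unfold)
    also have "\<dots> = (\<integral>\<theta>. (\<integral>x. k \<theta> x \<partial>lborel) \<partial>G0)"
      using P.integral_fst[OF ik] by simp
    finally show ?thesis .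
  qed
  also have "\<dots> = (\<integral>x. (\<integral>\<theta>. k \<theta> x \<partial>G0) \<partial>lborel)" by (rule P.Fubini_integral[OF ik, symmetric])
  also have "\<dots> = (\<integral>x. (posterior_mean G s x - posterior_mean G0 s x)\<^sup>2 * mix 0 G0 s x \<partial>lborel)"
    by (simp add: inner m_def m0_def)
  finally show "bayes_risk G G0 s - bayes_risk G0 G0 s =
      (\<integral>x. (posterior_mean G s x - posterior_mean G0 s x)\<^sup>2 * mix 0 G0 s x \<partial>lborel)" .
qed

lemma bayes_risk_diff_nonneg: "0 \<le> bayes_risk G G0 s - bayes_risk G0 G0 s"
  unfolding bayes_risk_diff(2) using mix_0_pos[OF G0] by (intro integral_nonneg_AE) (auto simp: less_imp_le)

text \<open>The difference of the scores f'/f and f0'/f0 is split into a part with f' - f0',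
  measured by \<open>wnorm2\<close>, and a part with f - f0, measured by the Hellinger distance and
  weighted by the size of the scores.\<close>

lemma posterior_mean_diff_sq_le:
  assumes \<Lambda>: "\<Lambda> \<ge> M" and R: "R \<ge> 0" "\<bar>x\<bar> \<le> R"
    and \<rho>: "\<rho> > 0" "mix 0 G s x + mix 0 G0 s x \<ge> \<rho>"
  shows "(posterior_mean G s x - posterior_mean G0 s x)\<^sup>2 * mix 0 G0 s x
    \<le> 16 * M\<^sup>2 * ((mixdiff G G0 1 x)\<^sup>2 / mixwt G G0 \<rho> x)
      + 64 * M ^ 4 * \<Lambda>\<^sup>2 * (1 + R)\<^sup>2 * (sqrt (mix 0 G s x) - sqrt (mix 0 G0 s x))\<^sup>2"
proof -
  define f f0 f' f0' where "f = mix 0 G s x" and "f0 = mix 0 G0 s x"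
    and "f' = mix 1 G s x" and "f0' = mix 1 G0 s x"
  have p: "f > 0" "f0 > 0" using mix_0_pos[OF G] mix_0_pos[OF G0] by (auto simp: f_def f0_def)
  define D E B where "D = f' - f0'" and "E = f - f0" and "B = f' / f + f0' / f0"
  define W where "W = f + f0"
  have W: "W > 0" using p by (simp add: W_def)
  have \<Lambda>1: "\<Lambda> > 1" using \<Lambda> M1 by simp
  have sc: "\<bar>f' / f\<bar> \<le> 2 * M * \<Lambda> * (1 + R)" "\<bar>f0' / f0\<bar> \<le> 2 * M * \<Lambda> * (1 + R)"
  proof -
    \<comment> \<open>Tweedie's formula read backwards: bounds for the posterior mean and for x
      bound the score.\<close>
    have gen: "\<bar>y\<bar> \<le> 2 * M * \<Lambda> * (1 + R)" if "\<bar>x + s\<^sup>2 * y\<bar> \<le> \<Lambda> * (1 + R)" for y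
    proof -
      have "1 * (1 + R) \<le> \<Lambda> * (1 + R)" using \<Lambda>1 R by (intro mult_right_mono) auto
      moreover have "\<bar>s\<^sup>2 * y\<bar> \<le> \<bar>x + s\<^sup>2 * y\<bar> + \<bar>x\<bar>" using abs_triangle_ineq4[of "x + s\<^sup>2 * y" x] by simp
      moreover have "a \<le> 2 * c" if "1 * (1 + R) \<le> c" "a \<le> b + d" "b \<le> c" "d \<le> R" for a b c d :: real
        using that by simp
      ultimately have "\<bar>s\<^sup>2 * y\<bar> \<le> 2 * (\<Lambda> * (1 + R))" using that R(2) by blast
      then have "s\<^sup>2 * \<bar>y\<bar> \<le> 2 * \<Lambda> * (1 + R)" by (simp add: abs_mult)
      then have "1 / s\<^sup>2 * (s\<^sup>2 * \<bar>y\<bar>) \<le> M * (2 * \<Lambda> * (1 + R))"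
        by (rule mult_mono[OF inv_s2_le]) (use M1 s0 in auto)
      then show ?thesis using s0 by (simp add: mult_ac)
    qed
    have "\<Lambda> * (1 + \<bar>x\<bar>) \<le> \<Lambda> * (1 + R)" using \<Lambda>1 R by (intro mult_left_mono) auto
    with growth[of x] have "\<bar>x + s\<^sup>2 * (f' / f)\<bar> \<le> \<Lambda> * (1 + R)"
      unfolding posterior_mean_eq(1)[OF G, of x] f_def f'_def by (rule order_trans)
    then show "\<bar>f' / f\<bar> \<le> 2 * M * \<Lambda> * (1 + R)" by (rule gen)
    have "M \<le> \<Lambda> * 1" using \<Lambda> by simp
    also have "\<dots> \<le> \<Lambda> * (1 + R)" using \<Lambda>1 R by (intro mult_left_mono) auto
    finally have "M \<le> \<Lambda> * (1 + R)" .
    with abs_posterior_mean_prior_le[of x] have "\<bar>x + s\<^sup>2 * (f0' / f0)\<bar> \<le> \<Lambda> * (1 + R)"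
      unfolding posterior_mean_eq(1)[OF G0, of x] f0_def f0'_def by (rule order_trans)
    then show "\<bar>f0' / f0\<bar> \<le> 2 * M * \<Lambda> * (1 + R)" by (rule gen)
  qed
  have "\<bar>B\<bar> \<le> 4 * M * \<Lambda> * (1 + R)" using sc unfolding B_def by linarith
  then have "\<bar>B\<bar>\<^sup>2 \<le> (4 * M * \<Lambda> * (1 + R))\<^sup>2" by (rule power_mono) simp
  then have B2: "B\<^sup>2 \<le> 16 * M\<^sup>2 * \<Lambda>\<^sup>2 * (1 + R)\<^sup>2" by (simp add: power_mult_distrib)
  \<comment> \<open>Symmetrising puts the single denominator \<open>W = f + f0\<close> in place of f
    and f0, either of which may be tiny on its own.\<close>
  have id: "f' / f - f0' / f0 = (2 * D - E * B) / W"
  proof -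
    have "(a - b) * (f + f0) = 2 * (a * f - b * f0) - (f - f0) * (a + b)" for a b
      by (simp add: algebra_simps)
    from this[of "f' / f" "f0' / f0"] p show ?thesis
      using W unfolding D_def E_def B_def W_def by (simp add: eq_divide_eq)
  qed
  have "(f' / f - f0' / f0)\<^sup>2 * f0 \<le> (8 * D\<^sup>2 + 2 * (E\<^sup>2 * B\<^sup>2)) / W"
  proof -
    have "(2 * D - E * B)\<^sup>2 \<le> 8 * D\<^sup>2 + 2 * (E\<^sup>2 * B\<^sup>2)"
      using zero_le_power2[of "2 * D + E * B"] by (simp add: power2_eq_square algebra_simps)
    then have "(2 * D - E * B)\<^sup>2 * f0 \<le> (8 * D\<^sup>2 + 2 * (E\<^sup>2 * B\<^sup>2)) * W"
      using p by (intro mult_mono) (auto simp: W_def)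
    then have "(2 * D - E * B)\<^sup>2 * f0 / (W * W) \<le> (8 * D\<^sup>2 + 2 * (E\<^sup>2 * B\<^sup>2)) * W / (W * W)"
      using W by (intro divide_right_mono) auto
    then show ?thesis using W unfolding id by (simp add: power_divide power2_eq_square[of W])
  qed
  also have "\<dots> = 8 * (D\<^sup>2 / W) + 2 * (E\<^sup>2 / W) * B\<^sup>2" by (simp add: add_divide_distrib)
  also have "\<dots> \<le> 8 * (2 * (D\<^sup>2 / (W + \<rho>))) + 2 * (2 * (sqrt f - sqrt f0)\<^sup>2) * (16 * M\<^sup>2 * \<Lambda>\<^sup>2 * (1 + R)\<^sup>2)"
  proof (intro add_mono mult_left_mono mult_mono)
    \<comment> \<open>Where the sum of the densities exceeds \<rho>, adding the floor to the
      denominator changes it by a factor of at most two.\<close>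
    have "W + \<rho> \<le> 2 * W" using \<rho> by (simp add: W_def f_def f0_def)
    then have "D\<^sup>2 / (2 * W) \<le> D\<^sup>2 / (W + \<rho>)" using W \<rho> by (intro divide_left_mono) auto
    then show "D\<^sup>2 / W \<le> 2 * (D\<^sup>2 / (W + \<rho>))" by simp
    show "E\<^sup>2 / W \<le> 2 * (sqrt f - sqrt f0)\<^sup>2"
      using mixdiff_0_sq_le[OF G G0 \<rho>(1), of x]
      by (simp add: E_def W_def f_def f0_def mixdiff_def[OF G G0 \<rho>(1)])
  qed (use B2 in auto)
  also have "\<dots> = 16 * (D\<^sup>2 / (W + \<rho>)) + 64 * M\<^sup>2 * \<Lambda>\<^sup>2 * (1 + R)\<^sup>2 * (sqrt f - sqrt f0)\<^sup>2" by (simp add: mult_ac)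
  finally have main: "(f' / f - f0' / f0)\<^sup>2 * f0
     \<le> 16 * (D\<^sup>2 / (W + \<rho>)) + 64 * M\<^sup>2 * \<Lambda>\<^sup>2 * (1 + R)\<^sup>2 * (sqrt f - sqrt f0)\<^sup>2" (is "?l \<le> ?r") .
  have "(posterior_mean G s x - posterior_mean G0 s x)\<^sup>2 * mix 0 G0 s x = (s\<^sup>2)\<^sup>2 * ?l"
  proof -
    have "(x + s\<^sup>2 * a) - (x + s\<^sup>2 * b) = s\<^sup>2 * (a - b)" for a b by (simp add: algebra_simps)
    then show ?thesis
      by (simp only: posterior_mean_eq(1)[OF G] posterior_mean_eq(1)[OF G0]
        f_def f0_def f'_def f0'_def power_mult_distrib mult.assoc)
  qed
  also have "\<dots> \<le> M\<^sup>2 * ?r"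
    using main p s2_upper M1 by (intro mult_mono power_mono) auto
  also have "\<dots> = 16 * M\<^sup>2 * ((mixdiff G G0 1 x)\<^sup>2 / mixwt G G0 \<rho> x)
      + 64 * M ^ 4 * \<Lambda>\<^sup>2 * (1 + R)\<^sup>2 * (sqrt (mix 0 G s x) - sqrt (mix 0 G0 s x))\<^sup>2"
    by (simp add: mixdiff_def[OF G G0 \<rho>(1)] mixwt_def[OF G G0 \<rho>(1)] D_def W_def f_def f0_def f'_def f0'_def
        power4_eq_xxxx power2_eq_square algebra_simps)
  finally show ?thesis .
qed

text \<open>On \<open>{-R..R}\<close> the pointwise comparison applies because the two densities are
  not both small there. Outside, the linear growth of both posterior means meets the tail of the
  prior mixture, which yields \<open>exp (- R)\<close>.\<close>

lemma bayes_risk_diff_le: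
  assumes \<Lambda>: "\<Lambda> \<ge> M" and R: "R \<ge> 0"
    and \<rho>: "\<rho> > 0" "\<And>x. \<bar>x\<bar> \<le> R \<Longrightarrow> mix 0 G s x + mix 0 G0 s x \<ge> \<rho>"
  shows "bayes_risk G G0 s - bayes_risk G0 G0 s \<le> 16 * M\<^sup>2 * wnorm2 G G0 \<rho> 1
    + 64 * M ^ 4 * \<Lambda>\<^sup>2 * (1 + R)\<^sup>2 * hell2 G G0 s + 4 * \<Lambda>\<^sup>2 * regret_const M * exp (- R)"
proof -
  define b where "b x = 16 * M\<^sup>2 * ((mixdiff G G0 1 x)\<^sup>2 / mixwt G G0 \<rho> x)
      + 64 * M ^ 4 * \<Lambda>\<^sup>2 * (1 + R)\<^sup>2 * (sqrt (mix 0 G s x) - sqrt (mix 0 G0 s x))\<^sup>2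
      + 4 * \<Lambda>\<^sup>2 * regret_const M * exp (- R) * tail_env x" for x
  have ib: "integrable lborel b"
    unfolding b_def[abs_def]
    by (intro Bochner_Integration.integrable_add integrable_mult_right wnorm2_integrable[OF G G0 \<rho>(1)]
        hell2_integrable[OF G G0 \<rho>(1)] tail_env_integrable)
  have rc: "regret_const M \<ge> 0" using M1 by (simp add: regret_const_def)
  have "(posterior_mean G s x - posterior_mean G0 s x)\<^sup>2 * mix 0 G0 s x \<le> b x" for x
  proof (cases "\<bar>x\<bar> \<le> R")
    case True
    have "0 \<le> 4 * \<Lambda>\<^sup>2 * regret_const M * exp (- R) * tail_env x"
      using rc by (simp add: tail_env_def)
    then show ?thesis using posterior_mean_diff_sq_le[OF \<Lambda> R True \<rho>(1) \<rho>(2)[OF True]] unfolding b_def by linarith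
  next
    case False
    have "\<bar>posterior_mean G s x - posterior_mean G0 s x\<bar> \<le> \<Lambda> * (1 + \<bar>x\<bar>) + \<Lambda> * 1"
      using growth[of x] abs_posterior_mean_prior_le[of x] \<Lambda> by linarith
    also have "\<dots> \<le> 2 * \<Lambda> * (1 + \<bar>x\<bar>)" using \<Lambda> M1 by (simp add: algebra_simps)
    finally have "\<bar>posterior_mean G s x - posterior_mean G0 s x\<bar>\<^sup>2 \<le> (2 * \<Lambda> * (1 + \<bar>x\<bar>))\<^sup>2"
      by (rule power_mono) simp
    then have "(posterior_mean G s x - posterior_mean G0 s x)\<^sup>2 * mix 0 G0 s x \<le> (2 * \<Lambda> * (1 + \<bar>x\<bar>))\<^sup>2 * mix 0 G0 s x"
      using mix_0_pos[OF G0, of x] by (intro mult_right_mono) auto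
    also have "\<dots> = 4 * \<Lambda>\<^sup>2 * ((1 + \<bar>x\<bar>)\<^sup>2 * mix 0 G0 s x)" by (simp add: power_mult_distrib)
    also have "\<dots> \<le> 4 * \<Lambda>\<^sup>2 * (regret_const M * exp (- \<bar>x\<bar>) * tail_env x)"
      using mix_0_quadratic_le[of x] by (intro mult_left_mono) auto
    also have "\<dots> \<le> 4 * \<Lambda>\<^sup>2 * (regret_const M * exp (- R) * tail_env x)"
      using False rc by (intro mult_left_mono mult_right_mono) (auto simp: tail_env_def)
    also have "\<dots> \<le> b x"
      using mixwt_pos[OF G G0 \<rho>(1), of x] M1 by (simp add: b_def less_imp_le)
    finally show ?thesis .
  qed
  then have "bayes_risk G G0 s - bayes_risk G0 G0 s \<le> (\<integral>x. b x \<partial>lborel)"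
    unfolding bayes_risk_diff(2) by (intro integral_mono bayes_risk_diff(1) ib)
  also have "\<dots> = 16 * M\<^sup>2 * wnorm2 G G0 \<rho> 1
    + 64 * M ^ 4 * \<Lambda>\<^sup>2 * (1 + R)\<^sup>2 * hell2 G G0 s + 4 * \<Lambda>\<^sup>2 * regret_const M * exp (- R)"
  proof -
    define p1 p2 where "p1 x = (mixdiff G G0 1 x)\<^sup>2 / mixwt G G0 \<rho> x"
      and "p2 x = (sqrt (mix 0 G s x) - sqrt (mix 0 G0 s x))\<^sup>2" for x
    have "integrable lborel p1" "integrable lborel p2" "(\<integral>x. p1 x \<partial>lborel) = wnorm2 G G0 \<rho> 1" "(\<integral>x. p2 x \<partial>lborel) = hell2 G G0 s"
      using wnorm2_integrable[OF G G0 \<rho>(1), of 1] hell2_integrable[OF G G0 \<rho>(1)]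
      by (simp_all only: p1_def[abs_def] p2_def[abs_def] wnorm2_def[OF G G0 \<rho>(1)] hell2_def)
    then show ?thesis unfolding b_def p1_def[symmetric] p2_def[symmetric] using tail_env_integrable by simp
  qed
  finally show ?thesis .
qed

end

end

end

section \<open>A Hoelder inequality for correlated Gaussian variables\<close>

lemma real_distribution_std_normal: "real_distribution std_normal"
  unfolding std_normal_def by (rule real_dist_normal_dist)

interpretation std_normal: real_distribution std_normal
  by (rule real_distribution_std_normal)

lemma sets_std_normal [simp, measurable_cong]: "sets std_normal = sets borel"
  by (simp add: std_normal_def)

lemma std_normal_moments:
  "integrable std_normal (\<lambda>y. y)" "(\<integral>y. y \<partial>std_normal) = 0"
  "integrable std_normal (\<lambda>y. y\<^sup>2)" "(\<integral>y. y\<^sup>2 \<partial>std_normal) = 1"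
proof -
  show "integrable std_normal (\<lambda>y. y)"
    using integrable_std_normal_distribution_moment[of 1] by (simp add: std_normal_def)
  show "(\<integral>y. y \<partial>std_normal) = 0"
    using integral_std_normal_distribution_moment_odd[of 1] by (simp add: std_normal_def)
  show "integrable std_normal (\<lambda>y. y\<^sup>2)"
    using integrable_std_normal_distribution_moment[of 2] by (simp add: std_normal_def)
  show "(\<integral>y. y\<^sup>2 \<partial>std_normal) = 1"
    using std_normal_distribution_even_moments(1)[of 1] by (simp add: std_normal_def)
qed

lemma std_normal_exp_integrable: "integrable std_normal (\<lambda>y. exp (c * \<bar>y\<bar>))"
proof -
  have "integrable lborel (\<lambda>y. exp (c * \<bar>y\<bar>) * normal_density 0 1 y)"
  proof (rule Bochner_Integration.integrable_bound)
    show "integrable lborel (\<lambda>y. sqrt 2 * exp (c\<^sup>2 * 1\<^sup>2) * normal_density 0 (sqrt 2 * 1) y)" by simp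
    show "AE y in lborel. norm (exp (c * \<bar>y\<bar>) * normal_density 0 1 y)
        \<le> norm (sqrt 2 * exp (c\<^sup>2 * 1\<^sup>2) * normal_density 0 (sqrt 2 * 1) y)"
      using exp_abs_mult_normal_density_le[of 1 c] by (auto simp: abs_mult)
  qed measurable
  then show ?thesis unfolding std_normal_def by (subst integrable_density) (auto simp: mult.commute)
qed

lemma char_std_normal: "char std_normal t = exp (- t\<^sup>2 / 2)"
  using char_std_normal_distribution by (simp add: std_normal_def fun_eq_iff)

lemma distr_std_normal_conv:
  assumes "a\<^sup>2 + b\<^sup>2 = 1"
  shows "distr (std_normal \<Otimes>\<^sub>M std_normal) borel (\<lambda>(y, w). a * y + b * w) = std_normal"
proof (rule Levy_uniqueness)
  interpret P: pair_prob_space std_normal std_normal ..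
  show "real_distribution (distr (std_normal \<Otimes>\<^sub>M std_normal) borel (\<lambda>(y, w). a * y + b * w))"
    by (rule P.real_distribution_distr) measurable
  show "char (distr (std_normal \<Otimes>\<^sub>M std_normal) borel (\<lambda>(y, w). a * y + b * w)) = char std_normal"
  proof
    fix t
    have i: "integrable (std_normal \<Otimes>\<^sub>M std_normal) (\<lambda>(y, w). iexp (t * (a * y + b * w)))"
      by (rule P.integrable_const_bound[where B = 1]) (auto simp: case_prod_unfold)
    have "char (distr (std_normal \<Otimes>\<^sub>M std_normal) borel (\<lambda>(y, w). a * y + b * w)) t
       = (\<integral>p. (\<lambda>(y, w). iexp (t * (a * y + b * w))) p \<partial>(std_normal \<Otimes>\<^sub>M std_normal))"
      by (simp add: char_def integral_distr case_prod_unfold)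
    also have "\<dots> = (\<integral>y. (\<integral>w. iexp (t * (a * y + b * w)) \<partial>std_normal) \<partial>std_normal)"
      using P.integral_fst'[OF i] by simp
    also have "\<dots> = (\<integral>y. (\<integral>w. iexp (t * a * y) * iexp (t * b * w) \<partial>std_normal) \<partial>std_normal)"
      by (simp add: algebra_simps flip: exp_add)
    also have "\<dots> = char std_normal (t * a) * char std_normal (t * b)"
      by (simp add: char_def)
    also have "\<dots> = exp (- (t\<^sup>2 * (a\<^sup>2 + b\<^sup>2)) / 2)"
      by (simp add: char_std_normal power_mult_distrib algebra_simps add_divide_distrib diff_divide_distrib flip: exp_add of_real_mult)
    finally show "char (distr (std_normal \<Otimes>\<^sub>M std_normal) borel (\<lambda>(y, w). a * y + b * w)) t = char std_normal t"
      by (simp add: assms char_std_normal)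
  qed
qed (rule real_distribution_std_normal)

lemma integral_std_normal_conv:
  fixes h :: "real \<Rightarrow> real"
  assumes ab: "a\<^sup>2 + b\<^sup>2 = 1" and [measurable]: "h \<in> borel_measurable borel" and B: "\<And>x. \<bar>h x\<bar> \<le> B"
  shows "(\<integral>y. (\<integral>w. h (a * y + b * w) \<partial>std_normal) \<partial>std_normal) = (\<integral>y. h y \<partial>std_normal)"
proof -
  interpret P: pair_prob_space std_normal std_normal ..
  have i: "integrable (std_normal \<Otimes>\<^sub>M std_normal) (\<lambda>(y, w). h (a * y + b * w))"
    by (rule P.integrable_const_bound[where B = B]) (auto simp: case_prod_unfold B)
  have "(\<integral>y. h y \<partial>std_normal) = (\<integral>y. h y \<partial>(distr (std_normal \<Otimes>\<^sub>M std_normal) borel (\<lambda>(y, w). a * y + b * w)))"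
    by (simp add: distr_std_normal_conv[OF ab])
  also have "\<dots> = (\<integral>p. (\<lambda>(y, w). h (a * y + b * w)) p \<partial>(std_normal \<Otimes>\<^sub>M std_normal))"
    by (subst integral_distr) (auto simp: case_prod_unfold)
  also have "\<dots> = (\<integral>y. (\<integral>w. h (a * y + b * w) \<partial>std_normal) \<partial>std_normal)"
    using P.integral_fst'[OF i] by simp
  finally show ?thesis by simp
qed

text \<open>The limit law is written as that of a scaled standard normal variable rather than by a
  density, so that a vanishing coefficient vector is included. Characteristic functions factor over
  the coordinates.\<close>

lemma distr_linear_form:
  fixes c :: "'i \<Rightarrow> real"
  assumes I: "finite I"
  shows "distr (\<Pi>\<^sub>M i\<in>I. std_normal) borel (\<lambda>z. \<Sum>i\<in>I. c i * z i)
    = distr std_normal borel (\<lambda>y. sqrt (\<Sum>i\<in>I. (c i)\<^sup>2) * y)"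
proof (rule Levy_uniqueness)
  interpret P: prob_space "\<Pi>\<^sub>M i\<in>I. std_normal" by (rule prob_space_PiM) (rule std_normal.prob_space_axioms)
  interpret S: product_sigma_finite "\<lambda>_::'i. std_normal" ..
  show "real_distribution (distr (\<Pi>\<^sub>M i\<in>I. std_normal) borel (\<lambda>z. \<Sum>i\<in>I. c i * z i))"
    by (rule P.real_distribution_distr) measurable
  show "real_distribution (distr std_normal borel (\<lambda>y. sqrt (\<Sum>i\<in>I. (c i)\<^sup>2) * y))"
    by (rule std_normal.real_distribution_distr) measurable
  show "char (distr (\<Pi>\<^sub>M i\<in>I. std_normal) borel (\<lambda>z. \<Sum>i\<in>I. c i * z i))
    = char (distr std_normal borel (\<lambda>y. sqrt (\<Sum>i\<in>I. (c i)\<^sup>2) * y))"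
  proof
    fix t
    have "char (distr (\<Pi>\<^sub>M i\<in>I. std_normal) borel (\<lambda>z. \<Sum>i\<in>I. c i * z i)) t
      = (\<integral>z. (\<Prod>i\<in>I. iexp (t * c i * z i)) \<partial>(\<Pi>\<^sub>M i\<in>I. std_normal))"
      by (simp add: char_def integral_distr exp_sum[OF I, symmetric] sum_distrib_left mult_ac)
    also have "\<dots> = (\<Prod>i\<in>I. char std_normal (t * c i))"
      unfolding char_def
      by (intro S.product_integral_prod[OF I] std_normal.integrable_const_bound[where B = 1]) auto
    also have "\<dots> = (\<Prod>i\<in>I. complex_of_real (exp (- (t\<^sup>2 * (c i)\<^sup>2) / 2)))"
      by (simp add: char_std_normal power_mult_distrib)
    also have "\<dots> = exp (- (t\<^sup>2 * (\<Sum>i\<in>I. (c i)\<^sup>2)) / 2)"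
      by (simp add: exp_sum[OF I, symmetric] sum_distrib_left sum_divide_distrib sum_negf flip: of_real_prod)
    also have "\<dots> = char std_normal (t * sqrt (\<Sum>i\<in>I. (c i)\<^sup>2))"
      by (simp add: char_std_normal power_mult_distrib sum_nonneg)
    also have "\<dots> = char (distr std_normal borel (\<lambda>y. sqrt (\<Sum>i\<in>I. (c i)\<^sup>2) * y)) t"
      by (simp add: char_def integral_distr mult_ac)
    finally show "char (distr (\<Pi>\<^sub>M i\<in>I. std_normal) borel (\<lambda>z. \<Sum>i\<in>I. c i * z i)) t
      = char (distr std_normal borel (\<lambda>y. sqrt (\<Sum>i\<in>I. (c i)\<^sup>2) * y)) t" .
  qed
qed

text \<open>Splits a Gaussian vector into two independent scaled copies, that is, into increments of
  a Brownian path. Testing on boxes reduces the claim to one coordinate.\<close>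

lemma distr_std_normal_product_conv:
  assumes I: "finite (I :: 'i set)" and ab: "a\<^sup>2 + b\<^sup>2 = 1"
  defines "\<mu> \<equiv> \<Pi>\<^sub>M i\<in>I. std_normal"
  shows "distr (\<mu> \<Otimes>\<^sub>M \<mu>) \<mu> (\<lambda>(z, w). \<lambda>i\<in>I. a * z i + b * w i) = \<mu>"
proof -
  interpret P: prob_space \<mu> unfolding \<mu>_def by (rule prob_space_PiM) (rule std_normal.prob_space_axioms)
  interpret PP: pair_prob_space \<mu> \<mu> ..
  interpret Q: pair_prob_space std_normal std_normal ..
  interpret S: product_sigma_finite "\<lambda>_::'i. std_normal" ..
  have m [measurable]: "(\<lambda>(z, w). \<lambda>i\<in>I. a * z i + b * w i) \<in> measurable (\<mu> \<Otimes>\<^sub>M \<mu>) \<mu>"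
    unfolding \<mu>_def by measurable
  show ?thesis
    unfolding \<mu>_def
  proof (rule S.PiM_eqI[OF I])
    fix A :: "'i \<Rightarrow> real set" assume "\<And>i. i \<in> I \<Longrightarrow> A i \<in> sets std_normal"
    then have A [measurable]: "\<And>i. i \<in> I \<Longrightarrow> A i \<in> sets borel" by simp
    have box: "Pi\<^sub>E I A \<in> sets \<mu>" unfolding \<mu>_def using A I by (intro sets_PiM_I_finite) auto
    have one: "(\<integral>\<^sup>+y. \<integral>\<^sup>+w. indicator (A i) (a * y + b * w) \<partial>std_normal \<partial>std_normal) = emeasure std_normal (A i)" if "i \<in> I" for i
    proof -
      have [measurable]: "A i \<in> sets borel" using A that .
      have "emeasure std_normal (A i) = emeasure (distr (std_normal \<Otimes>\<^sub>M std_normal) borel (\<lambda>(y, w). a * y + b * w)) (A i)"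
        by (simp add: distr_std_normal_conv[OF ab])
      also have "\<dots> = (\<integral>\<^sup>+x. indicator (A i) x \<partial>distr (std_normal \<Otimes>\<^sub>M std_normal) borel (\<lambda>(y, w). a * y + b * w))"
        by simp
      also have "\<dots> = (\<integral>\<^sup>+p. (\<lambda>(y, w). indicator (A i) (a * y + b * w)) p \<partial>(std_normal \<Otimes>\<^sub>M std_normal))"
        by (subst nn_integral_distr) (auto simp: case_prod_unfold)
      also have "\<dots> = (\<integral>\<^sup>+y. \<integral>\<^sup>+w. indicator (A i) (a * y + b * w) \<partial>std_normal \<partial>std_normal)"
        by (subst std_normal.nn_integral_fst[symmetric]) (auto simp: case_prod_unfold)
      finally show ?thesis by simp
    qed
    have ind: "indicator (Pi\<^sub>E I A) (\<lambda>i\<in>I. a * z i + b * w i) = (\<Prod>i\<in>I. indicator (A i) (a * z i + b * w i) :: ennreal)" for z w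
      using I by (auto simp: indicator_def PiE_iff prod_zero_iff)
    have "emeasure (distr (\<mu> \<Otimes>\<^sub>M \<mu>) \<mu> (\<lambda>(z, w). \<lambda>i\<in>I. a * z i + b * w i)) (Pi\<^sub>E I A)
      = (\<integral>\<^sup>+x. indicator (Pi\<^sub>E I A) x \<partial>distr (\<mu> \<Otimes>\<^sub>M \<mu>) \<mu> (\<lambda>(z, w). \<lambda>i\<in>I. a * z i + b * w i))"
      using box by simp
    also have "\<dots> = (\<integral>\<^sup>+p. (\<lambda>(z, w). indicator (Pi\<^sub>E I A) (\<lambda>i\<in>I. a * z i + b * w i)) p \<partial>(\<mu> \<Otimes>\<^sub>M \<mu>))"
      using box by (subst nn_integral_distr) (auto simp: case_prod_unfold)
    also have "\<dots> = (\<integral>\<^sup>+z. \<integral>\<^sup>+w. indicator (Pi\<^sub>E I A) (\<lambda>i\<in>I. a * z i + b * w i) \<partial>\<mu> \<partial>\<mu>)"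
      using box measurable_compose[OF m borel_measurable_indicator[OF box]]
      by (subst P.nn_integral_fst[symmetric]) (auto simp: case_prod_unfold)
    also have "\<dots> = (\<integral>\<^sup>+z. (\<Prod>i\<in>I. \<integral>\<^sup>+w. indicator (A i) (a * z i + b * w) \<partial>std_normal) \<partial>\<mu>)"
      unfolding ind \<mu>_def using A
      by (intro nn_integral_cong S.product_nn_integral_prod I) measurable
    also have "\<dots> = (\<Prod>i\<in>I. \<integral>\<^sup>+y. \<integral>\<^sup>+w. indicator (A i) (a * y + b * w) \<partial>std_normal \<partial>std_normal)"
      unfolding \<mu>_def using A
      by (intro S.product_nn_integral_prod[of I "\<lambda>i y. \<integral>\<^sup>+w. indicator (A i) (a * y + b * w) \<partial>std_normal"] I) measurable
    also have "\<dots> = (\<Prod>i\<in>I. emeasure std_normal (A i))" by (intro prod.cong one) auto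
    finally show "emeasure (distr ((\<Pi>\<^sub>M i\<in>I. std_normal) \<Otimes>\<^sub>M (\<Pi>\<^sub>M i\<in>I. std_normal)) (\<Pi>\<^sub>M i\<in>I. std_normal)
        (\<lambda>(z, w). \<lambda>i\<in>I. a * z i + b * w i)) (Pi\<^sub>E I A) = (\<Prod>i\<in>I. emeasure std_normal (A i))"
      by (simp add: \<mu>_def)
  qed simp
qed

section \<open>The heat semigroup on smooth bounded functions\<close>

text \<open>
  The first-order Taylor condition, rather than two derivatives, is what averaging over a Gaussian
  shift visibly preserves with the same constants.
\<close>

definition smooth_bdd :: "real \<Rightarrow> real \<Rightarrow> real \<Rightarrow> (real \<Rightarrow> real) \<Rightarrow> bool" where
  "smooth_bdd \<delta> B C g \<longleftrightarrow> g \<in> borel_measurable borel \<and> (\<forall>x. \<delta> \<le> g x \<and> g x \<le> B) \<and>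
     (\<forall>x y. \<bar>g (x + y) - g x\<bar> \<le> C * \<bar>y\<bar>) \<and>
     (\<exists>g1 \<in> borel_measurable borel. \<forall>x y. \<bar>g (x + y) - g x - g1 x * y\<bar> \<le> C * y\<^sup>2)"

text \<open>The heat semigroup, parametrised by the standard deviation: composing two averages adds
  the squares of their parameters.\<close>

definition gauss_avg :: "real \<Rightarrow> (real \<Rightarrow> real) \<Rightarrow> real \<Rightarrow> real" where
  "gauss_avg s g x = (\<integral>y. g (x + s * y) \<partial>std_normal)"

lemma gauss_avg_0: "gauss_avg 0 g x = g x"
  by (simp add: gauss_avg_def std_normal.prob_space[simplified])

lemma smooth_bdd_abs_le:
  assumes "smooth_bdd \<delta> B C g"
  shows "\<bar>g x\<bar> \<le> \<bar>\<delta>\<bar> + \<bar>B\<bar>"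
proof -
  have "\<delta> \<le> g x" "g x \<le> B" using assms by (auto simp: smooth_bdd_def)
  then show ?thesis by (intro abs_leI) linarith+
qed

lemma smooth_bdd_integrable:
  assumes "smooth_bdd \<delta> B C g"
  shows "integrable std_normal (\<lambda>y. g (x + s * y))"
proof -
  have [measurable]: "g \<in> borel_measurable borel" using assms by (simp add: smooth_bdd_def)
  show ?thesis using smooth_bdd_abs_le[OF assms]
    by (intro std_normal.integrable_const_bound[where B = "\<bar>\<delta>\<bar> + \<bar>B\<bar>"]) auto
qed

lemma smooth_bdd_gauss_avg:
  assumes g: "smooth_bdd \<delta> B C g"
  shows "smooth_bdd \<delta> B C (gauss_avg s g)"
proof -
  have gm [measurable]: "g \<in> borel_measurable borel" and gb: "\<And>x. \<delta> \<le> g x" "\<And>x. g x \<le> B"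
    and lip: "\<And>x y. \<bar>g (x + y) - g x\<bar> \<le> C * \<bar>y\<bar>"
    using g by (auto simp: smooth_bdd_def)
  obtain g1 where [measurable]: "g1 \<in> borel_measurable borel"
    and tay: "\<And>x y. \<bar>g (x + y) - g x - g1 x * y\<bar> \<le> C * y\<^sup>2"
    using g by (auto simp: smooth_bdd_def)
  \<comment> \<open>Comparing the Lipschitz and the Taylor condition at increment 1 shows that the
    derivative is bounded, hence can be averaged.\<close>
  have g1b: "\<bar>g1 x\<bar> \<le> 2 * C" for x
    using lip[of x 1] tay[of x 1] by simp
  note gi = smooth_bdd_integrable[OF g]
  have g1i: "integrable std_normal (\<lambda>y. g1 (x + s * y))" for x
    by (rule std_normal.integrable_const_bound[where B = "2 * C"]) (use g1b in auto)
  have bd: "\<bar>\<integral>y. k y \<partial>std_normal\<bar> \<le> D" if "integrable std_normal k" "\<And>y. \<bar>k y\<bar> \<le> D" for k :: "real \<Rightarrow> real" and D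
    using that by (intro order_trans[OF integral_abs_bound] std_normal.integral_le_const) auto
  show ?thesis unfolding smooth_bdd_def
  proof (intro conjI allI bexI[of _ "gauss_avg s g1"])
    show "gauss_avg s g \<in> borel_measurable borel" "gauss_avg s g1 \<in> borel_measurable borel"
      unfolding gauss_avg_def[abs_def] by measurable
    show "\<delta> \<le> gauss_avg s g x" "gauss_avg s g x \<le> B" for x
      unfolding gauss_avg_def using gi gb
      by (auto intro!: std_normal.integral_ge_const std_normal.integral_le_const)
    show "\<bar>gauss_avg s g (x + y) - gauss_avg s g x\<bar> \<le> C * \<bar>y\<bar>" for x y
    proof -
      have e: "gauss_avg s g (x + y) - gauss_avg s g x = (\<integral>w. g ((x + s * w) + y) - g (x + s * w) \<partial>std_normal)"
        using gi[of "x + y" s] gi[of x s] by (simp add: gauss_avg_def add_ac)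
      show ?thesis unfolding e
        by (rule bd[OF _ lip]) (use gi[of "x + y" s] gi[of x s] in \<open>simp add: add_ac\<close>)
    qed
    show "\<bar>gauss_avg s g (x + y) - gauss_avg s g x - gauss_avg s g1 x * y\<bar> \<le> C * y\<^sup>2" for x y
    proof -
      have e: "gauss_avg s g (x + y) - gauss_avg s g x - gauss_avg s g1 x * y
          = (\<integral>w. g ((x + s * w) + y) - g (x + s * w) - g1 (x + s * w) * y \<partial>std_normal)"
        using gi[of "x + y" s] gi[of x s] g1i[of x] by (simp add: gauss_avg_def add_ac)
      show ?thesis unfolding e
        by (rule bd[OF _ tay]) (use gi[of "x + y" s] gi[of x s] g1i[of x] in \<open>simp add: add_ac\<close>)
    qed
  qed
qed

lemma gauss_avg_gauss_avg:
  assumes g: "smooth_bdd \<delta> B C g" and r: "r > 0" "a\<^sup>2 + b\<^sup>2 = r\<^sup>2"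
  shows "gauss_avg a (gauss_avg b g) x = gauss_avg r g x"
proof -
  have [measurable]: "g \<in> borel_measurable borel" using g by (simp add: smooth_bdd_def)
  note gb = smooth_bdd_abs_le[OF g]
  have "(a / r)\<^sup>2 + (b / r)\<^sup>2 = 1" using r by (simp add: power_divide flip: add_divide_distrib)
  from integral_std_normal_conv[OF this, of "\<lambda>y. g (x + r * y)" "\<bar>\<delta>\<bar> + \<bar>B\<bar>"] gb r(1)
  show ?thesis by (simp add: gauss_avg_def algebra_simps)
qed

section \<open>A short time step of the heat flow\<close>

lemma exp_taylor_quadratic:
  fixes t :: real
  shows "\<bar>exp t - 1 - t - t\<^sup>2 / 2\<bar> \<le> \<bar>t\<bar> ^ 3 * exp \<bar>t\<bar>"
proof -
  obtain u where u: "\<bar>u\<bar> \<le> \<bar>t\<bar>" and e: "exp t = (\<Sum>m<3. t ^ m / fact m) + exp u / fact 3 * t ^ 3"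
    using Maclaurin_exp_le[of t 3] by auto
  have "exp t - 1 - t - t\<^sup>2 / 2 = exp u / 6 * t ^ 3"
    unfolding e by (simp add: numeral_3_eq_3 numeral_2_eq_2)
  then have "\<bar>exp t - 1 - t - t\<^sup>2 / 2\<bar> = exp u / 6 * \<bar>t\<bar> ^ 3"
    by (simp only: abs_mult power_abs abs_divide abs_exp_cancel abs_numeral)
  also have "\<dots> \<le> exp \<bar>t\<bar> * \<bar>t\<bar> ^ 3"
  proof (rule mult_right_mono)
    have "exp u \<le> exp \<bar>t\<bar>" using u by simp
    moreover have "exp u / 6 \<le> exp u" by simp
    ultimately show "exp u / 6 \<le> exp \<bar>t\<bar>" by (rule order_trans[rotated])
  qed simp
  finally show ?thesis by (simp add: mult.commute)
qed

text \<open>A second-order expansion before taking expectations. Here \<open>l j\<close> is the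
  logarithm of a factor relative to its mean, \<open>s * y j\<close> its linear part in the noise,
  and \<open>W\<close> an envelope of the noise. The right side is arranged so that its linear part
  has mean zero and its quadratic part nonpositive mean; everything else is cubic in
  \<open>s\<close>.\<close>

lemma one_step_pointwise:
  fixes l y :: "'j \<Rightarrow> real"
  assumes J: "finite J" and s: "0 < s" "s \<le> 1" and W: "W \<ge> 1" and c: "c \<ge> 1" and a: "0 \<le> \<alpha>" "\<alpha> \<le> 1"
    and l1: "\<And>j. j \<in> J \<Longrightarrow> \<bar>l j\<bar> \<le> c * s * W"
    and l2: "\<And>j. j \<in> J \<Longrightarrow> \<bar>l j - s * y j\<bar> \<le> c * s\<^sup>2 * W\<^sup>2"
    and y: "\<And>j. j \<in> J \<Longrightarrow> \<bar>y j\<bar> \<le> c * W"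
  defines "N \<equiv> 1 + real (card J)"
  shows "exp (\<alpha> * (\<Sum>j\<in>J. l j)) \<le> 1 + \<alpha> * (\<Sum>j\<in>J. exp (l j) - 1)
     + s\<^sup>2 / 2 * (\<alpha>\<^sup>2 * (\<Sum>j\<in>J. y j)\<^sup>2 - \<alpha> * (\<Sum>j\<in>J. (y j)\<^sup>2))
     + 24 * N ^ 3 * c ^ 3 * s ^ 3 * exp ((N * c + 1) * W)"
proof -
  define T Y n where "T = (\<Sum>j\<in>J. l j)" and "Y = (\<Sum>j\<in>J. y j)" and "n = real (card J)"
  have n0: "n \<ge> 0" and N: "N = 1 + n" by (auto simp: n_def N_def)
  define E where "E = c ^ 3 * s ^ 3 * W ^ 3"
  have E0: "E \<ge> 0" using c s W by (simp add: E_def)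
  have cubeE: "(c * s * W) ^ 3 = E" by (simp add: E_def power_mult_distrib)
  have quadE: "c\<^sup>2 * s ^ 3 * W ^ 3 \<le> E"
    unfolding E_def using c s W by (intro mult_right_mono power_increasing) auto
  have sb: "\<bar>\<Sum>j\<in>J. f j\<bar> \<le> n * D" if "\<And>j. j \<in> J \<Longrightarrow> \<bar>f j\<bar> \<le> D" for f :: "'j \<Rightarrow> real" and D
    by (rule order_trans[OF sum_abs]) (use sum_bounded_above[of J "\<lambda>j. \<bar>f j\<bar>" D] that in \<open>simp add: n_def\<close>)
  have T: "\<bar>T\<bar> \<le> n * (c * s * W)" unfolding T_def by (rule sb[OF l1])
  have TY: "\<bar>T - s * Y\<bar> \<le> n * (c * s\<^sup>2 * W\<^sup>2)"
  proof -
    have "T - s * Y = (\<Sum>j\<in>J. l j - s * y j)" by (simp add: T_def Y_def sum_subtractf sum_distrib_left)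
    then show ?thesis using sb[OF l2] by simp
  qed
  have Y: "\<bar>Y\<bar> \<le> n * (c * W)"
    unfolding Y_def by (rule sb[OF y])
  have sq: "\<bar>p\<^sup>2 - q\<^sup>2\<bar> \<le> A * (2 * B)" if "\<bar>p - q\<bar> \<le> A" "\<bar>p\<bar> \<le> B" "\<bar>q\<bar> \<le> B" for p q A B :: real
  proof -
    have "\<bar>p\<^sup>2 - q\<^sup>2\<bar> = \<bar>p - q\<bar> * \<bar>p + q\<bar>" by (simp add: power2_eq_square algebra_simps flip: abs_mult)
    also have "\<dots> \<le> A * (2 * B)"
    proof (rule mult_mono)
      show "\<bar>p + q\<bar> \<le> 2 * B" using abs_triangle_ineq[of p q] that by linarith
    qed (use that in auto)
    finally show ?thesis .
  qed
  have T2: "T\<^sup>2 \<le> s\<^sup>2 * Y\<^sup>2 + 2 * n\<^sup>2 * E"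
  proof -
    have "\<bar>s * Y\<bar> \<le> n * (c * s * W)"
      using mult_left_mono[OF Y, of s] s by (simp add: abs_mult mult_ac)
    from sq[OF TY T this] have "T\<^sup>2 \<le> (s * Y)\<^sup>2 + n * (c * s\<^sup>2 * W\<^sup>2) * (2 * (n * (c * s * W)))" by linarith
    also have "n * (c * s\<^sup>2 * W\<^sup>2) * (2 * (n * (c * s * W))) = 2 * n\<^sup>2 * (c\<^sup>2 * s ^ 3 * W ^ 3)"
      by (simp add: power2_eq_square power3_eq_cube)
    also have "\<dots> \<le> 2 * n\<^sup>2 * E" using quadE by (intro mult_left_mono) auto
    finally show ?thesis by (simp add: power_mult_distrib)
  qed
  have l2sum: "s\<^sup>2 * (\<Sum>j\<in>J. (y j)\<^sup>2) - 2 * n * E \<le> (\<Sum>j\<in>J. (l j)\<^sup>2)"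
  proof -
    have "s\<^sup>2 * (y j)\<^sup>2 - 2 * E \<le> (l j)\<^sup>2" if j: "j \<in> J" for j
    proof -
      have "\<bar>s * y j\<bar> \<le> c * s * W"
        using mult_left_mono[OF y[OF j], of s] s by (simp add: abs_mult mult_ac)
      from sq[OF l2[OF j] l1[OF j] this] have "(s * y j)\<^sup>2 - c * s\<^sup>2 * W\<^sup>2 * (2 * (c * s * W)) \<le> (l j)\<^sup>2" by linarith
      moreover have "c * s\<^sup>2 * W\<^sup>2 * (2 * (c * s * W)) = 2 * (c\<^sup>2 * s ^ 3 * W ^ 3)"
        by (simp add: power2_eq_square power3_eq_cube)
      ultimately show ?thesis using quadE by (simp add: power_mult_distrib)
    qed
    then have "(\<Sum>j\<in>J. s\<^sup>2 * (y j)\<^sup>2 - 2 * E) \<le> (\<Sum>j\<in>J. (l j)\<^sup>2)" by (rule sum_mono)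
    then show ?thesis by (simp add: sum_subtractf sum_distrib_left n_def mult_ac)
  qed
  define V where "V = exp (N * c * W)"
  have V1: "V \<ge> 1" using n0 c W by (simp add: V_def N)
  have upper: "exp (\<alpha> * T) \<le> 1 + \<alpha> * T + \<alpha>\<^sup>2 * T\<^sup>2 / 2 + n ^ 3 * E * V"
  proof -
    have t: "\<bar>\<alpha> * T\<bar> \<le> n * (c * s * W)"
      using mult_mono[OF a(2) T] a by (simp add: abs_mult)
    have "\<bar>\<alpha> * T\<bar> ^ 3 * exp \<bar>\<alpha> * T\<bar> \<le> (n * (c * s * W)) ^ 3 * V"
    proof (intro mult_mono power_mono)
      have "n * (c * s * W) \<le> N * (c * 1 * W)" using n0 c s W by (intro mult_mono) (auto simp: N)
      with t show "exp \<bar>\<alpha> * T\<bar> \<le> V" by (simp add: V_def mult_ac)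
    qed (use t in auto)
    also have "\<dots> = n ^ 3 * E * V" by (simp add: power_mult_distrib E_def)
    finally show ?thesis using exp_taylor_quadratic[of "\<alpha> * T"] by (simp add: power_mult_distrib)
  qed
  \<comment> \<open>The linear term is traded for \<open>exp (l j) - 1\<close>, whose expectation
    will vanish exactly; the trade produces the negative sum of squares in the claim.\<close>
  have lower: "T + (\<Sum>j\<in>J. (l j)\<^sup>2) / 2 - n * E * V \<le> (\<Sum>j\<in>J. exp (l j) - 1)"
  proof -
    have "l j + (l j)\<^sup>2 / 2 - E * V \<le> exp (l j) - 1" if j: "j \<in> J" for j
    proof -
      have "\<bar>l j\<bar> ^ 3 * exp \<bar>l j\<bar> \<le> (c * s * W) ^ 3 * V"
      proof (intro mult_mono power_mono)
        have "1 * (c * s * W) \<le> N * (c * 1 * W)" using n0 c s W by (intro mult_mono) (auto simp: N)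
        with l1[OF j] show "exp \<bar>l j\<bar> \<le> V" by (simp add: V_def mult_ac)
      qed (use l1[OF j] in auto)
      then show ?thesis using exp_taylor_quadratic[of "l j"] unfolding cubeE by linarith
    qed
    then have "(\<Sum>j\<in>J. l j + (l j)\<^sup>2 / 2 - E * V) \<le> (\<Sum>j\<in>J. exp (l j) - 1)" by (rule sum_mono)
    then show ?thesis by (simp add: sum_subtractf sum.distrib T_def n_def sum_divide_distrib)
  qed
  have a2: "\<alpha>\<^sup>2 \<le> 1" using a by (simp add: power_le_one)
  have "exp (\<alpha> * T) \<le> 1 + \<alpha> * (\<Sum>j\<in>J. exp (l j) - 1)
     + s\<^sup>2 / 2 * (\<alpha>\<^sup>2 * Y\<^sup>2 - \<alpha> * (\<Sum>j\<in>J. (y j)\<^sup>2)) + (n ^ 3 * E * V + n\<^sup>2 * E + n * E + n * E * V)"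
  proof -
    have "\<alpha>\<^sup>2 * T\<^sup>2 \<le> \<alpha>\<^sup>2 * (s\<^sup>2 * Y\<^sup>2) + 2 * n\<^sup>2 * E"
      using mult_left_mono[OF T2, of "\<alpha>\<^sup>2"] mult_right_mono[OF a2, of "2 * n\<^sup>2 * E"] E0
      by (simp add: distrib_left)
    moreover have "\<alpha> * (T + (\<Sum>j\<in>J. (l j)\<^sup>2) / 2 - n * E * V) \<le> \<alpha> * (\<Sum>j\<in>J. exp (l j) - 1)"
      using lower a by (intro mult_left_mono) auto
    moreover have "\<alpha> * (s\<^sup>2 * (\<Sum>j\<in>J. (y j)\<^sup>2) - 2 * n * E) \<le> \<alpha> * (\<Sum>j\<in>J. (l j)\<^sup>2)"
      using l2sum a by (intro mult_left_mono) auto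
    moreover have "\<alpha> * (n * E * V) \<le> n * E * V" "\<alpha> * (n * E) \<le> n * E"
      using a n0 E0 V1 by (auto intro!: mult_left_le_one_le)
    ultimately show ?thesis using upper by (simp add: algebra_simps)
  qed
  also have "n ^ 3 * E * V + n\<^sup>2 * E + n * E + n * E * V \<le> 4 * (N ^ 3 * E * V)"
  proof -
    have p: "n ^ k \<le> N ^ 3" if "k \<le> 3" for k
    proof -
      have "n ^ k \<le> N ^ k" using n0 by (intro power_mono) (auto simp: N)
      also have "\<dots> \<le> N ^ 3" using that n0 by (intro power_increasing) (auto simp: N)
      finally show ?thesis .
    qed
    have EV: "E * 1 \<le> E * V" using E0 V1 by (intro mult_left_mono) auto
    have "n ^ k * F \<le> N ^ 3 * (E * V)" if "k \<le> 3" "0 \<le> F" "F \<le> E * V" for k F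
      using p[OF that(1)] that n0 by (intro mult_mono) (auto simp: N)
    from this[of 3 "E * V"] this[of 2 E] this[of 1 E] this[of 1 "E * V"] E0 V1 EV show ?thesis
      by (simp add: mult.assoc)
  qed
  \<comment> \<open>Cubic powers of \<open>W\<close> are absorbed by
    \<open>W ^ 3 \<le> 6 * exp W\<close>, which explains the constant 24 and the additional 1 in the
    exponent.\<close>
  also have "4 * (N ^ 3 * E * V) \<le> 4 * (N ^ 3 * (c ^ 3 * s ^ 3 * (6 * exp W)) * V)"
  proof -
    have "W ^ 3 \<le> 6 * exp W" using power_le_fact_mult_exp[of W 3] W by (simp add: fact_numeral)
    then show ?thesis unfolding E_def using n0 c s V1
      by (intro mult_left_mono mult_right_mono) (auto simp: N)
  qed
  also have "\<dots> = 24 * N ^ 3 * c ^ 3 * s ^ 3 * exp ((N * c + 1) * W)"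
    by (simp add: V_def exp_add distrib_right)
  finally show ?thesis by (simp add: T_def Y_def)
qed

lemma ln_add_one_bounds:
  fixes t :: real
  assumes k: "k \<ge> 1" and t: "1 + t \<ge> 1 / k"
  shows "\<bar>ln (1 + t)\<bar> \<le> k * \<bar>t\<bar>" "\<bar>ln (1 + t) - t\<bar> \<le> k * t\<^sup>2"
proof -
  have p: "1 + t > 0" using k t by (smt (verit) divide_pos_pos)
  have inv: "1 / (1 + t) \<le> k" using k t p by (simp add: field_simps)
  have up: "ln (1 + t) \<le> t" using ln_add_one_self_le_self2[of t] p by simp
  have "ln (1 / (1 + t)) \<le> 1 / (1 + t) - 1" using p by (intro ln_le_minus_one) auto
  then have lo: "t / (1 + t) \<le> ln (1 + t)" using p by (simp add: ln_div field_simps)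
  have d: "t - t / (1 + t) = t\<^sup>2 * (1 / (1 + t))" using p by (simp add: field_simps power2_eq_square)
  also have "\<dots> \<le> t\<^sup>2 * k" using inv by (intro mult_left_mono) auto
  finally show "\<bar>ln (1 + t) - t\<bar> \<le> k * t\<^sup>2" using up lo by (simp add: mult.commute)
  have "\<bar>t / (1 + t)\<bar> \<le> k * \<bar>t\<bar>"
    using mult_right_mono[OF inv, of "\<bar>t\<bar>"] p by (simp add: abs_div_pos[symmetric])
  moreover have "\<bar>t\<bar> \<le> k * \<bar>t\<bar>" using mult_right_mono[OF k, of "\<bar>t\<bar>"] by simp
  ultimately show "\<bar>ln (1 + t)\<bar> \<le> k * \<bar>t\<bar>" using up lo by linarith
qed

text \<open>The reference value is the average \<open>gauss_avg s g x\<close> and not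
  \<open>g x\<close>, so that the normalised factor has expectation one. The two values differ only
  by order s^2, hence the linear part is still governed by the logarithmic derivative
  \<open>b\<close> of g at x.\<close>

lemma log_increment_bounds:
  assumes g: "smooth_bdd \<delta> B C g" and \<delta>: "\<delta> > 0" and s: "0 < s" "s \<le> 1" and C: "C \<ge> 0"
  obtains b where "\<And>y. \<bar>ln (g (x + s * y)) - ln (gauss_avg s g x)\<bar> \<le> (B / \<delta>) * (C / \<delta>) * s * (1 + \<bar>y\<bar>)"
    and "\<And>y. \<bar>ln (g (x + s * y)) - ln (gauss_avg s g x) - s * (b * y)\<bar>
       \<le> ((B / \<delta>) * (C / \<delta>) + (B / \<delta>) * (C / \<delta>)\<^sup>2 + C / \<delta>) * s\<^sup>2 * (1 + y\<^sup>2)"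
    and "\<bar>b\<bar> \<le> 2 * (C / \<delta>)"
proof -
  have gm [measurable]: "g \<in> borel_measurable borel" and gb: "\<And>x. \<delta> \<le> g x" "\<And>x. g x \<le> B"
    and lip: "\<And>x y. \<bar>g (x + y) - g x\<bar> \<le> C * \<bar>y\<bar>"
    using g by (auto simp: smooth_bdd_def)
  obtain g1 where [measurable]: "g1 \<in> borel_measurable borel"
    and tay: "\<And>x y. \<bar>g (x + y) - g x - g1 x * y\<bar> \<le> C * y\<^sup>2"
    using g by (auto simp: smooth_bdd_def)
  define G where "G = g x"
  define k where "k = B / \<delta>"
  define d where "d = C / \<delta>"
  have d0: "d \<ge> 0" using C \<delta> by (simp add: d_def)
  have G: "\<delta> \<le> G" "G \<le> B" "G > 0" using gb[of x] \<delta> by (auto simp: G_def)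
  have k1: "k \<ge> 1" using G \<delta> by (simp add: k_def)
  have CG: "C / G \<le> d" unfolding d_def using G \<delta> C by (intro divide_left_mono) auto
  have ratio: "v / G \<ge> 1 / k" if "\<delta> \<le> v" for v
  proof -
    have "\<delta> / B \<le> v / G" using that G \<delta> by (intro frac_le) auto
    then show ?thesis by (simp add: k_def)
  qed
  define b where "b = g1 x / G"
  define q where "q = gauss_avg s g x"
  have q: "\<delta> \<le> q" "q \<le> B" using smooth_bdd_gauss_avg[OF g, of s] by (auto simp: smooth_bdd_def q_def)
  have q0: "q > 0" using q \<delta> by simp
  \<comment> \<open>The first-order Taylor term has mean zero under the standard normal law, which
    leaves the quadratic error.\<close>
  have qG: "\<bar>q - G\<bar> \<le> C * s\<^sup>2"
  proof -
    note gi = smooth_bdd_integrable[OF g, of x s]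
    have i: "integrable std_normal (\<lambda>y. g (x + s * y) - G - g1 x * (s * y))"
      using gi std_normal_moments(1) by (simp add: mult.assoc[symmetric])
    have i2: "integrable std_normal (\<lambda>y. C * s\<^sup>2 * y\<^sup>2)" using std_normal_moments(3) by simp
    have "q - G = (\<integral>y. g (x + s * y) - G - g1 x * (s * y) \<partial>std_normal)"
      using gi std_normal_moments(1,2) std_normal.prob_space[simplified]
      by (simp add: q_def gauss_avg_def mult.assoc[symmetric])
    also have "\<bar>\<dots>\<bar> \<le> (\<integral>y. \<bar>g (x + s * y) - G - g1 x * (s * y)\<bar> \<partial>std_normal)" by (rule integral_abs_bound)
    also have "\<dots> \<le> (\<integral>y. C * s\<^sup>2 * y\<^sup>2 \<partial>std_normal)"
    proof (rule integral_mono[OF integrable_abs[OF i] i2])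
      fix y show "\<bar>g (x + s * y) - G - g1 x * (s * y)\<bar> \<le> C * s\<^sup>2 * y\<^sup>2"
        using tay[of x "s * y"] by (simp add: G_def power_mult_distrib mult.assoc)
    qed
    also have "\<dots> = C * s\<^sup>2" using std_normal_moments(4) by simp
    finally show ?thesis .
  qed
  have lq: "\<bar>ln q - ln G\<bar> \<le> k * d * s\<^sup>2"
  proof -
    have "\<bar>ln (1 + (q / G - 1))\<bar> \<le> k * \<bar>q / G - 1\<bar>"
      by (rule ln_add_one_bounds(1)[OF k1]) (use ratio[OF q(1)] in simp)
    moreover have "\<bar>q / G - 1\<bar> = \<bar>q - G\<bar> / G" using G(3) by (simp add: field_simps flip: abs_div_pos)
    moreover have "\<bar>q - G\<bar> / G \<le> C * s\<^sup>2 / G" using qG G(3) by (intro divide_right_mono) auto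
    moreover have "C * s\<^sup>2 / G \<le> d * s\<^sup>2" using mult_right_mono[OF CG, of "s\<^sup>2"] by simp
    ultimately have "\<bar>ln (q / G)\<bar> \<le> k * (d * s\<^sup>2)" using k1
      by (smt (verit) mult_left_mono)
    then show ?thesis using q0 G(3) by (simp add: ln_div mult.assoc)
  qed
  have main: "\<bar>ln (g (x + s * y)) - ln G\<bar> \<le> k * d * s * \<bar>y\<bar>"
    "\<bar>ln (g (x + s * y)) - ln G - s * (b * y)\<bar> \<le> (k * d\<^sup>2 + d) * s\<^sup>2 * y\<^sup>2" for y
  proof -
    define v where "v = g (x + s * y)"
    define t where "t = v / G - 1"
    have v: "\<delta> \<le> v" "v > 0" using gb[of "x + s * y"] \<delta> by (auto simp: v_def)
    have t: "1 + t \<ge> 1 / k" using ratio[OF v(1)] by (simp add: t_def)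
    have lnv: "ln (1 + t) = ln v - ln G" using v G(3) by (simp add: t_def ln_div)
    have tG: "t = (v - G) / G" using G(3) by (simp add: t_def field_simps)
    have "\<bar>v - G\<bar> / G \<le> C * (s * \<bar>y\<bar>) / G"
      using lip[of x "s * y"] s G(3) by (intro divide_right_mono) (auto simp: v_def G_def abs_mult)
    also have "\<dots> \<le> d * (s * \<bar>y\<bar>)" using mult_right_mono[OF CG, of "s * \<bar>y\<bar>"] s by simp
    finally have tb: "\<bar>t\<bar> \<le> d * s * \<bar>y\<bar>" using G(3) by (simp add: tG abs_div_pos[symmetric] mult.assoc)
    have "k * \<bar>t\<bar> \<le> k * (d * s * \<bar>y\<bar>)" using tb k1 by (intro mult_left_mono) auto
    with ln_add_one_bounds(1)[OF k1 t] show "\<bar>ln (g (x + s * y)) - ln G\<bar> \<le> k * d * s * \<bar>y\<bar>"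
      unfolding lnv by (simp add: v_def mult.assoc)
    have "\<bar>t\<bar>\<^sup>2 \<le> (d * s * \<bar>y\<bar>)\<^sup>2" using tb by (rule power_mono) simp
    then have "t\<^sup>2 \<le> d\<^sup>2 * s\<^sup>2 * y\<^sup>2" by (simp add: power_mult_distrib)
    then have "k * t\<^sup>2 \<le> k * (d\<^sup>2 * s\<^sup>2 * y\<^sup>2)" using k1 by (intro mult_left_mono) auto
    with ln_add_one_bounds(2)[OF k1 t] have 1: "\<bar>ln v - ln G - t\<bar> \<le> k * (d\<^sup>2 * s\<^sup>2 * y\<^sup>2)" unfolding lnv by linarith
    have "t - s * (b * y) = (v - G - g1 x * (s * y)) / G" using G(3) by (simp add: tG b_def field_simps)
    moreover have "\<bar>v - G - g1 x * (s * y)\<bar> / G \<le> C * (s * y)\<^sup>2 / G"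
      using tay[of x "s * y"] G(3) by (intro divide_right_mono) (auto simp: v_def G_def)
    moreover have "C * (s * y)\<^sup>2 / G \<le> d * (s * y)\<^sup>2" using mult_right_mono[OF CG, of "(s * y)\<^sup>2"] by simp
    ultimately have 2: "\<bar>t - s * (b * y)\<bar> \<le> d * (s * y)\<^sup>2" using G(3) by (simp add: abs_div_pos[symmetric])
    have "\<bar>ln v - ln G - s * (b * y)\<bar> \<le> \<bar>ln v - ln G - t\<bar> + \<bar>t - s * (b * y)\<bar>"
      using abs_triangle_ineq[of "ln v - ln G - t" "t - s * (b * y)"] by simp
    also have "\<dots> \<le> k * (d\<^sup>2 * s\<^sup>2 * y\<^sup>2) + d * (s * y)\<^sup>2" using 1 2 by (rule add_mono)
    finally show "\<bar>ln (g (x + s * y)) - ln G - s * (b * y)\<bar> \<le> (k * d\<^sup>2 + d) * s\<^sup>2 * y\<^sup>2"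
      by (simp add: v_def power_mult_distrib algebra_simps)
  qed
  show thesis
  proof (rule that[of b, folded q_def k_def d_def])
    fix y
    have ss: "s\<^sup>2 \<le> s" using s by (simp add: power2_eq_square mult_left_le_one_le)
    have "\<bar>ln (g (x + s * y)) - ln q\<bar> \<le> \<bar>ln (g (x + s * y)) - ln G\<bar> + \<bar>ln q - ln G\<bar>"
      using abs_triangle_ineq4[of "ln (g (x + s * y)) - ln G" "ln q - ln G"] by simp
    also have "\<dots> \<le> k * d * s * \<bar>y\<bar> + k * d * s"
    proof (rule add_mono[OF main(1)])
      have "k * d * s\<^sup>2 \<le> k * d * s" using ss k1 d0 by (intro mult_left_mono) auto
      with lq show "\<bar>ln q - ln G\<bar> \<le> k * d * s" by linarith
    qed
    finally show "\<bar>ln (g (x + s * y)) - ln q\<bar> \<le> k * d * s * (1 + \<bar>y\<bar>)" by (simp add: algebra_simps)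
    have "\<bar>ln (g (x + s * y)) - ln q - s * (b * y)\<bar> \<le> \<bar>ln (g (x + s * y)) - ln G - s * (b * y)\<bar> + \<bar>ln q - ln G\<bar>"
      using abs_triangle_ineq4[of "ln (g (x + s * y)) - ln G - s * (b * y)" "ln q - ln G"] by simp
    also have "\<dots> \<le> (k * d\<^sup>2 + d) * s\<^sup>2 * y\<^sup>2 + k * d * s\<^sup>2" by (rule add_mono[OF main(2) lq])
    also have "\<dots> \<le> (k * d + k * d\<^sup>2 + d) * s\<^sup>2 * (1 + y\<^sup>2)"
    proof -
      have "0 \<le> k * d * s\<^sup>2 * y\<^sup>2" "0 \<le> (k * d\<^sup>2 + d) * s\<^sup>2" using k1 d0 by auto
      then show ?thesis by (simp add: algebra_simps)
    qed
    finally show "\<bar>ln (g (x + s * y)) - ln q - s * (b * y)\<bar> \<le> (k * d + k * d\<^sup>2 + d) * s\<^sup>2 * (1 + y\<^sup>2)" .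
  next
    have "\<bar>g1 x\<bar> \<le> 2 * C" using lip[of x 1] tay[of x 1] by simp
    then have "\<bar>g1 x\<bar> / G \<le> 2 * C / G" using G(3) by (intro divide_right_mono) auto
    also have "\<dots> \<le> 2 * d" using CG by simp
    finally show "\<bar>b\<bar> \<le> 2 * d" using G(3) by (simp add: b_def abs_div_pos[symmetric])
  qed
qed

section \<open>Unit-variance Gaussian linear forms and their product inequality\<close>

lemma tendsto_exp_one_over_sqrt:
  fixes K :: real
  shows "(\<lambda>m::nat. exp (K * inverse (sqrt (real (Suc m))))) \<longlonglongrightarrow> 1"
proof -
  have "(\<lambda>m::nat. inverse (sqrt (real (Suc m)))) \<longlonglongrightarrow> 0"
    by (intro tendsto_inverse_0_at_top filterlim_compose[OF sqrt_at_top]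
        filterlim_compose[OF filterlim_real_sequentially] filterlim_Suc)
  from tendsto_exp[OF tendsto_mult[OF tendsto_const[of K] this]] show ?thesis by simp
qed

text \<open>Row \<open>A j\<close> holds the coefficients of a standard normal variable in
  independent coordinates. The left side of \<open>opb\<close> is the variance of the combination
  with weights \<open>v\<close>, so \<open>opb\<close> says that the correlation matrix is at most
  \<open>p\<close> times the identity.\<close>

locale gauss_linear_forms =
  fixes I :: "'i set" and J :: "'j set" and A :: "'j \<Rightarrow> 'i \<Rightarrow> real" and p :: real
  assumes finite_I: "finite I" and finite_J: "finite J" and p1: "p \<ge> 1"
    and unit: "\<And>j. j \<in> J \<Longrightarrow> (\<Sum>i\<in>I. (A j i)\<^sup>2) = 1"
    and opb: "\<And>v. (\<Sum>i\<in>I. (\<Sum>j\<in>J. v j * A j i)\<^sup>2) \<le> p * (\<Sum>j\<in>J. (v j)\<^sup>2)"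
begin

definition \<mu> :: "('i \<Rightarrow> real) measure" where "\<mu> = (\<Pi>\<^sub>M i\<in>I. std_normal)"

definition Y :: "'j \<Rightarrow> ('i \<Rightarrow> real) \<Rightarrow> real" where "Y j z = (\<Sum>i\<in>I. A j i * z i)"

sublocale \<mu>: prob_space \<mu>
  unfolding \<mu>_def by (rule prob_space_PiM) (rule std_normal.prob_space_axioms)

sublocale pair_\<mu>: pair_prob_space \<mu> \<mu> ..

lemma linear_form_measurable [measurable]: "(\<lambda>z. \<Sum>i\<in>I. c i * z i) \<in> borel_measurable \<mu>"
  unfolding \<mu>_def by measurable

lemma Y_measurable [measurable]: "Y j \<in> borel_measurable \<mu>"
  unfolding Y_def[abs_def] by measurable

lemma linear_form_integral:
  fixes h :: "real \<Rightarrow> real"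
  assumes [measurable]: "h \<in> borel_measurable borel"
  shows "(\<integral>z. h (\<Sum>i\<in>I. c i * z i) \<partial>\<mu>) = (\<integral>y. h (sqrt (\<Sum>i\<in>I. (c i)\<^sup>2) * y) \<partial>std_normal)"
    and "integrable \<mu> (\<lambda>z. h (\<Sum>i\<in>I. c i * z i)) \<longleftrightarrow> integrable std_normal (\<lambda>y. h (sqrt (\<Sum>i\<in>I. (c i)\<^sup>2) * y))"
proof -
  have e: "distr \<mu> borel (\<lambda>z. \<Sum>i\<in>I. c i * z i) = distr std_normal borel (\<lambda>y. sqrt (\<Sum>i\<in>I. (c i)\<^sup>2) * y)"
    unfolding \<mu>_def by (rule distr_linear_form[OF finite_I])
  show "(\<integral>z. h (\<Sum>i\<in>I. c i * z i) \<partial>\<mu>) = (\<integral>y. h (sqrt (\<Sum>i\<in>I. (c i)\<^sup>2) * y) \<partial>std_normal)"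
    using arg_cong[OF e, of "\<lambda>N. integral\<^sup>L N h"] by (simp add: integral_distr)
  show "integrable \<mu> (\<lambda>z. h (\<Sum>i\<in>I. c i * z i)) \<longleftrightarrow> integrable std_normal (\<lambda>y. h (sqrt (\<Sum>i\<in>I. (c i)\<^sup>2) * y))"
    using arg_cong[OF e, of "\<lambda>N. integrable N h"] by (simp add: integrable_distr_eq)
qed

lemma Y_integral:
  fixes h :: "real \<Rightarrow> real"
  assumes [measurable]: "h \<in> borel_measurable borel" and j: "j \<in> J"
  shows "(\<integral>z. h (Y j z) \<partial>\<mu>) = (\<integral>y. h y \<partial>std_normal)"
    and "integrable \<mu> (\<lambda>z. h (Y j z)) \<longleftrightarrow> integrable std_normal h"
  using linear_form_integral[of h "A j"] unit[OF j] by (simp_all add: Y_def)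

lemma Y_comb: "(\<Sum>j\<in>J. v j * Y j z) = (\<Sum>i\<in>I. (\<Sum>j\<in>J. v j * A j i) * z i)"
  unfolding Y_def by (simp add: sum_distrib_left sum_distrib_right mult.assoc sum.swap[of _ I J])

lemma Y_comb_second_moment:
  "integrable \<mu> (\<lambda>z. (\<Sum>j\<in>J. v j * Y j z)\<^sup>2)"
  "(\<integral>z. (\<Sum>j\<in>J. v j * Y j z)\<^sup>2 \<partial>\<mu>) \<le> p * (\<Sum>j\<in>J. (v j)\<^sup>2)"
proof -
  have "(\<integral>z. (\<Sum>j\<in>J. v j * Y j z)\<^sup>2 \<partial>\<mu>) = (\<Sum>i\<in>I. (\<Sum>j\<in>J. v j * A j i)\<^sup>2)"
    unfolding Y_comb linear_form_integral(1)[of "\<lambda>x. x\<^sup>2", simplified]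
    using std_normal_moments(4) by (simp add: power_mult_distrib sum_nonneg)
  then show "(\<integral>z. (\<Sum>j\<in>J. v j * Y j z)\<^sup>2 \<partial>\<mu>) \<le> p * (\<Sum>j\<in>J. (v j)\<^sup>2)" using opb[of v] by simp
  show "integrable \<mu> (\<lambda>z. (\<Sum>j\<in>J. v j * Y j z)\<^sup>2)"
    unfolding Y_comb linear_form_integral(2)[of "\<lambda>x. x\<^sup>2", simplified]
    using std_normal_moments(3) by (simp add: power_mult_distrib)
qed

lemma Y_second_moment:
  assumes "j \<in> J"
  shows "integrable \<mu> (\<lambda>z. (b * Y j z)\<^sup>2)" "(\<integral>z. (b * Y j z)\<^sup>2 \<partial>\<mu>) = b\<^sup>2"
  using Y_integral[of "\<lambda>y. (b * y)\<^sup>2", OF _ assms] std_normal_moments(3,4)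
  by (simp_all add: power_mult_distrib)

text \<open>A single envelope for all the linear forms at once. It is a sum over independent
  coordinates, so all its exponential moments are finite.\<close>

definition W :: "('i \<Rightarrow> real) \<Rightarrow> real" where "W z = 1 + (\<Sum>i\<in>I. \<bar>z i\<bar>)"

lemma W_ge_1: "W z \<ge> 1"
  by (simp add: W_def sum_nonneg)

lemma abs_Y_le: assumes "j \<in> J" shows "1 + \<bar>Y j z\<bar> \<le> W z"
proof -
  have "\<bar>A j i\<bar> \<le> 1" if "i \<in> I" for i
  proof -
    have "(A j i)\<^sup>2 \<le> (\<Sum>i\<in>I. (A j i)\<^sup>2)" using that finite_I by (intro member_le_sum) auto
    then have "(A j i)\<^sup>2 \<le> 1" using unit[OF assms] by simp
    then show ?thesis by (simp add: abs_square_le_1)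
  qed
  then have "\<bar>A j i * z i\<bar> \<le> \<bar>z i\<bar>" if "i \<in> I" for i
    using that by (auto simp: abs_mult intro!: mult_left_le_one_le)
  then have "(\<Sum>i\<in>I. \<bar>A j i * z i\<bar>) \<le> (\<Sum>i\<in>I. \<bar>z i\<bar>)" by (rule sum_mono)
  with sum_abs[of "\<lambda>i. A j i * z i" I] show ?thesis
    unfolding W_def Y_def by linarith
qed

lemma exp_W_integrable: "integrable \<mu> (\<lambda>z. exp (k * W z))"
proof -
  interpret S: product_sigma_finite "\<lambda>_::'i. std_normal" ..
  have "integrable \<mu> (\<lambda>z. \<Prod>i\<in>I. exp (k * \<bar>z i\<bar>))"
    unfolding \<mu>_def by (rule S.product_integrable_prod[OF finite_I std_normal_exp_integrable])
  then have "integrable \<mu> (\<lambda>z. exp k * (\<Prod>i\<in>I. exp (k * \<bar>z i\<bar>)))" by (rule integrable_mult_right)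
  then show ?thesis
    by (simp add: W_def distrib_left exp_add sum_distrib_left exp_sum finite_I)
qed

lemma prod_powr_integrable:
  assumes g: "\<And>j. j \<in> J \<Longrightarrow> smooth_bdd \<delta> B C (g j)" and \<delta>: "\<delta> > 0" and a: "\<alpha> \<ge> 0"
    and [measurable]: "\<And>j. j \<in> J \<Longrightarrow> h j \<in> borel_measurable N" and N: "prob_space N"
  shows "integrable N (\<lambda>z. \<Prod>j\<in>J. g j (h j z) powr \<alpha>)"
    "\<And>z. \<bar>\<Prod>j\<in>J. g j (h j z) powr \<alpha>\<bar> \<le> (\<Prod>j\<in>J. B powr \<alpha>)"
proof -
  have gm: "j \<in> J \<Longrightarrow> g j \<in> borel_measurable borel" for j using g by (simp add: smooth_bdd_def)
  have gb: "j \<in> J \<Longrightarrow> \<delta> \<le> g j x \<and> g j x \<le> B" for j x using g by (simp add: smooth_bdd_def)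
  show b: "\<bar>\<Prod>j\<in>J. g j (h j z) powr \<alpha>\<bar> \<le> (\<Prod>j\<in>J. B powr \<alpha>)" for z
    unfolding abs_prod
  proof (intro prod_mono conjI)
    fix j assume j: "j \<in> J"
    have "0 \<le> g j (h j z)" "g j (h j z) \<le> B" using gb[OF j, of "h j z"] \<delta> by linarith+
    then show "\<bar>g j (h j z) powr \<alpha>\<bar> \<le> B powr \<alpha>" using powr_mono2[OF a] by simp
  qed simp
  interpret N: prob_space N by (rule N)
  have "(\<lambda>z. \<Prod>j\<in>J. g j (h j z) powr \<alpha>) \<in> borel_measurable N"
    using measurable_compose[OF assms(4) gm] by (intro borel_measurable_prod powr_real_measurable) auto
  then show "integrable N (\<lambda>z. \<Prod>j\<in>J. g j (h j z) powr \<alpha>)"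
    by (intro N.integrable_const_bound[where B = "\<Prod>j\<in>J. B powr \<alpha>"]) (use b in auto)
qed

text \<open>The supermartingale property for one step of variance s^2, up to a relative error of
  order s^3. What matters is the quantifier order: \<open>K\<close> is fixed before the step size,
  the functions and the base point, so the step can be iterated about s^(-2) times.\<close>

lemma one_step:
  assumes \<delta>: "\<delta> > 0" and C: "C \<ge> 0" and B: "B \<ge> 0"
  obtains K where "K \<ge> 0" and "\<And>s g x. 0 < s \<Longrightarrow> s \<le> 1 \<Longrightarrow> (\<And>j. j \<in> J \<Longrightarrow> smooth_bdd \<delta> B C (g j)) \<Longrightarrow>
    (\<integral>z. (\<Prod>j\<in>J. g j (x j + s * Y j z) powr (1 / p)) \<partial>\<mu>)
      \<le> (1 + K * s ^ 3) * (\<Prod>j\<in>J. gauss_avg s (g j) (x j) powr (1 / p))"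
proof -
  define \<alpha> where "\<alpha> = 1 / p"
  have a: "0 \<le> \<alpha>" "\<alpha> \<le> 1" "\<alpha> * p = 1" using p1 by (auto simp: \<alpha>_def)
  define d where "d = C / \<delta>"
  \<comment> \<open>One number that is at least 1 and dominates all constants delivered by
    \<open>log_increment_bounds\<close>, including the bound \<open>2 * d\<close> on the
    slopes.\<close>
  define c where "c = 1 + (B / \<delta>) * d + (B / \<delta>) * d\<^sup>2 + d + 2 * d"
  have d0: "d \<ge> 0" using C \<delta> by (simp add: d_def)
  have terms: "(B / \<delta>) * d \<ge> 0" "(B / \<delta>) * d\<^sup>2 \<ge> 0" using B \<delta> d0 by auto
  have c1: "c \<ge> 1" using terms d0 by (simp add: c_def)
  define N where "N = 1 + real (card J)"
  define K0 where "K0 = 24 * N ^ 3 * c ^ 3"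
  have K0: "K0 \<ge> 0" using c1 by (simp add: K0_def N_def)
  define EW where "EW = (\<integral>z. exp ((N * c + 1) * W z) \<partial>\<mu>)"
  have EW0: "EW \<ge> 0" by (simp add: EW_def)
  show thesis
  proof (rule that[of "K0 * EW"])
    show "K0 * EW \<ge> 0" using K0 EW0 by simp
    fix s :: real and g :: "'j \<Rightarrow> real \<Rightarrow> real" and x :: "'j \<Rightarrow> real"
    assume s: "0 < s" "s \<le> 1" and g: "\<And>j. j \<in> J \<Longrightarrow> smooth_bdd \<delta> B C (g j)"
    have "\<forall>j\<in>J. \<exists>b. (\<forall>y. \<bar>ln (g j (x j + s * y)) - ln (gauss_avg s (g j) (x j))\<bar> \<le> (B / \<delta>) * d * s * (1 + \<bar>y\<bar>)) \<and>
      (\<forall>y. \<bar>ln (g j (x j + s * y)) - ln (gauss_avg s (g j) (x j)) - s * (b * y)\<bar>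
         \<le> ((B / \<delta>) * d + (B / \<delta>) * d\<^sup>2 + d) * s\<^sup>2 * (1 + y\<^sup>2)) \<and> \<bar>b\<bar> \<le> 2 * d"
    proof
      fix j assume "j \<in> J"
      show "\<exists>b. (\<forall>y. \<bar>ln (g j (x j + s * y)) - ln (gauss_avg s (g j) (x j))\<bar> \<le> (B / \<delta>) * d * s * (1 + \<bar>y\<bar>)) \<and>
        (\<forall>y. \<bar>ln (g j (x j + s * y)) - ln (gauss_avg s (g j) (x j)) - s * (b * y)\<bar>
         \<le> ((B / \<delta>) * d + (B / \<delta>) * d\<^sup>2 + d) * s\<^sup>2 * (1 + y\<^sup>2)) \<and> \<bar>b\<bar> \<le> 2 * d"
        unfolding d_def
        by (rule log_increment_bounds[OF g[OF \<open>j \<in> J\<close>] \<delta> s C, of "x j"]) blast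
    qed
    from bchoice[OF this] obtain b where
      b1: "\<And>j y. j \<in> J \<Longrightarrow> \<bar>ln (g j (x j + s * y)) - ln (gauss_avg s (g j) (x j))\<bar> \<le> (B / \<delta>) * d * s * (1 + \<bar>y\<bar>)" and
      b2: "\<And>j y. j \<in> J \<Longrightarrow> \<bar>ln (g j (x j + s * y)) - ln (gauss_avg s (g j) (x j)) - s * (b j * y)\<bar>
         \<le> ((B / \<delta>) * d + (B / \<delta>) * d\<^sup>2 + d) * s\<^sup>2 * (1 + y\<^sup>2)" and
      b3: "\<And>j. j \<in> J \<Longrightarrow> \<bar>b j\<bar> \<le> 2 * d" by blast
    define q where "q j = gauss_avg s (g j) (x j)" for j
    define l where "l j z = ln (g j (x j + s * Y j z)) - ln (q j)" for j z
    have gpos: "g j y > 0" if "j \<in> J" for j y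
      using g[OF that] \<delta> by (auto simp: smooth_bdd_def intro: less_le_trans)
    have qpos: "q j > 0" if "j \<in> J" for j
      using smooth_bdd_gauss_avg[OF g[OF that], of s] \<delta> by (auto simp: q_def smooth_bdd_def intro: less_le_trans)
    have expl: "exp (l j z) = g j (x j + s * Y j z) / q j" if "j \<in> J" for j z
      using gpos[OF that] qpos[OF that] by (simp add: l_def exp_diff)
    have pw: "exp (\<alpha> * (\<Sum>j\<in>J. l j z)) \<le> 1 + \<alpha> * (\<Sum>j\<in>J. exp (l j z) - 1)
       + s\<^sup>2 / 2 * (\<alpha>\<^sup>2 * (\<Sum>j\<in>J. b j * Y j z)\<^sup>2 - \<alpha> * (\<Sum>j\<in>J. (b j * Y j z)\<^sup>2))
       + K0 * s ^ 3 * exp ((N * c + 1) * W z)" for z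
      unfolding K0_def N_def
    proof (rule one_step_pointwise[OF finite_J s W_ge_1 c1 a(1,2)])
      fix j assume j: "j \<in> J"
      note Wj = abs_Y_le[OF j, of z]
      have "(B / \<delta>) * d * s * (1 + \<bar>Y j z\<bar>) \<le> c * s * W z"
        using Wj terms d0 s by (intro mult_mono) (auto simp: c_def)
      with b1[OF j, of "Y j z"] show "\<bar>l j z\<bar> \<le> c * s * W z" by (simp add: l_def q_def)
      have "1 + (Y j z)\<^sup>2 \<le> (1 + \<bar>Y j z\<bar>)\<^sup>2" by (simp add: power2_sum)
      also have "\<dots> \<le> (W z)\<^sup>2" using Wj by (intro power_mono) auto
      finally have "((B / \<delta>) * d + (B / \<delta>) * d\<^sup>2 + d) * s\<^sup>2 * (1 + (Y j z)\<^sup>2) \<le> c * s\<^sup>2 * (W z)\<^sup>2"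
        using terms d0 s c1 by (intro mult_mono) (auto simp: c_def)
      with b2[OF j, of "Y j z"] show "\<bar>l j z - s * (b j * Y j z)\<bar> \<le> c * s\<^sup>2 * (W z)\<^sup>2"
        by (simp add: l_def q_def)
      have "\<bar>b j * Y j z\<bar> \<le> c * W z"
        unfolding abs_mult using b3[OF j] Wj terms d0 by (intro mult_mono) (auto simp: c_def)
      then show "\<bar>b j * Y j z\<bar> \<le> c * W z" .
    qed
    have prod_eq: "(\<Prod>j\<in>J. g j (x j + s * Y j z) powr \<alpha>) = (\<Prod>j\<in>J. q j powr \<alpha>) * exp (\<alpha> * (\<Sum>j\<in>J. l j z))" for z
    proof -
      have "exp (\<alpha> * (\<Sum>j\<in>J. l j z)) = (\<Prod>j\<in>J. exp (\<alpha> * l j z))"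
        by (simp add: sum_distrib_left exp_sum finite_J)
      moreover have "g j (x j + s * Y j z) powr \<alpha> = q j powr \<alpha> * exp (\<alpha> * l j z)" if "j \<in> J" for j
        using gpos[OF that, of "x j + s * Y j z"] qpos[OF that]
        by (simp add: powr_def l_def algebra_simps flip: exp_add)
      ultimately show ?thesis by (simp add: prod.distrib)
    qed
    have ie: "integrable \<mu> (\<lambda>z. exp (l j z))" "(\<integral>z. exp (l j z) \<partial>\<mu>) = 1" if j: "j \<in> J" for j
    proof -
      have [measurable]: "g j \<in> borel_measurable borel" using g[OF j] by (simp add: smooth_bdd_def)
      have "(\<integral>z. g j (x j + s * Y j z) \<partial>\<mu>) = q j" and i: "integrable \<mu> (\<lambda>z. g j (x j + s * Y j z))"
        using Y_integral[of "\<lambda>y. g j (x j + s * y)", OF _ j] smooth_bdd_integrable[OF g[OF j], of "x j" s]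
        by (simp_all add: q_def gauss_avg_def)
      then show "integrable \<mu> (\<lambda>z. exp (l j z))" "(\<integral>z. exp (l j z) \<partial>\<mu>) = 1"
        using qpos[OF j] by (simp_all add: expl[OF j])
    qed
    have iL: "integrable \<mu> (\<lambda>z. exp (\<alpha> * (\<Sum>j\<in>J. l j z)))"
    proof -
      have "integrable \<mu> (\<lambda>z. (\<Prod>j\<in>J. g j (x j + s * Y j z) powr \<alpha>))"
        by (rule prod_powr_integrable[OF g \<delta> a(1) _ \<mu>.prob_space_axioms]) auto
      then have "integrable \<mu> (\<lambda>z. inverse (\<Prod>j\<in>J. q j powr \<alpha>) * (\<Prod>j\<in>J. g j (x j + s * Y j z) powr \<alpha>))"
        by (rule integrable_mult_right)
      moreover have "(\<Prod>j\<in>J. q j powr \<alpha>) \<noteq> 0" using qpos finite_J by (simp add: prod_zero_iff)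
         (metis less_irrefl)
      ultimately show ?thesis unfolding prod_eq by (simp add: mult.assoc[symmetric])
    qed
    have "(\<integral>z. exp (\<alpha> * (\<Sum>j\<in>J. l j z)) \<partial>\<mu>) \<le> (\<integral>z. 1 + \<alpha> * (\<Sum>j\<in>J. exp (l j z) - 1)
       + s\<^sup>2 / 2 * (\<alpha>\<^sup>2 * (\<Sum>j\<in>J. b j * Y j z)\<^sup>2 - \<alpha> * (\<Sum>j\<in>J. (b j * Y j z)\<^sup>2))
       + K0 * s ^ 3 * exp ((N * c + 1) * W z) \<partial>\<mu>)"
      by (rule integral_mono[OF iL _ pw])
         (intro Bochner_Integration.integrable_add Bochner_Integration.integrable_diff integrable_mult_right
            Bochner_Integration.integrable_sum \<mu>.integrable_const ie(1) Y_comb_second_moment(1) Y_second_moment(1) exp_W_integrable)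
    also have "\<dots> = 1 + \<alpha> * (\<Sum>j\<in>J. 1 - 1)
       + s\<^sup>2 / 2 * (\<alpha>\<^sup>2 * (\<integral>z. (\<Sum>j\<in>J. b j * Y j z)\<^sup>2 \<partial>\<mu>) - \<alpha> * (\<Sum>j\<in>J. (b j)\<^sup>2))
       + K0 * s ^ 3 * EW"
    proof -
      have i1: "integrable \<mu> (\<lambda>z. \<Sum>j\<in>J. exp (l j z) - 1)"
        by (intro Bochner_Integration.integrable_sum Bochner_Integration.integrable_diff ie(1) \<mu>.integrable_const)
      have v1: "(\<integral>z. (\<Sum>j\<in>J. exp (l j z) - 1) \<partial>\<mu>) = (\<Sum>j\<in>J. 1 - 1)"
        using ie by (subst Bochner_Integration.integral_sum) (auto simp: \<mu>.prob_space)
      have i2: "integrable \<mu> (\<lambda>z. \<Sum>j\<in>J. (b j * Y j z)\<^sup>2)"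
        by (intro Bochner_Integration.integrable_sum Y_second_moment(1))
      have v2: "(\<integral>z. (\<Sum>j\<in>J. (b j * Y j z)\<^sup>2) \<partial>\<mu>) = (\<Sum>j\<in>J. (b j)\<^sup>2)"
        by (subst Bochner_Integration.integral_sum) (auto simp: Y_second_moment)
      define F1 F2 F3 F4 where "F1 z = (\<Sum>j\<in>J. exp (l j z) - 1)" and "F2 z = (\<Sum>j\<in>J. (b j * Y j z)\<^sup>2)"
        and "F3 z = (\<Sum>j\<in>J. b j * Y j z)\<^sup>2" and "F4 z = exp ((N * c + 1) * W z)" for z
      have "integrable \<mu> F1" "integrable \<mu> F2" "integrable \<mu> F3" "integrable \<mu> F4"
        using i1 i2 Y_comb_second_moment(1)[of b] exp_W_integrable[of "N * c + 1"]
        by (simp_all only: F1_def[abs_def] F2_def[abs_def] F3_def[abs_def] F4_def[abs_def])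
      then have "(\<integral>z. 1 + \<alpha> * F1 z + s\<^sup>2 / 2 * (\<alpha>\<^sup>2 * F3 z - \<alpha> * F2 z) + K0 * s ^ 3 * F4 z \<partial>\<mu>)
        = 1 + \<alpha> * (\<integral>z. F1 z \<partial>\<mu>) + s\<^sup>2 / 2 * (\<alpha>\<^sup>2 * (\<integral>z. F3 z \<partial>\<mu>) - \<alpha> * (\<integral>z. F2 z \<partial>\<mu>)) + K0 * s ^ 3 * (\<integral>z. F4 z \<partial>\<mu>)"
        by (simp add: \<mu>.prob_space)
      then show ?thesis unfolding F1_def F2_def F3_def F4_def v1 v2 EW_def .
    qed
    \<comment> \<open>The balance behind the exponent: the variance of the combination is at most
      \<open>p\<close> times the sum of squares, and \<open>\<alpha> * p = 1\<close> cancels it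
      against the concavity term.\<close>
    also have "\<dots> \<le> 1 + K0 * s ^ 3 * EW"
    proof -
      have "\<alpha>\<^sup>2 * (\<integral>z. (\<Sum>j\<in>J. b j * Y j z)\<^sup>2 \<partial>\<mu>) \<le> \<alpha>\<^sup>2 * (p * (\<Sum>j\<in>J. (b j)\<^sup>2))"
        by (intro mult_left_mono Y_comb_second_moment) simp
      also have "\<dots> = \<alpha> * (\<alpha> * p) * (\<Sum>j\<in>J. (b j)\<^sup>2)" by (simp add: power2_eq_square)
      also have "\<dots> = \<alpha> * (\<Sum>j\<in>J. (b j)\<^sup>2)" by (simp add: a(3))
      finally have "s\<^sup>2 / 2 * (\<alpha>\<^sup>2 * (\<integral>z. (\<Sum>j\<in>J. b j * Y j z)\<^sup>2 \<partial>\<mu>) - \<alpha> * (\<Sum>j\<in>J. (b j)\<^sup>2)) \<le> 0"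
        by (intro mult_nonneg_nonpos) auto
      then show ?thesis by simp
    qed
    finally have fin: "(\<integral>z. exp (\<alpha> * (\<Sum>j\<in>J. l j z)) \<partial>\<mu>) \<le> 1 + K0 * EW * s ^ 3" by (simp add: mult_ac)
    have "(\<integral>z. (\<Prod>j\<in>J. g j (x j + s * Y j z) powr \<alpha>) \<partial>\<mu>) = (\<Prod>j\<in>J. q j powr \<alpha>) * (\<integral>z. exp (\<alpha> * (\<Sum>j\<in>J. l j z)) \<partial>\<mu>)"
      unfolding prod_eq using iL by simp
    also have "\<dots> \<le> (\<Prod>j\<in>J. q j powr \<alpha>) * (1 + K0 * EW * s ^ 3)"
      using fin by (intro mult_left_mono prod_nonneg) auto
    finally show "(\<integral>z. (\<Prod>j\<in>J. g j (x j + s * Y j z) powr (1 / p)) \<partial>\<mu>)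
      \<le> (1 + K0 * EW * s ^ 3) * (\<Prod>j\<in>J. gauss_avg s (g j) (x j) powr (1 / p))"
      by (simp add: \<alpha>_def q_def mult.commute)
  qed
qed

lemma integral_product_conv:
  assumes ab: "a\<^sup>2 + b\<^sup>2 = 1" and [measurable]: "F \<in> borel_measurable \<mu>" and F: "\<And>z. \<bar>F z\<bar> \<le> (D::real)"
  shows "(\<integral>z. F z \<partial>\<mu>) = (\<integral>z. (\<integral>w. F (\<lambda>i\<in>I. a * z i + b * w i) \<partial>\<mu>) \<partial>\<mu>)"
    and "integrable \<mu> (\<lambda>z. \<integral>w. F (\<lambda>i\<in>I. a * z i + b * w i) \<partial>\<mu>)"
proof -
  have m [measurable]: "(\<lambda>(z, w). \<lambda>i\<in>I. a * z i + b * w i) \<in> measurable (\<mu> \<Otimes>\<^sub>M \<mu>) \<mu>"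
    unfolding \<mu>_def by measurable
  have mF: "(\<lambda>(z, w). F (\<lambda>i\<in>I. a * z i + b * w i)) \<in> borel_measurable (\<mu> \<Otimes>\<^sub>M \<mu>)"
    using measurable_compose[OF m assms(2)] by (simp add: case_prod_unfold)
  have i: "integrable (\<mu> \<Otimes>\<^sub>M \<mu>) (\<lambda>(z, w). F (\<lambda>i\<in>I. a * z i + b * w i))"
    by (rule pair_\<mu>.integrable_const_bound[where B = D]) (use F mF in \<open>auto simp: case_prod_unfold\<close>)
  have "(\<integral>z. F z \<partial>\<mu>) = (\<integral>z. F z \<partial>distr (\<mu> \<Otimes>\<^sub>M \<mu>) \<mu> (\<lambda>(z, w). \<lambda>i\<in>I. a * z i + b * w i))"
    using distr_std_normal_product_conv[OF finite_I ab] by (simp add: \<mu>_def)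
  also have "\<dots> = (\<integral>p. (\<lambda>(z, w). F (\<lambda>i\<in>I. a * z i + b * w i)) p \<partial>(\<mu> \<Otimes>\<^sub>M \<mu>))"
    by (subst integral_distr) (auto simp: case_prod_unfold)
  also have "\<dots> = (\<integral>z. (\<integral>w. F (\<lambda>i\<in>I. a * z i + b * w i) \<partial>\<mu>) \<partial>\<mu>)"
    using pair_\<mu>.integral_fst'[OF i] by simp
  finally show "(\<integral>z. F z \<partial>\<mu>) = (\<integral>z. (\<integral>w. F (\<lambda>i\<in>I. a * z i + b * w i) \<partial>\<mu>) \<partial>\<mu>)" .
  show "integrable \<mu> (\<lambda>z. \<integral>w. F (\<lambda>i\<in>I. a * z i + b * w i) \<partial>\<mu>)"
    using pair_\<mu>.integrable_fst'[OF i] by simp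
qed

lemma Y_conv: "Y j (\<lambda>i\<in>I. a * z i + b * w i) = a * Y j z + b * Y j w"
  unfolding Y_def by (simp add: distrib_left sum.distrib sum_distrib_left mult_ac)

text \<open>The unit variance is reached in many equal small steps whose relative errors multiply to
  a factor tending to 1. The smoothness constants enter only through that factor and so disappear
  from the conclusion.\<close>

theorem gauss_hoelder:
  assumes g: "\<And>j. j \<in> J \<Longrightarrow> smooth_bdd \<delta> B C (g j)" and \<delta>: "\<delta> > 0" and C: "C \<ge> 0" and B: "B \<ge> 0"
  shows "(\<integral>z. (\<Prod>j\<in>J. g j (Y j z) powr (1 / p)) \<partial>\<mu>) \<le> (\<Prod>j\<in>J. (\<integral>y. g j y \<partial>std_normal) powr (1 / p))"
proof -
  have a: "1 / p \<ge> 0" using p1 by simp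
  from one_step[OF \<delta> C B] obtain K where K: "K \<ge> 0" and
    step: "\<And>s g x. 0 < s \<Longrightarrow> s \<le> 1 \<Longrightarrow> (\<And>j. j \<in> J \<Longrightarrow> smooth_bdd \<delta> B C (g j)) \<Longrightarrow>
      (\<integral>z. (\<Prod>j\<in>J. g j (x j + s * Y j z) powr (1 / p)) \<partial>\<mu>)
      \<le> (1 + K * s ^ 3) * (\<Prod>j\<in>J. gauss_avg s (g j) (x j) powr (1 / p))"
    by blast
  have iter: "(\<integral>z. (\<Prod>j\<in>J. g j (x j + (sqrt (real k) * s) * Y j z) powr (1 / p)) \<partial>\<mu>)
      \<le> (1 + K * s ^ 3) ^ k * (\<Prod>j\<in>J. gauss_avg (sqrt (real k) * s) (g j) (x j) powr (1 / p))"
    if s: "0 < s" "s \<le> 1" and g: "\<And>j. j \<in> J \<Longrightarrow> smooth_bdd \<delta> B C (g j)" for s k g and x :: "'j \<Rightarrow> real"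
    using g
  proof (induction k arbitrary: g)
    case 0
    then show ?case by (simp add: gauss_avg_0 \<mu>.prob_space)
  next
    case (Suc k)
    define r r' where "r = sqrt (real (Suc k)) * s" and "r' = sqrt (real k) * s"
    have r: "r > 0" "r'\<^sup>2 + s\<^sup>2 = r\<^sup>2" using s by (auto simp: r_def r'_def power_mult_distrib algebra_simps)
    have ab: "(r' / r)\<^sup>2 + (s / r)\<^sup>2 = 1" using r by (simp add: power_divide flip: add_divide_distrib)
    define F where "F z = (\<Prod>j\<in>J. g j (x j + r * Y j z) powr (1 / p))" for z
    have Fm: "F \<in> borel_measurable \<mu>" unfolding F_def[abs_def]
      by (rule borel_measurable_integrable, rule prod_powr_integrable[OF Suc.prems \<delta> a _ \<mu>.prob_space_axioms]) auto
    have Fb: "\<bar>F z\<bar> \<le> (\<Prod>j\<in>J. B powr (1 / p))" for z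
      unfolding F_def by (rule prod_powr_integrable(2)[OF Suc.prems \<delta> a _ \<mu>.prob_space_axioms]) auto
    have Fconv: "F (\<lambda>i\<in>I. (r' / r) * z i + (s / r) * w i) = (\<Prod>j\<in>J. g j ((x j + r' * Y j z) + s * Y j w) powr (1 / p))" for z w
      unfolding F_def Y_conv using r(1) by (simp add: algebra_simps)
    \<comment> \<open>The last increment is integrated out first, with the earlier ones frozen in
      the base point; the induction hypothesis then applies to the averaged functions, which satisfy
      the same smoothness bounds.\<close>
    define h where "h j = gauss_avg s (g j)" for j
    have h: "j \<in> J \<Longrightarrow> smooth_bdd \<delta> B C (h j)" for j unfolding h_def by (rule smooth_bdd_gauss_avg[OF Suc.prems])
    have ih: "integrable \<mu> (\<lambda>z. \<Prod>j\<in>J. h j (x j + r' * Y j z) powr (1 / p))"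
      by (rule prod_powr_integrable[OF h \<delta> a _ \<mu>.prob_space_axioms]) auto
    have "(\<integral>z. F z \<partial>\<mu>) \<le> (\<integral>z. (1 + K * s ^ 3) * (\<Prod>j\<in>J. h j (x j + r' * Y j z) powr (1 / p)) \<partial>\<mu>)"
      unfolding integral_product_conv(1)[OF ab Fm Fb]
    proof (rule integral_mono)
      show "integrable \<mu> (\<lambda>z. \<integral>w. F (\<lambda>i\<in>I. r' / r * z i + s / r * w i) \<partial>\<mu>)"
        by (rule integral_product_conv(2)[OF ab Fm Fb])
      show "integrable \<mu> (\<lambda>z. (1 + K * s ^ 3) * (\<Prod>j\<in>J. h j (x j + r' * Y j z) powr (1 / p)))"
        using ih by (rule integrable_mult_right)
      show "(\<integral>w. F (\<lambda>i\<in>I. r' / r * z i + s / r * w i) \<partial>\<mu>) \<le> (1 + K * s ^ 3) * (\<Prod>j\<in>J. h j (x j + r' * Y j z) powr (1 / p))" for z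
        unfolding Fconv h_def by (rule step[OF s Suc.prems])
    qed
    also have "\<dots> = (1 + K * s ^ 3) * (\<integral>z. (\<Prod>j\<in>J. h j (x j + r' * Y j z) powr (1 / p)) \<partial>\<mu>)" by simp
    also have "\<dots> \<le> (1 + K * s ^ 3) * ((1 + K * s ^ 3) ^ k * (\<Prod>j\<in>J. gauss_avg r' (h j) (x j) powr (1 / p)))"
      using K s unfolding r'_def by (intro mult_left_mono Suc.IH h) auto
    also have "\<dots> = (1 + K * s ^ 3) ^ Suc k * (\<Prod>j\<in>J. gauss_avg r (g j) (x j) powr (1 / p))"
      using gauss_avg_gauss_avg[OF Suc.prems r] by (simp add: h_def)
    finally show ?case by (simp add: F_def r_def)
  qed
  define E where "E = (\<integral>z. (\<Prod>j\<in>J. g j (Y j z) powr (1 / p)) \<partial>\<mu>)"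
  define P where "P = (\<Prod>j\<in>J. (\<integral>y. g j y \<partial>std_normal) powr (1 / p))"
  have P0: "P \<ge> 0" unfolding P_def by (intro prod_nonneg) auto
  have bound: "E \<le> exp (K * inverse (sqrt (real (Suc m)))) * P" for m
  proof -
    \<comment> \<open>With \<open>Suc m\<close> steps of variance \<open>1 / Suc m\<close>, the
      accumulated error is at most \<open>exp (K * s)\<close>, because
      \<open>real (Suc m) * s\<^sup>2 = 1\<close>.\<close>
    define s where "s = inverse (sqrt (real (Suc m)))"
    have s: "0 < s" "s \<le> 1" by (auto simp: s_def inverse_eq_divide)
    have sm: "sqrt (real (Suc m)) * s = 1" by (simp add: s_def del: of_nat_Suc)
    then have "(sqrt (real (Suc m)) * s)\<^sup>2 = 1\<^sup>2" by (simp only:)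
    then have sm2: "real (Suc m) * s\<^sup>2 = 1" by (simp add: power_mult_distrib del: of_nat_Suc)
    have "E \<le> (1 + K * s ^ 3) ^ Suc m * P"
      using iter[of s g "\<lambda>_. 0" "Suc m"] s g unfolding sm
      by (simp add: E_def P_def gauss_avg_def)
    also have "(1 + K * s ^ 3) ^ Suc m \<le> exp (K * s ^ 3) ^ Suc m"
      using K s by (intro power_mono) auto
    also have "exp (K * s ^ 3) ^ Suc m = exp (real (Suc m) * (K * s ^ 3))" by (rule exp_of_nat_mult[symmetric])
    also have "real (Suc m) * (K * s ^ 3) = K * s * (real (Suc m) * s\<^sup>2)" by (simp add: power2_eq_square power3_eq_cube)
    also have "\<dots> = K * s" by (simp only: sm2 mult_1_right)
    finally show ?thesis using P0 by (simp add: s_def mult_right_mono)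
  qed
  have "(\<lambda>m::nat. exp (K * inverse (sqrt (real (Suc m)))) * P) \<longlonglongrightarrow> 1 * P"
    by (intro tendsto_mult tendsto_exp_one_over_sqrt tendsto_const)
  then have "E \<le> 1 * P" by (rule LIMSEQ_le_const) (use bound in auto)
  then show ?thesis by (simp add: E_def P_def)
qed

end

section \<open>Likelihood ratios\<close>

lemma smooth_bddI:
  assumes d1: "\<And>x. (g has_real_derivative g1 x) (at x)" and d2: "\<And>x. (g1 has_real_derivative g2 x) (at x)"
    and b: "\<And>x. \<bar>g1 x\<bar> \<le> C" "\<And>x. \<bar>g2 x\<bar> \<le> C" and r: "\<And>x. \<delta> \<le> g x" "\<And>x. g x \<le> B"
  shows "smooth_bdd \<delta> B C g"
  unfolding smooth_bdd_def
proof (intro conjI allI bexI[of _ g1])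
  have c: "continuous_on UNIV g" "continuous_on UNIV g1"
    using d1 d2 by (meson DERIV_continuous_on has_field_derivative_at_within)+
  show "g \<in> borel_measurable borel" "g1 \<in> borel_measurable borel"
    using c by (auto intro: borel_measurable_continuous_onI)
  show "\<bar>g (x + y) - g x\<bar> \<le> C * \<bar>y\<bar>" for x y
  proof -
    have "norm (g (x + y) - g x) \<le> C * norm ((x + y) - x)"
      by (rule field_differentiable_bound[of UNIV g g1]) (use d1 b in auto)
    then show ?thesis by simp
  qed
  show "\<bar>g (x + y) - g x - g1 x * y\<bar> \<le> C * y\<^sup>2" for x y
    by (rule taylor_second_order_bound[OF d1 d2 b(2)])
qed (use r in auto)

lemma smooth_bdd_affine:
  assumes g: "smooth_bdd \<delta> B C g" and a: "\<bar>a\<bar> \<le> L" "a\<^sup>2 \<le> L" and C: "C \<ge> 0"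
  shows "smooth_bdd \<delta> B (C * L) (\<lambda>x. g (b + a * x))"
proof -
  have gm [measurable]: "g \<in> borel_measurable borel" and gb: "\<And>x. \<delta> \<le> g x" "\<And>x. g x \<le> B"
    and lip: "\<And>x y. \<bar>g (x + y) - g x\<bar> \<le> C * \<bar>y\<bar>"
    using g by (auto simp: smooth_bdd_def)
  obtain g1 where [measurable]: "g1 \<in> borel_measurable borel"
    and tay: "\<And>x y. \<bar>g (x + y) - g x - g1 x * y\<bar> \<le> C * y\<^sup>2"
    using g by (auto simp: smooth_bdd_def)
  show ?thesis unfolding smooth_bdd_def
  proof (intro conjI allI bexI[of _ "\<lambda>x. g1 (b + a * x) * a"])
    show "\<bar>g (b + a * (x + y)) - g (b + a * x)\<bar> \<le> C * L * \<bar>y\<bar>" for x y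
    proof -
      have "\<bar>g ((b + a * x) + a * y) - g (b + a * x)\<bar> \<le> C * (\<bar>a\<bar> * \<bar>y\<bar>)"
        using lip[of "b + a * x" "a * y"] by (simp add: abs_mult)
      also have "\<dots> \<le> C * (L * \<bar>y\<bar>)" using a C by (intro mult_left_mono mult_right_mono) auto
      finally show ?thesis by (simp add: algebra_simps)
    qed
    show "\<bar>g (b + a * (x + y)) - g (b + a * x) - g1 (b + a * x) * a * y\<bar> \<le> C * L * y\<^sup>2" for x y
    proof -
      have "\<bar>g ((b + a * x) + a * y) - g (b + a * x) - g1 (b + a * x) * (a * y)\<bar> \<le> C * (a\<^sup>2 * y\<^sup>2)"
        using tay[of "b + a * x" "a * y"] by (simp add: power_mult_distrib)
      also have "\<dots> \<le> C * (L * y\<^sup>2)" using a C by (intro mult_left_mono mult_right_mono) auto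
      finally show ?thesis by (simp add: algebra_simps)
    qed
  qed (use gb in auto)
qed

lemma sqrt_normal_density:
  assumes "\<sigma> > 0"
  shows "sqrt (normal_density 0 \<sigma> x) = sqrt (2 * pi * (sqrt 2 * \<sigma>)\<^sup>2) / sqrt (sqrt (2 * pi * \<sigma>\<^sup>2)) * normal_density 0 (sqrt 2 * \<sigma>) x"
proof -
  have "exp (- x\<^sup>2 / (2 * \<sigma>\<^sup>2)) = (exp (- x\<^sup>2 / (4 * \<sigma>\<^sup>2)))\<^sup>2" by (simp flip: exp_double)
  then have "sqrt (exp (- x\<^sup>2 / (2 * \<sigma>\<^sup>2))) = exp (- x\<^sup>2 / (4 * \<sigma>\<^sup>2))" by simp
  moreover have "sqrt (2 * pi * (sqrt 2 * \<sigma>)\<^sup>2) > 0" using assms by simp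
  ultimately show ?thesis
    unfolding normal_density_def by (simp add: real_sqrt_divide real_sqrt_mult power_mult_distrib)
qed

text \<open>
  The offset \<open>\<eta>\<close> makes the ratio smooth and bounded on both sides; it also absorbs the error of
  replacing the estimator by a representative of its moment class.
\<close>

definition lik_ratio :: "real \<Rightarrow> real measure \<Rightarrow> real measure \<Rightarrow> real \<Rightarrow> real \<Rightarrow> real" where
  "lik_ratio \<eta> H G0 s x = sqrt ((mix 0 H s x + \<eta>) / (mix 0 G0 s x + \<eta>))"

context noise_level
begin

text \<open>The constants are very large for small \<eta>, but \<open>gauss_hoelder\<close> needs
  only that they exist and are the same for all coordinates.\<close>

lemma lik_ratio_smooth:
  assumes H: "real_distribution H" and G0: "real_distribution G0" and \<eta>: "\<eta> > 0"
  defines "B \<equiv> sqrt ((gauss_const 0 + \<eta>) / \<eta>)" and "D \<equiv> (gauss_const 1 + gauss_const 2) / \<eta>"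
  shows "smooth_bdd (1 / B) B (B * (D + 2 * D\<^sup>2)) (lik_ratio \<eta> H G0 s)"
proof -
  define u v where "u x = mix 0 H s x + \<eta>" and "v x = mix 0 G0 s x + \<eta>" for x
  define u1 v1 where "u1 x = mix 1 H s x" and "v1 x = mix 1 G0 s x" for x
  define u2 v2 where "u2 x = mix 2 H s x" and "v2 x = mix 2 G0 s x" for x
  \<comment> \<open>Writing the square root of a quotient as an exponential turns both derivatives
    into \<open>r\<close> times a polynomial in logarithmic derivatives.\<close>
  define r where "r x = exp ((ln (u x) - ln (v x)) / 2)" for x
  have u: "\<eta> \<le> u x" "u x \<le> gauss_const 0 + \<eta>" and v: "\<eta> \<le> v x" "v x \<le> gauss_const 0 + \<eta>" for x
    using mix_0_pos[OF H, of x] abs_mix_le[OF H, of 0 x] mix_0_pos[OF G0, of x] abs_mix_le[OF G0, of 0 x]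
    by (auto simp: u_def v_def)
  have up: "u x > 0" and vp: "v x > 0" for x using u[of x] v[of x] \<eta> by linarith+
  have du: "(u has_real_derivative u1 x) (at x)" "(u1 has_real_derivative u2 x) (at x)" for x
    unfolding u_def[abs_def] u1_def[abs_def] u2_def using mix_has_deriv[OF H, of 0 x] mix_has_deriv[OF H, of 1 x]
    by (auto intro!: derivative_eq_intros simp: numeral_2_eq_2)
  have dv: "(v has_real_derivative v1 x) (at x)" "(v1 has_real_derivative v2 x) (at x)" for x
    unfolding v_def[abs_def] v1_def[abs_def] v2_def using mix_has_deriv[OF G0, of 0 x] mix_has_deriv[OF G0, of 1 x]
    by (auto intro!: derivative_eq_intros simp: numeral_2_eq_2)
  define a where "a x = (u1 x / u x - v1 x / v x) / 2" for x
  define b where "b x = ((u2 x / u x - (u1 x / u x)\<^sup>2) - (v2 x / v x - (v1 x / v x)\<^sup>2)) / 2" for x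
  have dr: "(r has_real_derivative r x * a x) (at x)" for x
    unfolding r_def[abs_def] a_def using up[of x] vp[of x]
    by (auto intro!: derivative_eq_intros du dv)
  have da: "(a has_real_derivative b x) (at x)" for x
    unfolding a_def[abs_def] b_def using up[of x] vp[of x]
    by (auto intro!: derivative_eq_intros du dv simp: power2_eq_square field_simps)
  have dr2: "((\<lambda>x. r x * a x) has_real_derivative r x * ((a x)\<^sup>2 + b x)) (at x)" for x
    using DERIV_mult[OF dr da, of x] by (simp add: power2_eq_square algebra_simps)
  have r_eq: "r x = lik_ratio \<eta> H G0 s x" for x
  proof -
    have "(r x)\<^sup>2 = exp (ln (u x) - ln (v x))" by (simp add: r_def flip: exp_double)
    also have "\<dots> = u x / v x" using up[of x] vp[of x] by (simp add: exp_diff)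
    finally have "sqrt (u x / v x) = r x" by (intro real_sqrt_unique) (auto simp: r_def)
    then show ?thesis by (simp add: lik_ratio_def u_def v_def)
  qed
  have gpos: "gauss_const k > 0" for k by (rule gauss_const_pos)
  have B1: "B > 0" using gpos[of 0] \<eta> by (simp add: B_def)
  have D0: "D \<ge> 0" using gpos[of 1] gpos[of 2] \<eta> by (simp add: D_def)
  have rb: "1 / B \<le> r x" "r x \<le> B" for x
  proof -
    have "u x / v x \<le> (gauss_const 0 + \<eta>) / \<eta>" using u[of x] v[of x] \<eta> gpos[of 0] by (intro frac_le) auto
    then show "r x \<le> B" unfolding r_eq lik_ratio_def B_def by (simp add: u_def v_def)
    have "1 / B = sqrt (\<eta> / (gauss_const 0 + \<eta>))" by (simp add: B_def real_sqrt_divide)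
    also have "\<dots> \<le> r x" unfolding r_eq lik_ratio_def
      using u[of x] v[of x] up[of x] vp[of x] \<eta> by (intro real_sqrt_le_mono frac_le) (auto simp: u_def v_def)
    finally show "1 / B \<le> r x" .
  qed
  have q: "\<bar>w / z\<bar> \<le> D" if "\<bar>w\<bar> \<le> gauss_const 1 \<or> \<bar>w\<bar> \<le> gauss_const 2" "\<eta> \<le> z" for w z
  proof -
    have "\<bar>w\<bar> / \<bar>z\<bar> \<le> (gauss_const 1 + gauss_const 2) / \<eta>"
      using that \<eta> gpos[of 1] gpos[of 2] by (intro frac_le) auto
    then show ?thesis by (simp add: D_def)
  qed
  have q1: "\<bar>u1 x / u x\<bar> \<le> D" "\<bar>v1 x / v x\<bar> \<le> D" "\<bar>u2 x / u x\<bar> \<le> D" "\<bar>v2 x / v x\<bar> \<le> D" for x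
  proof -
    show "\<bar>u1 x / u x\<bar> \<le> D" by (rule q[OF _ u(1)]) (simp only: u1_def abs_mix_le[OF H] simp_thms)
    show "\<bar>v1 x / v x\<bar> \<le> D" by (rule q[OF _ v(1)]) (simp only: v1_def abs_mix_le[OF G0] simp_thms)
    show "\<bar>u2 x / u x\<bar> \<le> D" by (rule q[OF _ u(1)]) (simp only: u2_def abs_mix_le[OF H] simp_thms)
    show "\<bar>v2 x / v x\<bar> \<le> D" by (rule q[OF _ v(1)]) (simp only: v2_def abs_mix_le[OF G0] simp_thms)
  qed
  have q2: "(u1 x / u x)\<^sup>2 \<le> D\<^sup>2" "(v1 x / v x)\<^sup>2 \<le> D\<^sup>2" for x
    using power_mono[OF q1(1)[of x] abs_ge_zero, of 2] power_mono[OF q1(2)[of x] abs_ge_zero, of 2]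
    by (simp_all only: power2_abs)
  have ab: "\<bar>a x\<bar> \<le> D" for x
    using q1(1,2)[of x] abs_triangle_ineq4[of "u1 x / u x" "v1 x / v x"] unfolding a_def by simp
  have bb: "\<bar>b x\<bar> \<le> D + D\<^sup>2" for x
  proof -
    have "\<bar>((a - b) - (c - d)) / 2\<bar> \<le> D + E"
      if "\<bar>a\<bar> \<le> D" "\<bar>c\<bar> \<le> D" "0 \<le> b" "b \<le> E" "0 \<le> d" "d \<le> E" for a b c d E :: real
      using that by (simp add: abs_le_iff)
    from this[OF q1(3)[of x] q1(4)[of x] zero_le_power2 q2(1)[of x] zero_le_power2 q2(2)[of x]] show ?thesis unfolding b_def .
  qed
  have "smooth_bdd (1 / B) B (B * (D + 2 * D\<^sup>2)) r"
  proof (rule smooth_bddI[OF dr dr2])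
    fix x
    have r0: "0 \<le> r x" by (simp add: r_def)
    have "\<bar>r x * a x\<bar> = r x * \<bar>a x\<bar>" using r0 by (simp add: abs_mult)
    also have "\<dots> \<le> B * (D + 2 * D\<^sup>2)"
      using rb(2)[of x] order_trans[OF ab[of x], of "D + 2 * D\<^sup>2"] r0 B1 by (intro mult_mono) auto
    finally show "\<bar>r x * a x\<bar> \<le> B * (D + 2 * D\<^sup>2)" .
    have "(a x)\<^sup>2 \<le> D\<^sup>2" using power_mono[OF ab[of x] abs_ge_zero, of 2] by simp
    then have "\<bar>(a x)\<^sup>2 + b x\<bar> \<le> D + 2 * D\<^sup>2"
      using bb[of x] zero_le_power2[of "a x"] by linarith
    then have "r x * \<bar>(a x)\<^sup>2 + b x\<bar> \<le> B * (D + 2 * D\<^sup>2)"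
      using rb(2)[of x] r0 B1 by (intro mult_mono) auto
    then show "\<bar>r x * ((a x)\<^sup>2 + b x)\<bar> \<le> B * (D + 2 * D\<^sup>2)" using r0 by (simp add: abs_mult)
  qed (rule rb)+
  moreover have "r = lik_ratio \<eta> H G0 s" by (rule ext) (rule r_eq)
  ultimately show ?thesis by simp
qed

text \<open>The constant in the bound of the square root of the prior mixture density by
  \<open>tail_env\<close>: the root of the constant in \<open>mix_0_le_env\<close> times the
  normalising factor of \<open>sqrt_normal_density\<close>, since the root of a Gaussian density is
  a multiple of one with twice the variance.\<close>

definition sqrt_const :: real where
  "sqrt_const = sqrt (sqrt 2 * M * exp (M / 2)) *
     (sqrt (2 * pi * (sqrt 2 * (sqrt 2 * sqrt M))\<^sup>2) / sqrt (sqrt (2 * pi * (sqrt 2 * sqrt M)\<^sup>2)))"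

lemma mix_sqrt_integrable:
  assumes G: "real_distribution G" and G0: "real_distribution G0"
  shows "integrable lborel (\<lambda>x. sqrt (mix 0 G s x * mix 0 G0 s x))"
    "(\<integral>x. sqrt (mix 0 G s x * mix 0 G0 s x) \<partial>lborel) = 1 - hell2 G G0 s / 2"
proof -
  have e: "sqrt (mix 0 G s x * mix 0 G0 s x) = (mix 0 G s x + mix 0 G0 s x - (sqrt (mix 0 G s x) - sqrt (mix 0 G0 s x))\<^sup>2) / 2" for x
    using mix_0_pos[OF G, of x] mix_0_pos[OF G0, of x] by (simp add: power2_diff real_sqrt_mult)
  have hi: "integrable lborel (\<lambda>x. (sqrt (mix 0 G s x) - sqrt (mix 0 G0 s x))\<^sup>2)"
    by (rule hell2_integrable[OF G G0, of 1]) simp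
  note i = mix_integrable[OF G, of 0] mix_integrable[OF G0, of 0] hi
  show "integrable lborel (\<lambda>x. sqrt (mix 0 G s x * mix 0 G0 s x))"
    unfolding e using i by auto
  show "(\<integral>x. sqrt (mix 0 G s x * mix 0 G0 s x) \<partial>lborel) = 1 - hell2 G G0 s / 2"
    unfolding e hell2_def using i integral_mix_0[OF G] integral_mix_0[OF G0] by (simp add: diff_divide_distrib)
qed

lemma mix_0_le_env:
  assumes G0: "real_distribution G0" and supp: "AE \<theta> in G0. \<bar>\<theta>\<bar> \<le> M"
  shows "mix 0 G0 s x \<le> sqrt 2 * M * exp (M / 2) * gauss_env x"
proof -
  interpret G0: real_distribution G0 by fact
  show ?thesis unfolding mix_def using supp mix_integrand_integrable[OF G0, of 0 x] gauss_env_shift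
    by (intro G0.integral_le_const) auto
qed

text \<open>Dropping \<eta> from the denominator and splitting the root in the numerator leaves the
  Hellinger affinity plus sqrt \<eta> times the integral of the root of the prior mixture density.
  Compact support of the prior makes that integral finite, uniformly in \<open>s\<close>.\<close>

lemma lik_ratio_integral_le:
  assumes H: "real_distribution H" and G0: "real_distribution G0" and supp: "AE \<theta> in G0. \<bar>\<theta>\<bar> \<le> M" and \<eta>: "\<eta> > 0"
  shows "(\<integral>x. lik_ratio \<eta> H G0 s x * mix 0 G0 s x \<partial>lborel) \<le> exp (- hell2 H G0 s / 2 + sqrt \<eta> * sqrt_const)"
proof -
  define k where "k = sqrt (2 * pi * (sqrt 2 * (sqrt 2 * sqrt M))\<^sup>2) / sqrt (sqrt (2 * pi * (sqrt 2 * sqrt M)\<^sup>2))"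
  have sf: "sqrt (mix 0 G0 s x) \<le> sqrt_const * tail_env x" for x
  proof -
    have "sqrt (mix 0 G0 s x) \<le> sqrt (sqrt 2 * M * exp (M / 2) * gauss_env x)"
      by (rule real_sqrt_le_mono[OF mix_0_le_env[OF G0 supp]])
    also have "\<dots> = sqrt (sqrt 2 * M * exp (M / 2)) * sqrt (gauss_env x)" by (rule real_sqrt_mult)
    also have "sqrt (gauss_env x) = k * tail_env x"
      unfolding gauss_env_def tail_env_def k_def by (rule sqrt_normal_density) (use M1 in simp)
    finally show ?thesis by (simp add: sqrt_const_def k_def mult.assoc)
  qed
  note si = mix_sqrt_integrable[OF H G0]
  have pw: "lik_ratio \<eta> H G0 s x * mix 0 G0 s x \<le> sqrt (mix 0 H s x * mix 0 G0 s x) + sqrt \<eta> * (sqrt_const * tail_env x)" for x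
  proof -
    define f f0 where "f = mix 0 H s x" and "f0 = mix 0 G0 s x"
    have p: "f > 0" "f0 > 0" using mix_0_pos[OF H] mix_0_pos[OF G0] by (auto simp: f_def f0_def)
    have "f0 / sqrt (f0 + \<eta>) \<le> f0 / sqrt f0" using p \<eta> by (intro divide_left_mono) auto
    also have "\<dots> = sqrt f0" using p by (simp add: real_div_sqrt)
    finally have "sqrt (f + \<eta>) * (f0 / sqrt (f0 + \<eta>)) \<le> sqrt (f + \<eta>) * sqrt f0"
      using p \<eta> by (intro mult_left_mono) auto
    also have "\<dots> \<le> (sqrt f + sqrt \<eta>) * sqrt f0"
      using p \<eta> sqrt_add_le_add_sqrt[of f \<eta>] by (intro mult_right_mono) auto
    also have "\<dots> = sqrt (f * f0) + sqrt \<eta> * sqrt f0" by (simp add: distrib_right real_sqrt_mult)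
    also have "\<dots> \<le> sqrt (f * f0) + sqrt \<eta> * (sqrt_const * tail_env x)"
      using sf[of x] \<eta> by (intro add_left_mono mult_left_mono) (auto simp: f0_def)
    finally show ?thesis by (simp add: lik_ratio_def f_def f0_def real_sqrt_divide)
  qed
  have ib: "integrable lborel (\<lambda>x. sqrt (mix 0 H s x * mix 0 G0 s x) + sqrt \<eta> * (sqrt_const * tail_env x))"
    using si(1) tail_env_integrable(1) by auto
  have [measurable]: "lik_ratio \<eta> H G0 s \<in> borel_measurable borel"
    using lik_ratio_smooth[OF H G0 \<eta>] by (simp add: smooth_bdd_def)
  have [measurable]: "mix 0 G0 s \<in> borel_measurable borel" by (rule borel_measurable_mix[OF G0])
  have nn: "0 \<le> lik_ratio \<eta> H G0 s x * mix 0 G0 s x" for x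
    using mix_0_pos[OF H, of x] mix_0_pos[OF G0, of x] \<eta> by (simp add: lik_ratio_def)
  have il: "integrable lborel (\<lambda>x. lik_ratio \<eta> H G0 s x * mix 0 G0 s x)"
  proof (rule Bochner_Integration.integrable_bound[OF ib])
    show "AE x in lborel. norm (lik_ratio \<eta> H G0 s x * mix 0 G0 s x)
       \<le> norm (sqrt (mix 0 H s x * mix 0 G0 s x) + sqrt \<eta> * (sqrt_const * tail_env x))"
      using pw nn by (intro AE_I2) (smt (verit) real_norm_def)
  qed measurable
  have "(\<integral>x. lik_ratio \<eta> H G0 s x * mix 0 G0 s x \<partial>lborel)
     \<le> (\<integral>x. sqrt (mix 0 H s x * mix 0 G0 s x) + sqrt \<eta> * (sqrt_const * tail_env x) \<partial>lborel)"
    by (rule integral_mono[OF il ib pw])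
  also have "\<dots> = 1 + (- hell2 H G0 s / 2 + sqrt \<eta> * sqrt_const)"
    using si tail_env_integrable by simp
  also have "\<dots> \<le> exp (- hell2 H G0 s / 2 + sqrt \<eta> * sqrt_const)" by (rule exp_ge_add_one_self)
  finally show ?thesis .
qed

text \<open>Both sides are the expectation of h at one observation, computed by conditioning on the
  mean and from the marginal density.\<close>

lemma integral_gauss_avg_mix:
  assumes h: "smooth_bdd \<delta> B C h" and G0: "real_distribution G0"
  shows "(\<integral>b. gauss_avg s h b \<partial>G0) = (\<integral>x. h x * mix 0 G0 s x \<partial>lborel)"
proof -
  interpret G0: real_distribution G0 by fact
  interpret P: pair_sigma_finite G0 lborel ..
  have [measurable]: "h \<in> borel_measurable borel" using h by (simp add: smooth_bdd_def)
  note hb = smooth_bdd_abs_le[OF h]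
  have inner: "gauss_avg s h b = (\<integral>x. h x * gauss_deriv 0 s (x - b) \<partial>lborel)" for b
  proof -
    have e: "std_normal_density z * h (b + s * z) = s * (h (b + s * z) * normal_density 0 s (s * z))" for z
      using normal_density_scale[OF s0, of z] by (simp add: mult_ac)
    show ?thesis
      unfolding std_normal_def gauss_avg_def using s0
        lborel_integral_real_affine[of s "\<lambda>x. h x * gauss_deriv 0 s (x - b)" b]
      by (subst integral_density) (auto simp: e)
  qed
  have i: "integrable (G0 \<Otimes>\<^sub>M lborel) (\<lambda>(b, x). h x * gauss_deriv 0 s (x - b))"
  proof (rule Bochner_Integration.integrable_bound)
    show "integrable (G0 \<Otimes>\<^sub>M lborel) (\<lambda>p. (\<bar>\<delta>\<bar> + \<bar>B\<bar>) * (case p of (b, x) \<Rightarrow> gauss_deriv 0 s (x - b)))"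
      using convolution_prob_integral(1)[OF G0 gauss_deriv_integrable[of 0]] by (rule integrable_mult_right)
    show "AE p in G0 \<Otimes>\<^sub>M lborel. norm (case p of (b, x) \<Rightarrow> h x * gauss_deriv 0 s (x - b))
      \<le> norm ((\<bar>\<delta>\<bar> + \<bar>B\<bar>) * (case p of (b, x) \<Rightarrow> gauss_deriv 0 s (x - b)))"
      using hb by (intro AE_I2) (auto simp: abs_mult split: prod.split intro!: mult_right_mono order_trans[OF hb])
  qed measurable
  have "(\<integral>b. gauss_avg s h b \<partial>G0) = (\<integral>x. (\<integral>b. h x * gauss_deriv 0 s (x - b) \<partial>G0) \<partial>lborel)"
    unfolding inner by (rule P.Fubini_integral[OF i, symmetric])
  also have "\<dots> = (\<integral>x. h x * mix 0 G0 s x \<partial>lborel)"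
    by (simp only: mix_def integral_mult_right_zero)
  finally show ?thesis .
qed

end

text \<open>Jensen's inequality for a concave power. Young's inequality supplies the tangent line at
  the mean \<open>c\<close>.\<close>

lemma integral_powr_le:
  fixes k :: "'a \<Rightarrow> real"
  assumes N: "prob_space N" and [measurable]: "k \<in> borel_measurable N"
    and k: "\<And>x. \<delta> \<le> k x" "\<And>x. k x \<le> B" and \<delta>: "\<delta> > 0" and a: "0 \<le> \<alpha>" "\<alpha> \<le> 1"
  shows "(\<integral>x. k x powr \<alpha> \<partial>N) \<le> (\<integral>x. k x \<partial>N) powr \<alpha>"
proof -
  interpret prob_space N by (rule N)
  have kp: "k x > 0" for x using k(1)[of x] \<delta> by linarith
  have ki: "integrable N k"
    by (rule integrable_const_bound[where B = B]) (use k kp in \<open>auto simp: abs_of_pos\<close>)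
  have kai: "integrable N (\<lambda>x. k x powr \<alpha>)"
    by (rule integrable_const_bound[where B = "B powr \<alpha>"])
       (use k kp a in \<open>auto intro!: powr_mono2 simp: less_imp_le\<close>)
  define c where "c = (\<integral>x. k x \<partial>N)"
  have "\<delta> \<le> c" unfolding c_def using ki k by (intro integral_ge_const) auto
  then have c: "c > 0" using \<delta> by linarith
  have pw: "k x powr \<alpha> \<le> c powr \<alpha> * (1 - \<alpha> + \<alpha> / c * k x)" for x
  proof -
    have "(k x / c) powr \<alpha> * 1 powr (1 - \<alpha>) \<le> \<alpha> * (k x / c) + (1 - \<alpha>) * 1"
      by (rule Youngs_inequality_0) (use a kp[of x] c in auto)
    then have "c powr \<alpha> * (k x powr \<alpha> / c powr \<alpha>) \<le> c powr \<alpha> * (1 - \<alpha> + \<alpha> / c * k x)"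
      using kp[of x] c by (intro mult_left_mono) (auto simp: powr_divide less_imp_le)
    then show ?thesis using c by simp
  qed
  have "(\<integral>x. k x powr \<alpha> \<partial>N) \<le> (\<integral>x. c powr \<alpha> * (1 - \<alpha> + \<alpha> / c * k x) \<partial>N)"
    using ki by (intro integral_mono kai pw) auto
  also have "\<dots> = c powr \<alpha> * (1 - \<alpha> + \<alpha> / c * c)" using ki by (simp add: prob_space c_def)
  also have "\<dots> = c powr \<alpha>" using c by simp
  finally show ?thesis by (simp add: c_def)
qed

section \<open>The correlated model\<close>

text \<open>A point outside the support has an open null neighbourhood. There may be uncountably
  many of these, so the Lindelof property selects countably many that still cover the
  complement.\<close>

lemma AE_supp_bounded:
  assumes G: "real_distribution G" and s: "supp G \<subseteq> {-M..M}"
  shows "AE \<theta> in G. \<bar>\<theta>\<bar> \<le> M"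
proof -
  interpret G: real_distribution G by fact
  define F where "F = {T. open T \<and> emeasure G T = 0}"
  obtain F' where F': "F' \<subseteq> F" "countable F'" "\<Union>F' = \<Union>F"
    by (rule Lindelof[of F]) (auto simp: F_def)
  have "\<Union>F' \<in> null_sets G"
    using F'(1,2) by (intro null_sets_UN'[of F' "\<lambda>T. T", simplified]) (auto simp: F_def null_sets_def)
  moreover have "{\<theta> \<in> space G. \<not> \<bar>\<theta>\<bar> \<le> M} \<subseteq> \<Union>F'"
  proof
    fix \<theta> assume "\<theta> \<in> {\<theta> \<in> space G. \<not> \<bar>\<theta>\<bar> \<le> M}"
    then have "\<theta> \<notin> {-M..M}" by (auto simp: abs_le_iff)
    then have "\<theta> \<notin> supp G" using s by blast
    then obtain T where T: "open T" "\<theta> \<in> T" "\<not> measure G T > 0" by (auto simp: supp_def)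
    then have "emeasure G T = 0" by (simp add: G.emeasure_eq_measure zero_less_measure_iff)
    then show "\<theta> \<in> \<Union>F'" unfolding F'(3) using T by (auto simp: F_def)
  qed
  ultimately show ?thesis by (rule AE_I')  
qed

section \<open>Euclidean and operator norms of matrices\<close>

lemma euclid_norm_sq:
  assumes "v \<in> carrier_vec n"
  shows "(euclid_norm v)\<^sup>2 = (\<Sum>i<n. (v $ i)\<^sup>2)"
proof -
  have "v \<bullet> v = (\<Sum>i<n. (v $ i)\<^sup>2)"
    using assms by (simp add: scalar_prod_def power2_eq_square atLeast0LessThan)
  moreover have "\<dots> \<ge> 0" by (intro sum_nonneg) auto
  ultimately show ?thesis by (simp add: euclid_norm_def)
qed

text \<open>The Frobenius bound. It shows that the supremum defining \<open>op_norm\<close> is over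
  a bounded set and settles vectors of norm zero.\<close>

lemma euclid_norm_mult_mat_vec_le:
  assumes A: "A \<in> carrier_mat n n" and v: "v \<in> carrier_vec n"
  shows "(euclid_norm (A *\<^sub>v v))\<^sup>2 \<le> (\<Sum>i<n. \<Sum>j<n. (A $$ (i, j))\<^sup>2) * (euclid_norm v)\<^sup>2"
proof -
  have Av: "A *\<^sub>v v \<in> carrier_vec n" using A v by simp
  have "((A *\<^sub>v v) $ i)\<^sup>2 \<le> (\<Sum>j<n. (A $$ (i, j))\<^sup>2) * (\<Sum>j<n. (v $ j)\<^sup>2)" if i: "i < n" for i
  proof -
    have "(A *\<^sub>v v) $ i = (\<Sum>j<n. A $$ (i, j) * v $ j)"
      using A v i by (simp add: scalar_prod_def atLeast0LessThan)
    then show ?thesis by (simp add: Cauchy_Schwarz_ineq_sum)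
  qed
  then have "(\<Sum>i<n. ((A *\<^sub>v v) $ i)\<^sup>2) \<le> (\<Sum>i<n. (\<Sum>j<n. (A $$ (i, j))\<^sup>2) * (\<Sum>j<n. (v $ j)\<^sup>2))"
    by (intro sum_mono) auto
  then show ?thesis by (simp add: euclid_norm_sq[OF Av] euclid_norm_sq[OF v] sum_distrib_right)
qed

lemma euclid_norm_nonneg: "0 \<le> euclid_norm v"
  unfolding euclid_norm_def scalar_prod_def by (auto intro!: sum_nonneg)

lemma op_norm_bound:
  assumes A: "A \<in> carrier_mat n n" and v: "v \<in> carrier_vec n"
  shows "euclid_norm (A *\<^sub>v v) \<le> op_norm n A * euclid_norm v"
proof (cases "euclid_norm v = 0")
  case True
  with euclid_norm_mult_mat_vec_le[OF A v] have "(euclid_norm (A *\<^sub>v v))\<^sup>2 \<le> 0" by simp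
  then show ?thesis using True by simp
next
  case False
  define r where "r = euclid_norm v"
  have r: "r > 0" using False euclid_norm_nonneg[of v] by (simp add: r_def)
  define u where "u = (1 / r) \<cdot>\<^sub>v v"
  have u: "u \<in> carrier_vec n" using v by (simp add: u_def)
  have sc: "euclid_norm (c \<cdot>\<^sub>v w) = c * euclid_norm w" if "c \<ge> 0" for c w
    using that by (simp add: euclid_norm_def smult_scalar_prod_distrib[of w "dim_vec w"] scalar_prod_smult_distrib[of w "dim_vec w"]
        real_sqrt_mult mult.assoc[symmetric] carrier_vec_dim_vec)
  have u1: "euclid_norm u = 1" using r sc[of "1 / r" v] by (simp add: u_def r_def)
  have "bdd_above ((\<lambda>v. euclid_norm (A *\<^sub>v v)) ` {v \<in> carrier_vec n. euclid_norm v = 1})"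
  proof (rule bdd_aboveI2)
    fix w assume "w \<in> {v \<in> carrier_vec n. euclid_norm v = 1}"
    with euclid_norm_mult_mat_vec_le[OF A, of w]
    show "euclid_norm (A *\<^sub>v w) \<le> sqrt (\<Sum>i<n. \<Sum>j<n. (A $$ (i, j))\<^sup>2)"
      by (intro real_le_rsqrt) auto
  qed
  then have "euclid_norm (A *\<^sub>v u) \<le> op_norm n A"
    unfolding op_norm_def using u u1 by (intro cSUP_upper) auto
  moreover have "A *\<^sub>v u = (1 / r) \<cdot>\<^sub>v (A *\<^sub>v v)" using A v by (simp add: u_def mult_mat_vec)
  ultimately have "1 / r * euclid_norm (A *\<^sub>v v) \<le> op_norm n A" using sc[of "1 / r"] r by simp
  then show ?thesis using r by (simp add: r_def[symmetric] field_simps)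
qed

lemma quadratic_form_le_op_norm:
  assumes A: "A \<in> carrier_mat n n"
  shows "(\<Sum>i<n. \<Sum>j<n. v i * v j * A $$ (i, j)) \<le> op_norm n A * (\<Sum>i<n. (v i)\<^sup>2)"
proof -
  define w where "w = Matrix.vec n v"
  have w: "w \<in> carrier_vec n" by (simp add: w_def)
  have Aw: "A *\<^sub>v w \<in> carrier_vec n" using A w by simp
  have n2: "(euclid_norm w)\<^sup>2 = (\<Sum>i<n. (v i)\<^sup>2)" unfolding euclid_norm_sq[OF w] by (simp add: w_def)
  have "(\<Sum>i<n. \<Sum>j<n. v i * v j * A $$ (i, j)) = (\<Sum>i<n. w $ i * (A *\<^sub>v w) $ i)"
    using A by (auto simp: w_def scalar_prod_def atLeast0LessThan sum_distrib_left mult_ac intro!: sum.cong)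
  also have "\<dots> \<le> euclid_norm w * euclid_norm (A *\<^sub>v w)"
  proof -
    have "(\<Sum>i<n. w $ i * (A *\<^sub>v w) $ i)\<^sup>2 \<le> (euclid_norm w * euclid_norm (A *\<^sub>v w))\<^sup>2"
      unfolding power_mult_distrib euclid_norm_sq[OF w] euclid_norm_sq[OF Aw] by (rule Cauchy_Schwarz_ineq_sum)
    then show ?thesis by (rule power2_le_imp_le) (simp add: euclid_norm_nonneg)
  qed
  also have "\<dots> \<le> euclid_norm w * (op_norm n A * euclid_norm w)"
    by (intro mult_left_mono op_norm_bound A w euclid_norm_nonneg)
  also have "\<dots> = op_norm n A * (euclid_norm w)\<^sup>2" by (simp add: power2_eq_square)
  finally show ?thesis unfolding n2 .
qed

section \<open>The observations as a prior plus unit-variance Gaussian linear forms\<close>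

locale corr_model =
  fixes M :: real and n :: nat and G0 :: "real measure" and Cov S :: "real mat"
  assumes M1: "M > 1" and n1: "n \<ge> 1" and G0: "real_distribution G0" and supp: "supp G0 \<subseteq> {-M..M}"
    and Cov: "pos_semidef n Cov" and S: "psd_sqrt n Cov S"
    and diag: "\<And>j. j < n \<Longrightarrow> Cov $$ (j, j) \<in> {1 / M..M}"
begin

abbreviation \<sigma> :: "nat \<Rightarrow> real" where "\<sigma> \<equiv> marginal_sd Cov"

definition coef :: "nat \<Rightarrow> nat \<Rightarrow> real" where "coef j i = S $$ (j, i) / \<sigma> j"

definition opn :: real where "opn = op_norm n (correlation_mat n Cov)"

lemma AE_G0: "AE \<theta> in G0. \<bar>\<theta>\<bar> \<le> M"
  by (rule AE_supp_bounded[OF G0 supp])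

lemma noise_level_\<sigma>: "j < n \<Longrightarrow> noise_level M (\<sigma> j)"
proof -
  assume "j < n"
  then have d: "1 / M \<le> Cov $$ (j, j)" "Cov $$ (j, j) \<le> M" using diag[of j] by auto
  then have "Cov $$ (j, j) > 0" using M1 by (smt (verit) divide_pos_pos)
  then show "noise_level M (\<sigma> j)" using d M1 by unfold_locales (auto simp: marginal_sd_def)
qed

lemma \<sigma>_pos: "j < n \<Longrightarrow> \<sigma> j > 0"
  using noise_level.s0[OF noise_level_\<sigma>] by simp

lemma carriers: "Cov \<in> carrier_mat n n" "S \<in> carrier_mat n n" "S * S = Cov"
  using Cov S by (auto simp: pos_semidef_def psd_sqrt_def)

lemma correlation_carrier: "correlation_mat n Cov \<in> carrier_mat n n"
  unfolding correlation_mat_def Let_def by (intro mult_carrier_mat[of _ n n] carriers(1) mat_diag_dim)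

lemma correlation_entry:
  assumes "i < n" "j < n"
  shows "correlation_mat n Cov $$ (i, j) = Cov $$ (i, j) / (\<sigma> i * \<sigma> j)"
proof -
  define R where "R = mat_diag n (\<lambda>i. 1 / sqrt (Cov $$ (i, i)))"
  have 1: "R * Cov = Matrix.mat n n (\<lambda>(i, j). 1 / sqrt (Cov $$ (i, i)) * Cov $$ (i, j))"
    unfolding R_def by (rule mat_diag_mult_left[OF carriers(1)])
  have "R * Cov * R = Matrix.mat n n (\<lambda>(i, j). (R * Cov) $$ (i, j) * (1 / sqrt (Cov $$ (j, j))))"
    unfolding R_def by (rule mat_diag_mult_right[of _ n n]) (simp add: 1[unfolded R_def])
  then show ?thesis using assms unfolding correlation_mat_def Let_def R_def[symmetric]
    by (simp add: 1 marginal_sd_def)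
qed

text \<open>Symmetry of the root turns \<open>S * S\<close> into a Gram matrix of rows; dividing the
  rows by the standard deviations normalises the covariance to the correlation.\<close>

lemma coef_gram:
  assumes "j < n" "k < n"
  shows "(\<Sum>i<n. coef j i * coef k i) = correlation_mat n Cov $$ (j, k)"
proof -
  have sym: "S $$ (i, k) = S $$ (k, i)" if "i < n" for i
  proof -
    have "transpose_mat S = S" using S by (simp add: psd_sqrt_def pos_semidef_def)
    then have "S $$ (i, k) = transpose_mat S $$ (i, k)" by simp
    also have "\<dots> = S $$ (k, i)" using that assms carriers by simp
    finally show ?thesis .
  qed
  have "Cov $$ (j, k) = (\<Sum>i<n. S $$ (j, i) * S $$ (i, k))"
    using assms carriers(2) by (subst carriers(3)[symmetric]) (simp add: scalar_prod_def atLeast0LessThan)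
  also have "\<dots> = (\<Sum>i<n. S $$ (j, i) * S $$ (k, i))" by (intro sum.cong) (auto simp: sym)
  finally show ?thesis
    by (simp add: correlation_entry[OF assms] coef_def sum_divide_distrib)
qed

lemma coef_opb: "(\<Sum>i<n. (\<Sum>j<n. v j * coef j i)\<^sup>2) \<le> opn * (\<Sum>j<n. (v j)\<^sup>2)"
proof -
  have "(\<Sum>i<n. (\<Sum>j<n. v j * coef j i)\<^sup>2) = (\<Sum>i<n. \<Sum>j<n. \<Sum>k<n. v j * v k * (coef j i * coef k i))"
    by (simp add: power2_eq_square sum_product mult_ac)
  also have "\<dots> = (\<Sum>j<n. \<Sum>k<n. \<Sum>i<n. v j * v k * (coef j i * coef k i))"
    by (subst sum.swap, rule sum.cong[OF refl], rule sum.swap)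
  also have "\<dots> = (\<Sum>j<n. \<Sum>k<n. v j * v k * correlation_mat n Cov $$ (j, k))"
    by (simp add: coef_gram flip: sum_distrib_left)
  also have "\<dots> \<le> opn * (\<Sum>j<n. (v j)\<^sup>2)"
    unfolding opn_def by (rule quadratic_form_le_op_norm[OF correlation_carrier])
  finally show ?thesis .
qed

lemma correlation_diag: "j < n \<Longrightarrow> correlation_mat n Cov $$ (j, j) = 1"
  using \<sigma>_pos[of j] diag[of j] M1 by (simp add: correlation_entry marginal_sd_def)

text \<open>Tested on the first unit vector, the quadratic form of a correlation matrix equals its
  diagonal entry 1.\<close>

lemma opn_ge_1: "opn \<ge> 1"
proof -
  have "(\<Sum>j<n. (if i = 0 then 1 else 0) * (if j = 0 then 1 else 0) * correlation_mat n Cov $$ (i, j)) = (if i = 0 then 1 else 0)" for i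
    using n1 correlation_diag[of 0] by (cases "i = 0") (simp_all add: if_distrib[of "\<lambda>x. x * _"] sum.delta' cong: if_cong)
  then have "(\<Sum>i<n. \<Sum>j<n. (if i = 0 then 1 else 0) * (if j = 0 then 1 else 0) * correlation_mat n Cov $$ (i, j)) = 1"
    using n1 by simp
  moreover have "(\<Sum>i<n. (if i = 0 then 1 else 0 :: real)\<^sup>2) = 1"
    using n1 by (simp add: if_distrib[of "\<lambda>x. x\<^sup>2"] sum.delta' cong: if_cong)
  ultimately show ?thesis
    using quadratic_form_le_op_norm[OF correlation_carrier, of "\<lambda>i. if i = 0 then 1 else 0"] by (simp add: opn_def)
qed

sublocale forms: gauss_linear_forms "{..<n}" "{..<n}" coef opn
proof
  show "(\<Sum>i<n. (coef j i)\<^sup>2) = 1" if "j \<in> {..<n}" for j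
    using coef_gram[of j j] correlation_diag[of j] that by (simp add: power2_eq_square)
qed (use opn_ge_1 coef_opb in auto)

lemma model_eq: "model n G0 = (\<Pi>\<^sub>M i\<in>{..<n}. G0) \<Otimes>\<^sub>M forms.\<mu>"
  by (simp add: model_def forms.\<mu>_def)

lemma observation_eq: "j < n \<Longrightarrow> observation n S \<omega> $ j = fst \<omega> j + \<sigma> j * forms.Y j (snd \<omega>)"
  using carriers(2) \<sigma>_pos[of j]
  by (cases \<omega>) (simp add: observation_def forms.Y_def coef_def scalar_prod_def atLeast0LessThan sum_distrib_left)

interpretation G0: real_distribution G0 by (rule G0)

sublocale prior: prob_space "\<Pi>\<^sub>M i\<in>{..<n}. G0"
  by (rule prob_space_PiM) (rule G0.prob_space_axioms)

sublocale joint: pair_prob_space "\<Pi>\<^sub>M i\<in>{..<n}. G0" forms.\<mu> ..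

lemma prob_space_model: "prob_space (model n G0)"
  unfolding model_eq by (rule joint.prob_space_axioms)

lemma observation_measurable: "j < n \<Longrightarrow> (\<lambda>\<omega>. observation n S \<omega> $ j) \<in> borel_measurable (model n G0)"
proof -
  assume j: "j < n"
  have "(\<lambda>\<beta>. \<beta> j) \<in> borel_measurable (\<Pi>\<^sub>M i\<in>{..<n}. G0)"
    using measurable_component_singleton[of j "{..<n}" "\<lambda>_. G0"] j
    by (simp add: measurable_cong_sets[OF refl G0.events_eq_borel])
  from measurable_compose[OF measurable_fst this] measurable_compose[OF measurable_snd forms.Y_measurable]
  show ?thesis unfolding model_eq observation_eq[OF j]
    by (intro borel_measurable_add borel_measurable_times borel_measurable_const) auto
qed

text \<open>Correlation lives only in the noise. Given the means, \<open>gauss_hoelder\<close>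
  bounds the expectation by a product; the means are independent, so its expectation factors, and
  Jensen's inequality with exponent \<open>1 / opn \<le> 1\<close> moves the power outside each
  factor.\<close>

theorem hoelder_model:
  assumes h: "\<And>j. j < n \<Longrightarrow> smooth_bdd \<delta> B C (h j)" and \<delta>: "\<delta> > 0" and C: "C \<ge> 0" and B: "B \<ge> 0"
  shows "integrable (model n G0) (\<lambda>\<omega>. \<Prod>j<n. h j (observation n S \<omega> $ j) powr (1 / opn))"
    and "(\<integral>\<omega>. (\<Prod>j<n. h j (observation n S \<omega> $ j) powr (1 / opn)) \<partial>model n G0)
      \<le> (\<Prod>j<n. (\<integral>x. h j x * mix 0 G0 (\<sigma> j) x \<partial>lborel) powr (1 / opn))"
proof -
  have a: "0 \<le> 1 / opn" "1 / opn \<le> 1" using opn_ge_1 by auto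
  interpret PS: product_sigma_finite "\<lambda>_::nat. G0" ..
  show i: "integrable (model n G0) (\<lambda>\<omega>. \<Prod>j<n. h j (observation n S \<omega> $ j) powr (1 / opn))"
    by (rule forms.prod_powr_integrable(1)[OF _ \<delta> a(1) _ prob_space_model]) (use h observation_measurable in auto)
  have oe: "(\<lambda>\<omega>. \<Prod>j<n. h j (observation n S \<omega> $ j) powr (1 / opn))
     = (\<lambda>\<omega>. \<Prod>j<n. h j (fst \<omega> j + \<sigma> j * forms.Y j (snd \<omega>)) powr (1 / opn))"
    by (intro ext prod.cong) (auto simp: observation_eq)
  have i2: "integrable ((\<Pi>\<^sub>M i\<in>{..<n}. G0) \<Otimes>\<^sub>M forms.\<mu>)
     (\<lambda>(\<beta>, z). \<Prod>j<n. h j (\<beta> j + \<sigma> j * forms.Y j z) powr (1 / opn))"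
    using i unfolding model_eq oe by (simp add: case_prod_unfold)
  define k where "k j = gauss_avg (\<sigma> j) (h j)" for j
  have k: "smooth_bdd \<delta> B C (k j)" if "j < n" for j unfolding k_def by (rule smooth_bdd_gauss_avg[OF h[OF that]])
  have "(\<integral>\<omega>. (\<Prod>j<n. h j (observation n S \<omega> $ j) powr (1 / opn)) \<partial>model n G0)
     = (\<integral>\<beta>. (\<integral>z. (\<Prod>j<n. h j (\<beta> j + \<sigma> j * forms.Y j z) powr (1 / opn)) \<partial>forms.\<mu>) \<partial>(\<Pi>\<^sub>M i\<in>{..<n}. G0))"
    using joint.integral_fst'[OF i2] unfolding model_eq oe by (simp add: case_prod_unfold)
  also have "\<dots> \<le> (\<integral>\<beta>. (\<Prod>j<n. k j (\<beta> j) powr (1 / opn)) \<partial>(\<Pi>\<^sub>M i\<in>{..<n}. G0))"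
  proof (rule integral_mono)
    show "integrable (\<Pi>\<^sub>M i\<in>{..<n}. G0) (\<lambda>\<beta>. \<integral>z. (\<Prod>j<n. h j (\<beta> j + \<sigma> j * forms.Y j z) powr (1 / opn)) \<partial>forms.\<mu>)"
      using joint.integrable_fst'[OF i2] by simp
    show "integrable (\<Pi>\<^sub>M i\<in>{..<n}. G0) (\<lambda>\<beta>. \<Prod>j<n. k j (\<beta> j) powr (1 / opn))"
      by (rule forms.prod_powr_integrable(1)[OF _ \<delta> a(1) _ prior.prob_space_axioms]) (use k in auto)
    fix \<beta>
    have "(\<integral>z. (\<Prod>j<n. h j (\<beta> j + \<sigma> j * forms.Y j z) powr (1 / opn)) \<partial>forms.\<mu>)
       \<le> (\<Prod>j<n. (\<integral>y. h j (\<beta> j + \<sigma> j * y) \<partial>std_normal) powr (1 / opn))"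
    \<comment> \<open>Rescaling by \<sigma>_j multiplies the smoothness constant by a common bound
      for \<sigma>_j and its square; both are at most \<open>M\<close> because
      \<open>M > 1\<close>.\<close>
    proof (rule forms.gauss_hoelder[OF _ \<delta> _ B, where C = "C * M"])
      fix j assume "j \<in> {..<n}"
      then have j: "j < n" by simp
      interpret nl: noise_level M "\<sigma> j" by (rule noise_level_\<sigma>[OF j])
      have "\<bar>\<sigma> j\<bar> \<le> M"
      proof (rule ccontr)
        assume "\<not> \<bar>\<sigma> j\<bar> \<le> M"
        then have "M < \<sigma> j" using nl.s0 by simp
        then have "M * 1 < \<sigma> j * \<sigma> j" using M1 by (intro mult_strict_mono) auto
        then show False using nl.s2_upper by (simp add: power2_eq_square)
      qed
      then show "smooth_bdd \<delta> B (C * M) (\<lambda>x. h j (\<beta> j + \<sigma> j * x))"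
        using nl.s2_upper by (intro smooth_bdd_affine[OF h[OF j]] C) auto
    qed (use C M1 in auto)
    then show "(\<integral>z. (\<Prod>j<n. h j (\<beta> j + \<sigma> j * forms.Y j z) powr (1 / opn)) \<partial>forms.\<mu>) \<le> (\<Prod>j<n. k j (\<beta> j) powr (1 / opn))"
      by (simp add: k_def gauss_avg_def)
  qed
  also have "\<dots> = (\<Prod>j<n. (\<integral>b. k j b powr (1 / opn) \<partial>G0))"
  proof (rule PS.product_integral_prod)
    fix j assume "j \<in> {..<n}"
    then have j: "j < n" by simp
    have kb: "\<delta> \<le> k j x" "k j x \<le> B" and [measurable]: "k j \<in> borel_measurable borel" for x
      using k[OF j] by (auto simp: smooth_bdd_def)
    show "integrable G0 (\<lambda>b. k j b powr (1 / opn))"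
      by (intro G0.integrable_const_bound[where B = "B powr (1 / opn)"])
        (use kb order_trans[OF less_imp_le[OF \<delta>] kb(1)] in \<open>auto intro!: AE_I2 powr_mono2[OF a(1)]\<close>)
  qed simp
  also have "\<dots> \<le> (\<Prod>j<n. (\<integral>b. k j b \<partial>G0) powr (1 / opn))"
  proof (intro prod_mono conjI)
    fix j assume "j \<in> {..<n}"
    then have j: "j < n" by simp
    show "0 \<le> (\<integral>b. k j b powr (1 / opn) \<partial>G0)" by simp
    show "(\<integral>b. k j b powr (1 / opn) \<partial>G0) \<le> (\<integral>b. k j b \<partial>G0) powr (1 / opn)"
      by (rule integral_powr_le[OF G0.prob_space_axioms _ _ _ \<delta> a]) (use k[OF j] in \<open>auto simp: smooth_bdd_def\<close>)
  qed
  also have "\<dots> = (\<Prod>j<n. (\<integral>x. h j x * mix 0 G0 (\<sigma> j) x \<partial>lborel) powr (1 / opn))"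
    unfolding k_def using noise_level.integral_gauss_avg_mix[OF noise_level_\<sigma> h G0] by (intro prod.cong) auto
  finally show "(\<integral>\<omega>. (\<Prod>j<n. h j (observation n S \<omega> $ j) powr (1 / opn)) \<partial>model n G0)
      \<le> (\<Prod>j<n. (\<integral>x. h j x * mix 0 G0 (\<sigma> j) x \<partial>lborel) powr (1 / opn))" .
qed

end

section \<open>Covering the mixtures by matching truncated moments\<close>

text \<open>The estimator ranges over all distributions, including those without moments; truncation
  makes the moments exist and bounds them by powers of r.\<close>

definition trunc_moment :: "real \<Rightarrow> real measure \<Rightarrow> nat \<Rightarrow> real" where
  "trunc_moment r G l = (\<integral>u. u ^ l * indicator {-r..r} u \<partial>G)"

lemma trunc_moment_integrable:
  assumes "real_distribution G" "r \<ge> 0"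
  shows "integrable G (\<lambda>u. u ^ l * indicator {-r..r} u)" "\<bar>trunc_moment r G l\<bar> \<le> r ^ l"
proof -
  interpret G: real_distribution G by fact
  have b: "\<bar>u ^ l * indicator {-r..r} u\<bar> \<le> r ^ l" for u
    using assms(2) by (auto simp: indicator_def power_abs intro!: power_mono)
  show i: "integrable G (\<lambda>u. u ^ l * indicator {-r..r} u)"
    by (rule G.integrable_const_bound[where B = "r ^ l"]) (use b in auto)
  show "\<bar>trunc_moment r G l\<bar> \<le> r ^ l" unfolding trunc_moment_def
    by (rule order_trans[OF integral_abs_bound]) (use b i in \<open>auto intro!: G.integral_le_const\<close>)
qed

lemma exp_minus_taylor:
  fixes t :: real
  assumes "0 \<le> t" "t \<le> B"
  shows "\<bar>exp (- t) - (\<Sum>k<K. (- t) ^ k / fact k)\<bar> \<le> exp B * B ^ K / fact K"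
proof -
  obtain v where v: "\<bar>v\<bar> \<le> \<bar>- t\<bar>" and e: "exp (- t) = (\<Sum>m<K. (- t) ^ m / fact m) + exp v / fact K * (- t) ^ K"
    using Maclaurin_exp_le[of "- t" K] by auto
  have "\<bar>exp (- t) - (\<Sum>k<K. (- t) ^ k / fact k)\<bar> = exp v / fact K * t ^ K"
    using assms unfolding e by (simp add: abs_mult power_abs)
  also have "\<dots> \<le> exp B / fact K * B ^ K"
    using v assms by (intro mult_mono divide_right_mono power_mono) auto
  finally show ?thesis by simp
qed

text \<open>Three sources of error: mass beyond r seen from a point within R, the remainder of the
  exponential series after K terms, and a mismatch \<epsilon> of the truncated moments weighted by
  the coefficients of the Taylor polynomial.\<close>

definition cover_error :: "real \<Rightarrow> real \<Rightarrow> real \<Rightarrow> nat \<Rightarrow> real \<Rightarrow> real" where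
  "cover_error M R r K \<epsilon> = M * (2 * exp (- (r - R)\<^sup>2 / (2 * M))
     + 2 * (exp ((R + r)\<^sup>2 * M / 2) * ((R + r)\<^sup>2 * M / 2) ^ K / fact K)
     + \<epsilon> * exp ((1 + R)\<^sup>2 * M / 2))"

context noise_level
begin

lemma normal_density_prefactor_le: "1 / sqrt (2 * pi * s\<^sup>2) \<le> M"
proof -
  have "1 / sqrt (2 * pi * s\<^sup>2) = normal_density 0 s 0" by (simp add: normal_density_def)
  also have "\<dots> \<le> M * normal_density 0 (sqrt M) 0" by (rule normal_density_le)
  also have "\<dots> \<le> M * 1"
  proof (rule mult_left_mono)
    have "1 \<le> 2 * pi * M" by (rule one_le_two_pi_mult) (use M1 in simp)
    then show "normal_density 0 (sqrt M) 0 \<le> 1" using M1 by (simp add: normal_density_def)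
  qed (use M1 in simp)
  finally show ?thesis by simp
qed

lemma normal_density_le_tail:
  assumes "0 \<le> d" "d \<le> \<bar>v\<bar>"
  shows "normal_density 0 s v \<le> M * exp (- d\<^sup>2 / (2 * M))"
proof -
  have "d\<^sup>2 \<le> v\<^sup>2" using power_mono[OF assms(2,1), of 2] by simp
  then have "d\<^sup>2 / (2 * M) \<le> v\<^sup>2 / (2 * s\<^sup>2)" using s2_upper s0 M1 by (intro frac_le) auto
  then have "1 / sqrt (2 * pi * s\<^sup>2) * exp (- v\<^sup>2 / (2 * s\<^sup>2)) \<le> M * exp (- d\<^sup>2 / (2 * M))"
    using normal_density_prefactor_le M1 by (intro mult_mono) auto
  then show ?thesis by (simp add: normal_density_def)
qed

definition inner_mix :: "real \<Rightarrow> real measure \<Rightarrow> real \<Rightarrow> real" where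
  "inner_mix r G x = (\<integral>u. normal_density 0 s (x - u) * indicator {-r..r} u \<partial>G)"

lemma mix_inner_mix:
  assumes G: "real_distribution G" and R: "\<bar>x\<bar> \<le> R" "R \<le> r"
  shows "0 \<le> mix 0 G s x - inner_mix r G x" "mix 0 G s x - inner_mix r G x \<le> M * exp (- (r - R)\<^sup>2 / (2 * M))"
    and "integrable G (\<lambda>u. normal_density 0 s (x - u) * indicator {-r..r} u)"
proof -
  interpret G: real_distribution G by fact
  show i: "integrable G (\<lambda>u. normal_density 0 s (x - u) * indicator {-r..r} u)"
    using mix_integrand_integrable[OF G, of 0 x]
    by (intro Bochner_Integration.integrable_bound[OF mix_integrand_integrable[OF G, of 0 x]]) (auto simp: indicator_def)
  have i': "integrable G (\<lambda>u. normal_density 0 s (x - u) - normal_density 0 s (x - u) * indicator {-r..r} u)"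
    using mix_integrand_integrable[OF G, of 0 x] i by simp
  have e: "mix 0 G s x - inner_mix r G x = (\<integral>u. normal_density 0 s (x - u) - normal_density 0 s (x - u) * indicator {-r..r} u \<partial>G)"
    using mix_integrand_integrable[OF G, of 0 x] i by (simp add: mix_def inner_mix_def)
  show "0 \<le> mix 0 G s x - inner_mix r G x" unfolding e
    by (intro integral_nonneg_AE AE_I2) (auto simp: indicator_def)
  show "mix 0 G s x - inner_mix r G x \<le> M * exp (- (r - R)\<^sup>2 / (2 * M))" unfolding e
  proof (rule G.integral_le_const[OF i'], rule AE_I2)
    fix u
    show "normal_density 0 s (x - u) - normal_density 0 s (x - u) * indicator {-r..r} u \<le> M * exp (- (r - R)\<^sup>2 / (2 * M))"
    proof (cases "u \<in> {-r..r}")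
      case False
      then have "r - R \<le> \<bar>x - u\<bar>" using R by (auto simp: abs_real_def split: if_splits)
      then show ?thesis using normal_density_le_tail[of "r - R" "x - u"] R False by simp
    qed (use M1 in simp)
  qed
qed

text \<open>On bounded sets the Gaussian kernel is nearly a polynomial in u of degree below
  \<open>2 * K\<close>, whose integral is determined by moments. The moments involve neither x nor
  s, so one class of mixing measures works for all coordinates at once.\<close>

lemma inner_mix_close:
  assumes G: "real_distribution G" and H: "real_distribution H" and R: "\<bar>x\<bar> \<le> R" "R \<le> r"
    and m: "\<And>l. l \<le> 2 * K \<Longrightarrow> \<bar>trunc_moment r G l - trunc_moment r H l\<bar> \<le> \<epsilon>"
  shows "\<bar>inner_mix r G x - inner_mix r H x\<bar>
     \<le> M * (2 * (exp ((R + r)\<^sup>2 * M / 2) * ((R + r)\<^sup>2 * M / 2) ^ K / fact K) + \<epsilon> * exp ((1 + R)\<^sup>2 * M / 2))"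
proof -
  define c where "c = 1 / sqrt (2 * pi * s\<^sup>2)"
  have c: "0 \<le> c" "c \<le> M" using normal_density_prefactor_le by (auto simp: c_def)
  define B where "B = (R + r)\<^sup>2 * M / 2"
  define T where "T = exp B * B ^ K / fact K"
  have R0: "R \<ge> 0" "r \<ge> 0" using R by auto
  define w where "w k = (- 1 / (2 * s\<^sup>2)) ^ k / fact k" for k :: nat
  define P where "P u = (\<Sum>k<K. w k * (x - u) ^ (2 * k))" for u
  define \<kappa> :: "real \<Rightarrow> real" where "\<kappa> = indicator {-r..r}"
  have Pt: "P u = (\<Sum>k<K. (- ((x - u)\<^sup>2 / (2 * s\<^sup>2))) ^ k / fact k)" for u
  proof -
    have "(- ((x - u)\<^sup>2 / (2 * s\<^sup>2))) ^ k = (- 1 / (2 * s\<^sup>2)) ^ k * (x - u) ^ (2 * k)" for k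
    proof -
      have "- ((x - u)\<^sup>2 / (2 * s\<^sup>2)) = (- 1 / (2 * s\<^sup>2)) * (x - u)\<^sup>2" by simp
      then show ?thesis by (simp only: power_mult_distrib power_mult)
    qed
    then show ?thesis by (simp add: P_def w_def)
  qed
  have approx: "\<bar>normal_density 0 s (x - u) * \<kappa> u - c * (P u * \<kappa> u)\<bar> \<le> c * T" for u
  proof (cases "u \<in> {-r..r}")
    case True
    have "\<bar>x - u\<bar> \<le> R + r" using True R by (auto simp: abs_real_def split: if_splits)
    then have "(x - u)\<^sup>2 \<le> (R + r)\<^sup>2" using power_mono[of "\<bar>x - u\<bar>" "R + r" 2] by simp
    then have "(x - u)\<^sup>2 * (1 / s\<^sup>2) \<le> (R + r)\<^sup>2 * M" using inv_s2_le by (intro mult_mono) auto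
    then have "(x - u)\<^sup>2 / (2 * s\<^sup>2) \<le> B" by (simp add: B_def)
    then have "\<bar>exp (- ((x - u)\<^sup>2 / (2 * s\<^sup>2))) - P u\<bar> \<le> T"
      unfolding Pt T_def by (intro exp_minus_taylor) auto
    then have "c * \<bar>exp (- ((x - u)\<^sup>2 / (2 * s\<^sup>2))) - P u\<bar> \<le> c * T" using c by (intro mult_left_mono) auto
    moreover have "normal_density 0 s (x - u) * \<kappa> u - c * (P u * \<kappa> u) = c * (exp (- ((x - u)\<^sup>2 / (2 * s\<^sup>2))) - P u)"
      using True by (simp add: \<kappa>_def normal_density_def c_def right_diff_distrib)
    ultimately show ?thesis using c by (simp add: abs_mult)
  next
    case False
    have "B \<ge> 0" using M1 by (simp add: B_def)
    then have "T \<ge> 0" by (simp add: T_def)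
    then show ?thesis using False c by (simp add: \<kappa>_def)
  qed
  define d where "d k l = real ((2 * k) choose l) * x ^ (2 * k - l) * (- 1) ^ l" for k l :: nat
  have Pexp: "P u * \<kappa> u = (\<Sum>k<K. \<Sum>l\<le>2 * k. w k * d k l * (u ^ l * \<kappa> u))" for u
  proof -
    have "(x - u) ^ (2 * k) = (\<Sum>l\<le>2 * k. d k l * u ^ l)" for k
      using binomial_ring[of "- u" x "2 * k"] by (simp add: d_def power_minus[of u] mult_ac)
    then show ?thesis by (simp add: P_def sum_distrib_left sum_distrib_right mult.assoc)
  qed
  have mi: "integrable N (\<lambda>u. P u * \<kappa> u)" "(\<integral>u. P u * \<kappa> u \<partial>N) = (\<Sum>k<K. \<Sum>l\<le>2 * k. w k * d k l * trunc_moment r N l)"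
    if "real_distribution N" for N
  proof -
    have i: "integrable N (\<lambda>u. u ^ l * \<kappa> u)" for l
      unfolding \<kappa>_def by (rule trunc_moment_integrable(1)[OF that R0(2)])
    show "integrable N (\<lambda>u. P u * \<kappa> u)" unfolding Pexp
      by (intro Bochner_Integration.integrable_sum integrable_mult_right i)
    show "(\<integral>u. P u * \<kappa> u \<partial>N) = (\<Sum>k<K. \<Sum>l\<le>2 * k. w k * d k l * trunc_moment r N l)"
      unfolding Pexp using i by (simp add: Bochner_Integration.integral_sum trunc_moment_def \<kappa>_def)
  qed
  have one: "\<bar>inner_mix r N x - c * (\<integral>u. P u * \<kappa> u \<partial>N)\<bar> \<le> c * T" if N: "real_distribution N" for N
  proof -
    interpret N: real_distribution N by (rule N)
    have i1: "integrable N (\<lambda>u. normal_density 0 s (x - u) * \<kappa> u)" unfolding \<kappa>_def by (rule mix_inner_mix(3)[OF N R])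
    have i2: "integrable N (\<lambda>u. normal_density 0 s (x - u) * \<kappa> u - c * (P u * \<kappa> u))"
      using i1 mi(1)[OF N] by simp
    have "inner_mix r N x - c * (\<integral>u. P u * \<kappa> u \<partial>N) = (\<integral>u. normal_density 0 s (x - u) * \<kappa> u - c * (P u * \<kappa> u) \<partial>N)"
      using i1 mi(1)[OF N] by (simp add: inner_mix_def \<kappa>_def)
    then show ?thesis
      using approx i2 by (auto intro!: order_trans[OF integral_abs_bound] N.integral_le_const)
  qed
  have two: "\<bar>(\<integral>u. P u * \<kappa> u \<partial>G) - (\<integral>u. P u * \<kappa> u \<partial>H)\<bar> \<le> \<epsilon> * exp ((1 + R)\<^sup>2 * M / 2)"
  proof -
    have \<epsilon>0: "\<epsilon> \<ge> 0" using m[of 0] by linarith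
    define y where "y = (1 + R)\<^sup>2 * M / 2"
    have "(\<integral>u. P u * \<kappa> u \<partial>G) - (\<integral>u. P u * \<kappa> u \<partial>H)
       = (\<Sum>k<K. \<Sum>l\<le>2 * k. w k * d k l * (trunc_moment r G l - trunc_moment r H l))"
      by (simp add: mi(2)[OF G] mi(2)[OF H] right_diff_distrib sum_subtractf)
    also have "\<bar>\<dots>\<bar> \<le> (\<Sum>k<K. \<Sum>l\<le>2 * k. \<bar>w k\<bar> * \<bar>d k l\<bar> * \<epsilon>)"
    proof (rule order_trans[OF sum_abs], rule sum_mono, rule order_trans[OF sum_abs], rule sum_mono)
      fix k l assume "k \<in> {..<K}" "l \<in> {..2 * k}"
      then have "l \<le> 2 * K" by auto
      from m[OF this] show "\<bar>w k * d k l * (trunc_moment r G l - trunc_moment r H l)\<bar> \<le> \<bar>w k\<bar> * \<bar>d k l\<bar> * \<epsilon>"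
        unfolding abs_mult by (intro mult_left_mono) auto
    qed
    also have "\<dots> \<le> (\<Sum>k<K. y ^ k / fact k * \<epsilon>)"
    proof (rule sum_mono)
      fix k assume "k \<in> {..<K}"
      \<comment> \<open>The absolute coefficients of (x - u)^(2k) are a binomial expansion with all
        signs positive. Summed over k against \<open>(M / 2) ^ k / fact k\<close> they give the last
        exponential in \<open>cover_error\<close>.\<close>
      have "(\<Sum>l\<le>2 * k. \<bar>d k l\<bar>) = (1 + \<bar>x\<bar>) ^ (2 * k)"
        using binomial_ring[of 1 "\<bar>x\<bar>" "2 * k"] by (simp add: d_def abs_mult power_abs)
      also have "\<dots> \<le> ((1 + R)\<^sup>2) ^ k" unfolding power_mult[symmetric] using R by (intro power_mono) auto
      finally have d: "(\<Sum>l\<le>2 * k. \<bar>d k l\<bar>) \<le> ((1 + R)\<^sup>2) ^ k" .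
      have wk: "\<bar>w k\<bar> \<le> (M / 2) ^ k / fact k"
      proof -
        have "\<bar>w k\<bar> = (1 / (2 * s\<^sup>2)) ^ k / fact k" by (simp add: w_def power_abs abs_divide flip: power_divide)
        also have "\<dots> \<le> (M / 2) ^ k / fact k"
          using inv_s2_le s0 by (intro divide_right_mono power_mono) auto
        finally show ?thesis .
      qed
      have "(\<Sum>l\<le>2 * k. \<bar>w k\<bar> * \<bar>d k l\<bar> * \<epsilon>) = \<bar>w k\<bar> * (\<Sum>l\<le>2 * k. \<bar>d k l\<bar>) * \<epsilon>"
        by (simp add: sum_distrib_left sum_distrib_right)
      also have "\<dots> \<le> ((M / 2) ^ k / fact k) * ((1 + R)\<^sup>2) ^ k * \<epsilon>"
        using d wk \<epsilon>0 M1 by (intro mult_right_mono mult_mono sum_nonneg) auto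
      also have "\<dots> = y ^ k / fact k * \<epsilon>" by (simp add: y_def power_mult_distrib power_divide mult_ac)
      finally show "(\<Sum>l\<le>2 * k. \<bar>w k\<bar> * \<bar>d k l\<bar> * \<epsilon>) \<le> y ^ k / fact k * \<epsilon>" .
    qed
    also have "\<dots> = (\<Sum>k<K. y ^ k / fact k) * \<epsilon>" by (simp add: sum_distrib_right)
    also have "\<dots> \<le> exp y * \<epsilon>"
    proof (rule mult_right_mono[OF _ \<epsilon>0])
      have "y \<ge> 0" using M1 by (simp add: y_def)
      then have "(\<Sum>k<K. y ^ k /\<^sub>R fact k) \<le> (\<Sum>k. y ^ k /\<^sub>R fact k)"
        using exp_converges[of y] by (intro sum_le_suminf) (auto simp: sums_iff)
      then show "(\<Sum>k<K. y ^ k / fact k) \<le> exp y"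
        using exp_converges[of y] by (simp add: sums_iff divide_inverse mult.commute)
    qed
    finally show ?thesis by (simp add: y_def mult.commute)
  qed
  have "\<bar>inner_mix r G x - inner_mix r H x\<bar> \<le> 2 * (c * T) + c * \<bar>(\<integral>u. P u * \<kappa> u \<partial>G) - (\<integral>u. P u * \<kappa> u \<partial>H)\<bar>"
  proof -
    have "\<bar>a - b\<bar> \<le> 2 * t + \<bar>a' - b'\<bar>" if "\<bar>a - a'\<bar> \<le> t" "\<bar>b - b'\<bar> \<le> t" for a b a' b' t :: real
      using that by (simp add: abs_real_def split: if_splits)
    from this[OF one[OF G] one[OF H]] show ?thesis using c by (simp add: abs_mult flip: right_diff_distrib)
  qed
  also have "\<dots> \<le> 2 * (M * T) + M * (\<epsilon> * exp ((1 + R)\<^sup>2 * M / 2))"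
  proof -
    have "B \<ge> 0" using M1 by (simp add: B_def)
    then have "T \<ge> 0" by (simp add: T_def)
    then show ?thesis using c two by (intro add_mono mult_left_mono mult_right_mono mult_mono) auto
  qed
  finally show ?thesis by (simp add: T_def B_def algebra_simps)
qed

lemma mix_close:
  assumes G: "real_distribution G" and H: "real_distribution H" and R: "\<bar>x\<bar> \<le> R" "R \<le> r"
    and m: "\<And>l. l \<le> 2 * K \<Longrightarrow> \<bar>trunc_moment r G l - trunc_moment r H l\<bar> \<le> \<epsilon>"
  shows "mix 0 G s x \<le> mix 0 H s x + cover_error M R r K \<epsilon>"
proof -
  have e: "M * exp (- (r - R)\<^sup>2 / (2 * M)) \<ge> 0" using M1 by simp
  have ic: "\<bar>inner_mix r G x - inner_mix r H x\<bar>
     \<le> M * (2 * (exp ((R + r)\<^sup>2 * M / 2) * ((R + r)\<^sup>2 * M / 2) ^ K / fact K) + \<epsilon> * exp ((1 + R)\<^sup>2 * M / 2))"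
    by (rule inner_mix_close[OF G H R m])
  show ?thesis
    using ic mix_inner_mix(1,2)[OF G R] mix_inner_mix(1,2)[OF H R] e
    unfolding cover_error_def distrib_left by linarith
qed

end

text \<open>Moments rounded down to a grid of mesh \<epsilon>. Restricting the function to
  \<open>{..2 * K}\<close> makes the classes elements of a finite dependent product, which can be
  counted.\<close>

definition moment_class :: "real \<Rightarrow> nat \<Rightarrow> real \<Rightarrow> real measure \<Rightarrow> nat \<Rightarrow> int" where
  "moment_class r K \<epsilon> G = (\<lambda>l\<in>{..2 * K}. \<lfloor>trunc_moment r G l / \<epsilon>\<rfloor>)"

lemma moment_class_eqD:
  assumes "moment_class r K \<epsilon> G = moment_class r K \<epsilon> H" "l \<le> 2 * K" "\<epsilon> > 0"
  shows "\<bar>trunc_moment r G l - trunc_moment r H l\<bar> \<le> \<epsilon>"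
proof -
  have "\<lfloor>trunc_moment r G l / \<epsilon>\<rfloor> = \<lfloor>trunc_moment r H l / \<epsilon>\<rfloor>"
    using fun_cong[OF assms(1), of l] assms(2) by (simp add: moment_class_def)
  then have "\<bar>trunc_moment r G l / \<epsilon> - trunc_moment r H l / \<epsilon>\<bar> \<le> 1" by linarith
  then have "\<bar>trunc_moment r G l - trunc_moment r H l\<bar> / \<epsilon> \<le> 1"
    using assms(3) by (simp add: abs_div_pos diff_divide_distrib)
  then show ?thesis using assms(3) by (simp add: field_simps)
qed

lemma moment_class_range:
  assumes r: "r \<ge> 1" and \<epsilon>: "0 < \<epsilon>" "\<epsilon> \<le> 1"
  shows "finite (moment_class r K \<epsilon> ` {G. real_distribution G})"
    and "real (card (moment_class r K \<epsilon> ` {G. real_distribution G})) \<le> (7 * r ^ (2 * K) / \<epsilon>) ^ (2 * K + 1)"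
proof -
  define X where "X = r ^ (2 * K) / \<epsilon>"
  have "1 * \<epsilon> \<le> r ^ (2 * K)" using r \<epsilon> one_le_power[OF r, of "2 * K"] by linarith
  then have X1: "X \<ge> 1" using \<epsilon> by (simp add: X_def)
  define Q where "Q = \<lceil>X\<rceil> + 1"
  define F where "F = PiE {..2 * K} (\<lambda>_. {-Q..Q})"
  have sub: "moment_class r K \<epsilon> ` {G. real_distribution G} \<subseteq> F"
  proof
    fix c assume "c \<in> moment_class r K \<epsilon> ` {G. real_distribution G}"
    then obtain G where G: "real_distribution G" and c: "c = moment_class r K \<epsilon> G" by auto
    have "\<lfloor>trunc_moment r G l / \<epsilon>\<rfloor> \<in> {-Q..Q}" if "l \<le> 2 * K" for l
    proof -
      have "\<bar>trunc_moment r G l\<bar> \<le> r ^ l" using trunc_moment_integrable(2)[OF G] r by auto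
      also have "\<dots> \<le> r ^ (2 * K)" using that r by (intro power_increasing) auto
      finally have "\<bar>trunc_moment r G l / \<epsilon>\<bar> \<le> X"
        unfolding X_def using \<epsilon> by (simp add: divide_right_mono)
      then have "- X \<le> trunc_moment r G l / \<epsilon>" "trunc_moment r G l / \<epsilon> \<le> X" unfolding abs_le_iff by linarith+
      then show ?thesis unfolding Q_def by (auto simp: le_floor_iff floor_le_iff) linarith+
    qed
    then show "c \<in> F" unfolding c F_def moment_class_def by auto
  qed
  have finF: "finite F" unfolding F_def by (intro finite_PiE) auto
  show "finite (moment_class r K \<epsilon> ` {G. real_distribution G})" by (rule finite_subset[OF sub finF])
  have "card F = card {-Q..Q} ^ (2 * K + 1)" unfolding F_def by (subst card_PiE) auto
  then have cF: "real (card F) = real (nat (2 * Q + 1)) ^ (2 * K + 1)" by (simp add: algebra_simps)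
  \<comment> \<open>Each rounded moment takes at most \<open>2 * Q + 1\<close> values, and
    \<open>2 * (X + 2) + 1 \<le> 7 * X\<close> because \<open>X \<ge> 1\<close>: the origin of the
    7.\<close>
  have Q: "0 \<le> Q" "of_int Q \<le> X + 2" using X1 unfolding Q_def by linarith+
  have "real (card (moment_class r K \<epsilon> ` {G. real_distribution G})) \<le> real (card F)"
    using card_mono[OF finF sub] by simp
  also have "\<dots> \<le> (7 * X) ^ (2 * K + 1)"
    unfolding cF using Q X1 by (intro power_mono) auto
  finally show "real (card (moment_class r K \<epsilon> ` {G. real_distribution G})) \<le> (7 * r ^ (2 * K) / \<epsilon>) ^ (2 * K + 1)"
    by (simp add: X_def)
qed

section \<open>A high-probability event for the estimator\<close>

lemma std_normal_exp_integral_le: "(\<integral>y. exp (c * \<bar>y\<bar>) \<partial>std_normal) \<le> sqrt 2 * exp (c\<^sup>2)"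
proof -
  have "(\<integral>y. exp (c * \<bar>y\<bar>) \<partial>std_normal) = (\<integral>y. exp (c * \<bar>y\<bar>) * normal_density 0 1 y \<partial>lborel)"
    unfolding std_normal_def by (subst integral_density) (auto simp: mult.commute)
  also have "\<dots> \<le> (\<integral>y. sqrt 2 * exp (c\<^sup>2 * 1\<^sup>2) * normal_density 0 (sqrt 2 * 1) y \<partial>lborel)"
  proof (rule integral_mono)
    show "integrable lborel (\<lambda>y. exp (c * \<bar>y\<bar>) * normal_density 0 1 y)"
      using std_normal_exp_integrable[of c] unfolding std_normal_def
      by (subst (asm) integrable_density) (auto simp: mult.commute)
    show "integrable lborel (\<lambda>y. sqrt 2 * exp (c\<^sup>2 * 1\<^sup>2) * normal_density 0 (sqrt 2 * 1) y)" by simp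
  qed (rule exp_abs_mult_normal_density_le, simp)
  also have "\<dots> = sqrt 2 * exp (c\<^sup>2)" by simp
  finally show ?thesis .
qed

context corr_model
begin

interpretation G0: real_distribution G0 by (rule G0)

interpretation model: prob_space "model n G0" by (rule prob_space_model)

abbreviation U :: "(nat \<Rightarrow> real) \<times> (nat \<Rightarrow> real) \<Rightarrow> nat \<Rightarrow> real" where
  "U \<omega> j \<equiv> observation n S \<omega> $ j"

text \<open>An exponential Markov bound with parameter 1 suffices, since R will be a multiple of log
  n. The two copies of \<open>exp M\<close> come from the bounded mean and from the
  variance.\<close>

lemma observation_tail:
  assumes j: "j < n"
  shows "{\<omega> \<in> space (model n G0). R < \<bar>U \<omega> j\<bar>} \<in> sets (model n G0)"
    and "measure (model n G0) {\<omega> \<in> space (model n G0). R < \<bar>U \<omega> j\<bar>} \<le> 2 * exp (2 * M) * exp (- R)"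
proof -
  interpret nl: noise_level M "\<sigma> j" by (rule noise_level_\<sigma>[OF j])
  note [measurable] = observation_measurable[OF j]
  define A where "A = {\<omega> \<in> space (model n G0). R < \<bar>U \<omega> j\<bar>}"
  show A: "{\<omega> \<in> space (model n G0). R < \<bar>U \<omega> j\<bar>} \<in> sets (model n G0)" by measurable
  have Am: "A \<in> sets ((\<Pi>\<^sub>M i\<in>{..<n}. G0) \<Otimes>\<^sub>M forms.\<mu>)"
    using A by (simp add: A_def model_eq)
  define c where "c = exp (M - R)"
  have iY: "integrable forms.\<mu> (\<lambda>z. exp (\<sigma> j * \<bar>forms.Y j z\<bar>))"
    using forms.Y_integral(2)[of "\<lambda>y. exp (\<sigma> j * \<bar>y\<bar>)" j] std_normal_exp_integrable j by simp
  have vY: "(\<integral>z. exp (\<sigma> j * \<bar>forms.Y j z\<bar>) \<partial>forms.\<mu>) \<le> 2 * exp M"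
  proof -
    have "(\<integral>z. exp (\<sigma> j * \<bar>forms.Y j z\<bar>) \<partial>forms.\<mu>) \<le> sqrt 2 * exp ((\<sigma> j)\<^sup>2)"
      using forms.Y_integral(1)[of "\<lambda>y. exp (\<sigma> j * \<bar>y\<bar>)" j] std_normal_exp_integral_le[of "\<sigma> j"] j by simp
    also have "\<dots> \<le> 2 * exp M" using nl.s2_upper sqrt2_less_2 by (intro mult_mono) auto
    finally show ?thesis .
  qed
  have AE: "AE \<beta> in \<Pi>\<^sub>M i\<in>{..<n}. G0. \<bar>\<beta> j\<bar> \<le> M"
    by (rule AE_PiM_component[where M = "\<lambda>_. G0" and P = "\<lambda>\<theta>. \<bar>\<theta>\<bar> \<le> M"])
       (use j G0.prob_space_axioms AE_G0 in auto)
  have "emeasure (model n G0) A = (\<integral>\<^sup>+\<omega>. indicator A \<omega> \<partial>model n G0)"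
    using A by (simp add: A_def)
  also have "\<dots> = (\<integral>\<^sup>+\<beta>. \<integral>\<^sup>+z. indicator A (\<beta>, z) \<partial>forms.\<mu> \<partial>(\<Pi>\<^sub>M i\<in>{..<n}. G0))"
    using Am unfolding model_eq by (subst forms.\<mu>.nn_integral_fst[symmetric]) auto
  also have "\<dots> \<le> (\<integral>\<^sup>+\<beta>. ennreal (c * (2 * exp M)) \<partial>(\<Pi>\<^sub>M i\<in>{..<n}. G0))"
  proof (rule nn_integral_mono_AE, use AE in eventually_elim)
    fix \<beta> :: "nat \<Rightarrow> real" assume b: "\<bar>\<beta> j\<bar> \<le> M"
    have "(\<integral>\<^sup>+z. indicator A (\<beta>, z) \<partial>forms.\<mu>) \<le> (\<integral>\<^sup>+z. ennreal (c * exp (\<sigma> j * \<bar>forms.Y j z\<bar>)) \<partial>forms.\<mu>)"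
    proof (rule nn_integral_mono)
      fix z
      show "indicator A (\<beta>, z) \<le> ennreal (c * exp (\<sigma> j * \<bar>forms.Y j z\<bar>))"
      proof (cases "(\<beta>, z) \<in> A")
        case True
        then have "R < \<bar>\<beta> j + \<sigma> j * forms.Y j z\<bar>" using observation_eq[OF j, of "(\<beta>, z)"] by (simp add: A_def)
        also have "\<dots> \<le> \<bar>\<beta> j\<bar> + \<sigma> j * \<bar>forms.Y j z\<bar>"
          using abs_triangle_ineq[of "\<beta> j" "\<sigma> j * forms.Y j z"] nl.s0 by (simp add: abs_mult)
        finally have "0 \<le> (M - R) + \<sigma> j * \<bar>forms.Y j z\<bar>" using b by linarith
        then have "1 \<le> exp ((M - R) + \<sigma> j * \<bar>forms.Y j z\<bar>)" by simp
        then have "1 \<le> c * exp (\<sigma> j * \<bar>forms.Y j z\<bar>)" unfolding c_def by (simp only: exp_add)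
        then show ?thesis using True by (simp add: ennreal_ge_1)
      qed simp
    qed
    also have "\<dots> = ennreal (\<integral>z. c * exp (\<sigma> j * \<bar>forms.Y j z\<bar>) \<partial>forms.\<mu>)"
      using iY by (intro nn_integral_eq_integral) (auto simp: c_def)
    also have "\<dots> \<le> ennreal (c * (2 * exp M))"
      using vY by (intro ennreal_leI) (simp add: c_def)
    finally show "(\<integral>\<^sup>+z. indicator A (\<beta>, z) \<partial>forms.\<mu>) \<le> ennreal (c * (2 * exp M))" .
  qed
  also have "\<dots> = ennreal (c * (2 * exp M))" by (simp add: prior.emeasure_space_1)
  finally have "measure (model n G0) A \<le> c * (2 * exp M)"
    by (simp add: model.emeasure_eq_measure c_def)
  also have "\<dots> = 2 * exp (2 * M) * exp (- R)" 
  proof -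
    have "exp (2 * M) = exp M * exp M" by (simp flip: exp_add)
    then show ?thesis by (simp add: c_def exp_diff exp_minus field_simps)
  qed
  finally show "measure (model n G0) {\<omega> \<in> space (model n G0). R < \<bar>U \<omega> j\<bar>} \<le> 2 * exp (2 * M) * exp (- R)"
    by (simp add: A_def)
qed

definition lik_prod :: "real \<Rightarrow> real measure \<Rightarrow> (nat \<Rightarrow> real) \<times> (nat \<Rightarrow> real) \<Rightarrow> real" where
  "lik_prod \<eta> H \<omega> = (\<Prod>j<n. lik_ratio \<eta> H G0 (\<sigma> j) (U \<omega> j) powr (1 / opn))"

abbreviation total_hell2 :: "real measure \<Rightarrow> real" where
  "total_hell2 H \<equiv> \<Sum>j<n. hell2 H G0 (\<sigma> j)"

lemma sqrt_const_nonneg: "0 \<le> noise_level.sqrt_const M"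
proof -
  interpret nl: noise_level M "\<sigma> 0" by (rule noise_level_\<sigma>) (use n1 in simp)
  show ?thesis unfolding nl.sqrt_const_def using M1 by simp
qed

text \<open>Markov's inequality at level exp(-1). Each coordinate contributes its Hellinger distance
  to the exponent divided by \<open>opn\<close>; this is where n becomes the effective sample
  size.\<close>

lemma lik_prod_large:
  assumes H: "real_distribution H" and \<eta>: "\<eta> > 0" and E: "E \<le> total_hell2 H"
  shows "{\<omega> \<in> space (model n G0). exp (- 1) \<le> lik_prod \<eta> H \<omega>} \<in> sets (model n G0)"
    and "measure (model n G0) {\<omega> \<in> space (model n G0). exp (- 1) \<le> lik_prod \<eta> H \<omega>}
      \<le> exp (1 - E / (2 * opn) + real n * sqrt \<eta> * noise_level.sqrt_const M)"
proof -
  define B where "B = sqrt ((noise_level.gauss_const M 0 + \<eta>) / \<eta>)"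
  define D where "D = (noise_level.gauss_const M 1 + noise_level.gauss_const M 2) / \<eta>"
  interpret n0: noise_level M "\<sigma> 0" by (rule noise_level_\<sigma>) (use n1 in simp)
  have B: "B > 0" using n0.gauss_const_pos[of 0] \<eta> by (simp add: B_def)
  have D: "D \<ge> 0" using n0.gauss_const_pos[of 1] n0.gauss_const_pos[of 2] \<eta> by (simp add: D_def)
  have sm: "smooth_bdd (1 / B) B (B * (D + 2 * D\<^sup>2)) (lik_ratio \<eta> H G0 (\<sigma> j))" if "j < n" for j
    unfolding B_def D_def by (rule noise_level.lik_ratio_smooth[OF noise_level_\<sigma>[OF that] H G0 \<eta>])
  have cB: "0 < 1 / B" "0 \<le> B * (D + 2 * D\<^sup>2)" "0 \<le> B" using B D by auto
  note hm = hoelder_model[where h = "\<lambda>j. lik_ratio \<eta> H G0 (\<sigma> j)", OF sm cB, folded lik_prod_def]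
  have i: "integrable (model n G0) (lik_prod \<eta> H)" by (rule hm(1))
  then have [measurable]: "lik_prod \<eta> H \<in> borel_measurable (model n G0)" by auto
  define A where "A = {\<omega> \<in> space (model n G0). exp (- 1) \<le> lik_prod \<eta> H \<omega>}"
  show A: "{\<omega> \<in> space (model n G0). exp (- 1) \<le> lik_prod \<eta> H \<omega>} \<in> sets (model n G0)" by measurable
  have lp0: "lik_prod \<eta> H \<omega> \<ge> 0" for \<omega> unfolding lik_prod_def by (intro prod_nonneg) auto
  have "exp (- 1) * measure (model n G0) A = (\<integral>\<omega>. exp (- 1) * indicator A \<omega> \<partial>model n G0)"
    using A by (simp add: A_def)
  also have "\<dots> \<le> (\<integral>\<omega>. lik_prod \<eta> H \<omega> \<partial>model n G0)"
  proof (rule integral_mono[OF _ i])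
    show "integrable (model n G0) (\<lambda>\<omega>. exp (- 1) * indicator A \<omega> :: real)"
      using A by (intro integrable_mult_right integrable_real_indicator) (auto simp: A_def model.emeasure_eq_measure)
  qed (use lp0 in \<open>auto simp: A_def indicator_def\<close>)
  also have "\<dots> \<le> (\<Prod>j<n. (\<integral>x. lik_ratio \<eta> H G0 (\<sigma> j) x * mix 0 G0 (\<sigma> j) x \<partial>lborel) powr (1 / opn))"
    by (rule hm(2))
  also have "\<dots> \<le> (\<Prod>j<n. exp ((- hell2 H G0 (\<sigma> j) / 2 + sqrt \<eta> * noise_level.sqrt_const M) / opn))"
  proof (intro prod_mono conjI)
    fix j assume "j \<in> {..<n}"
    then have j: "j < n" by simp
    interpret nl: noise_level M "\<sigma> j" by (rule noise_level_\<sigma>[OF j])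
    have "0 \<le> (\<integral>x. lik_ratio \<eta> H G0 (\<sigma> j) x * mix 0 G0 (\<sigma> j) x \<partial>lborel)"
      using nl.mix_0_pos[OF H] nl.mix_0_pos[OF G0] \<eta>
      by (intro integral_nonneg_AE AE_I2) (auto simp: lik_ratio_def less_imp_le add_nonneg_nonneg)
    then have "(\<integral>x. lik_ratio \<eta> H G0 (\<sigma> j) x * mix 0 G0 (\<sigma> j) x \<partial>lborel) powr (1 / opn)
       \<le> exp (- hell2 H G0 (\<sigma> j) / 2 + sqrt \<eta> * noise_level.sqrt_const M) powr (1 / opn)"
      using nl.lik_ratio_integral_le[OF H G0 AE_G0 \<eta>] opn_ge_1 by (intro powr_mono2) auto
    then show "(\<integral>x. lik_ratio \<eta> H G0 (\<sigma> j) x * mix 0 G0 (\<sigma> j) x \<partial>lborel) powr (1 / opn)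
       \<le> exp ((- hell2 H G0 (\<sigma> j) / 2 + sqrt \<eta> * noise_level.sqrt_const M) / opn)"
      by (simp add: powr_def)
  qed simp
  also have "\<dots> = exp ((- total_hell2 H / 2 + real n * (sqrt \<eta> * noise_level.sqrt_const M)) / opn)"
    by (simp add: exp_sum[symmetric] sum.distrib sum_divide_distrib[symmetric] sum_subtractf sum_negf)
  also have "\<dots> \<le> exp (- E / (2 * opn) + real n * sqrt \<eta> * noise_level.sqrt_const M)"
  proof -
    have "E / (2 * opn) \<le> total_hell2 H / (2 * opn)" using E opn_ge_1 by (intro divide_right_mono) auto
    moreover define q where "q = real n * (sqrt \<eta> * noise_level.sqrt_const M)"
    moreover have "q / opn \<le> q / 1"
      using opn_ge_1 \<eta> sqrt_const_nonneg by (intro divide_left_mono) (auto simp: q_def)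
    ultimately show ?thesis by (simp add: add_divide_distrib diff_divide_distrib mult_ac)
  qed
  finally have "exp (- 1) * measure (model n G0) A \<le> exp (- E / (2 * opn) + real n * sqrt \<eta> * noise_level.sqrt_const M)" .
  then have "exp 1 * (exp (- 1) * measure (model n G0) A) \<le> exp 1 * exp (- E / (2 * opn) + real n * sqrt \<eta> * noise_level.sqrt_const M)"
    by (intro mult_left_mono) auto
  then have "measure (model n G0) A \<le> exp (1 + (- E / (2 * opn) + real n * sqrt \<eta> * noise_level.sqrt_const M))"
    by (simp only: mult.assoc[symmetric] mult_exp_exp) simp
  then show "measure (model n G0) {\<omega> \<in> space (model n G0). exp (- 1) \<le> lik_prod \<eta> H \<omega>}
      \<le> exp (1 - E / (2 * opn) + real n * sqrt \<eta> * noise_level.sqrt_const M)"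
    by (simp add: A_def algebra_simps)
qed

lemma npmle_loglik:
  assumes "G \<in> npmle_set n \<sigma> (observation n S \<omega>)"
  shows "real_distribution G" "(\<Sum>j<n. ln (mix 0 G0 (\<sigma> j) (U \<omega> j))) \<le> (\<Sum>j<n. ln (mix 0 G (\<sigma> j) (U \<omega> j)))"
proof -
  show "real_distribution G" using assms by (simp add: npmle_set_def)
  have "composite_loglik n \<sigma> (observation n S \<omega>) G0 \<le> composite_loglik n \<sigma> (observation n S \<omega>) G"
    using assms G0 by (simp add: npmle_set_def)
  then show "(\<Sum>j<n. ln (mix 0 G0 (\<sigma> j) (U \<omega> j))) \<le> (\<Sum>j<n. ln (mix 0 G (\<sigma> j) (U \<omega> j)))"
    using n1 by (simp add: composite_loglik_def mixture_density_eq_mix divide_le_cancel)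
qed

text \<open>The log likelihood ratio of the estimator against the prior is nonnegative. Passing to H
  is covered by the offset \<eta> in the numerator, and the offset in the denominator costs at most
  \<eta> / \<rho> per coordinate, at most 1 in total.\<close>

lemma npmle_lik_prod_ge:
  assumes G: "G \<in> npmle_set n \<sigma> (observation n S \<omega>)" and H: "real_distribution H"
    and close: "\<And>j. j < n \<Longrightarrow> mix 0 G (\<sigma> j) (U \<omega> j) \<le> mix 0 H (\<sigma> j) (U \<omega> j) + \<eta>"
    and \<rho>: "\<rho> > 0" "\<And>j. j < n \<Longrightarrow> \<rho> \<le> mix 0 G0 (\<sigma> j) (U \<omega> j)"
    and \<eta>: "\<eta> > 0" "real n * \<eta> \<le> \<rho>"
  shows "exp (- 1) \<le> lik_prod \<eta> H \<omega>"
proof -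
  note Gd = npmle_loglik[OF G]
  define l where "l j = ln (lik_ratio \<eta> H G0 (\<sigma> j) (U \<omega> j))" for j
  have lj: "lik_ratio \<eta> H G0 (\<sigma> j) (U \<omega> j) > 0"
    "(ln (mix 0 G (\<sigma> j) (U \<omega> j)) - ln (mix 0 G0 (\<sigma> j) (U \<omega> j)) - \<eta> / \<rho>) / 2 \<le> l j" if j: "j < n" for j
  proof -
    interpret nl: noise_level M "\<sigma> j" by (rule noise_level_\<sigma>[OF j])
    define f g h where "f = mix 0 G0 (\<sigma> j) (U \<omega> j)" and "g = mix 0 G (\<sigma> j) (U \<omega> j)" and "h = mix 0 H (\<sigma> j) (U \<omega> j)"
    have p: "f > 0" "g > 0" "h > 0" using nl.mix_0_pos G0 Gd(1) H by (auto simp: f_def g_def h_def)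
    show "lik_ratio \<eta> H G0 (\<sigma> j) (U \<omega> j) > 0"
      using p \<eta> by (simp add: lik_ratio_def f_def h_def)
    have "l j = (ln (h + \<eta>) - ln (f + \<eta>)) / 2"
      using p \<eta> by (simp add: l_def lik_ratio_def f_def h_def ln_sqrt ln_div)
    moreover have "ln g \<le> ln (h + \<eta>)" using close[OF j] p by (simp add: g_def h_def)
    moreover have "ln (f + \<eta>) \<le> ln f + \<eta> / \<rho>"
    proof -
      have "ln (f + \<eta>) - ln f = ln (1 + \<eta> / f)"
        using p \<eta> ln_div[of "f + \<eta>" f] by (simp add: add_divide_distrib)
      also have "\<dots> \<le> \<eta> / f" using p \<eta> by (intro ln_add_one_self_le_self) auto
      also have "\<dots> \<le> \<eta> / \<rho>" using \<rho>(1) \<rho>(2)[OF j] \<eta> by (intro divide_left_mono) (auto simp: f_def)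
      finally show ?thesis by simp
    qed
    ultimately show "(ln (mix 0 G (\<sigma> j) (U \<omega> j)) - ln (mix 0 G0 (\<sigma> j) (U \<omega> j)) - \<eta> / \<rho>) / 2 \<le> l j"
      unfolding f_def[symmetric] g_def[symmetric] by argo
  qed
  have "(\<Sum>j<n. (ln (mix 0 G (\<sigma> j) (U \<omega> j)) - ln (mix 0 G0 (\<sigma> j) (U \<omega> j)) - \<eta> / \<rho>) / 2) \<le> (\<Sum>j<n. l j)"
    using lj(2) by (intro sum_mono) auto
  also have "(\<Sum>j<n. (ln (mix 0 G (\<sigma> j) (U \<omega> j)) - ln (mix 0 G0 (\<sigma> j) (U \<omega> j)) - \<eta> / \<rho>) / 2)
     = ((\<Sum>j<n. ln (mix 0 G (\<sigma> j) (U \<omega> j))) - (\<Sum>j<n. ln (mix 0 G0 (\<sigma> j) (U \<omega> j))) - real n * \<eta> / \<rho>) / 2"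
    by (simp add: sum_divide_distrib[symmetric] sum_subtractf)
  finally have fin: "((\<Sum>j<n. ln (mix 0 G (\<sigma> j) (U \<omega> j))) - (\<Sum>j<n. ln (mix 0 G0 (\<sigma> j) (U \<omega> j))) - real n * \<eta> / \<rho>) / 2
     \<le> (\<Sum>j<n. l j)" .
  have "- 1 \<le> d" if "(a - b - c) / 2 \<le> d" "b \<le> a" "c \<le> 1" for a b c d :: real
    using that by simp
  moreover have "real n * \<eta> / \<rho> \<le> 1" using \<eta> \<rho>(1) by simp
  ultimately have "- 1 \<le> (\<Sum>j<n. l j)" using fin Gd(2) by blast
  then have "- 1 / opn \<le> (\<Sum>j<n. l j) / opn" using opn_ge_1 by (intro divide_right_mono) auto
  moreover have "- 1 \<le> - 1 / opn" using opn_ge_1 by simp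
  ultimately have "exp (- 1) \<le> exp ((\<Sum>j<n. l j) / opn)" by simp
  also have "\<dots> = (\<Prod>j<n. exp (1 / opn * l j))" by (simp add: exp_sum[symmetric] sum_divide_distrib)
  also have "\<dots> = lik_prod \<eta> H \<omega>"
    unfolding lik_prod_def by (intro prod.cong) (auto simp: powr_def l_def dest: lj(1))
  finally show ?thesis .
qed

text \<open>The event is the complement of finitely many bad sets described without the estimator,
  so it is measurable by construction and serves every maximiser at once.\<close>

theorem npmle_event:
  assumes R: "0 \<le> R" "R \<le> r" and r: "1 \<le> r" and \<epsilon>: "0 < \<epsilon>" "\<epsilon> \<le> 1" and \<eta>: "\<eta> > 0" "real n * \<eta> \<le> \<rho>"
    and ce: "cover_error M R r K \<epsilon> \<le> \<eta>"
    and \<rho>: "\<And>j x. j < n \<Longrightarrow> \<bar>x\<bar> \<le> R \<Longrightarrow> \<rho> \<le> mix 0 G0 (\<sigma> j) x"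
  obtains A where "A \<in> sets (model n G0)"
    and "measure (model n G0) A \<ge> 1 - (real n * (2 * exp (2 * M) * exp (- R)) +
        (7 * r ^ (2 * K) / \<epsilon>) ^ (2 * K + 1) * exp (1 - E / (2 * opn) + real n * sqrt \<eta> * noise_level.sqrt_const M))"
    and "\<And>\<omega> G. \<omega> \<in> A \<Longrightarrow> G \<in> npmle_set n \<sigma> (observation n S \<omega>) \<Longrightarrow>
        (\<forall>j<n. \<bar>U \<omega> j\<bar> \<le> R) \<and> total_hell2 G < E"
proof -
  have "0 < real n * \<eta>" using n1 \<eta>(1) by simp
  then have \<rho>0: "\<rho> > 0" using \<eta>(2) by linarith
  define Bad where "Bad = {G. real_distribution G \<and> E \<le> total_hell2 G}"
  define CB where "CB = moment_class r K \<epsilon> ` Bad"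
  \<comment> \<open>Representatives are taken among the bad distributions themselves, so
    \<open>lik_prod_large\<close> applies to them with the full distance \<open>E\<close>; no
    continuity of the Hellinger distance within a class has to be established.\<close>
  define rep where "rep c = (SOME G. G \<in> Bad \<and> moment_class r K \<epsilon> G = c)" for c
  have rep: "rep c \<in> Bad" "moment_class r K \<epsilon> (rep c) = c" if "c \<in> CB" for c
  proof -
    have "\<exists>G. G \<in> Bad \<and> moment_class r K \<epsilon> G = c" using that by (auto simp: CB_def)
    from someI_ex[OF this] show "rep c \<in> Bad" "moment_class r K \<epsilon> (rep c) = c" by (auto simp: rep_def)
  qed
  have sub: "CB \<subseteq> moment_class r K \<epsilon> ` {G. real_distribution G}" by (auto simp: CB_def Bad_def)
  note mc = moment_class_range[OF r \<epsilon>, of K]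
  have fin: "finite CB" by (rule finite_subset[OF sub mc(1)])
  have cardCB: "real (card CB) \<le> (7 * r ^ (2 * K) / \<epsilon>) ^ (2 * K + 1)"
    using card_mono[OF mc(1) sub] mc(2) by linarith
  define T where "T j = {\<omega> \<in> space (model n G0). R < \<bar>U \<omega> j\<bar>}" for j
  define ev where "ev c = {\<omega> \<in> space (model n G0). exp (- 1) \<le> lik_prod \<eta> (rep c) \<omega>}" for c
  define pb where "pb = exp (1 - E / (2 * opn) + real n * sqrt \<eta> * noise_level.sqrt_const M)"
  have Ts: "T j \<in> sets (model n G0)" "measure (model n G0) (T j) \<le> 2 * exp (2 * M) * exp (- R)" if "j < n" for j
    unfolding T_def by (rule observation_tail[OF that])+
  have evs: "ev c \<in> sets (model n G0)" "measure (model n G0) (ev c) \<le> pb" if "c \<in> CB" for c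
    unfolding ev_def pb_def using rep(1)[OF that] by (auto intro!: lik_prod_large \<eta>(1) simp: Bad_def)
  define X where "X = (\<Union>j\<in>{..<n}. T j) \<union> (\<Union>c\<in>CB. ev c)"
  have X1: "(\<Union>j\<in>{..<n}. T j) \<in> sets (model n G0)" "(\<Union>c\<in>CB. ev c) \<in> sets (model n G0)"
    using Ts evs fin by auto
  have mX: "measure (model n G0) X \<le> real n * (2 * exp (2 * M) * exp (- R)) + real (card CB) * pb"
  proof -
    have "measure (model n G0) X \<le> measure (model n G0) (\<Union>j\<in>{..<n}. T j) + measure (model n G0) (\<Union>c\<in>CB. ev c)"
      unfolding X_def by (rule measure_Un_le[OF X1])
    also have "measure (model n G0) (\<Union>j\<in>{..<n}. T j) \<le> (\<Sum>j\<in>{..<n}. measure (model n G0) (T j))"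
      using Ts by (intro measure_UNION_le) auto
    also have "\<dots> \<le> real (card {..<n}) * (2 * exp (2 * M) * exp (- R))"
      using Ts by (intro sum_bounded_above) auto
    also have "measure (model n G0) (\<Union>c\<in>CB. ev c) \<le> (\<Sum>c\<in>CB. measure (model n G0) (ev c))"
      using evs fin by (intro measure_UNION_le) auto
    also have "\<dots> \<le> real (card CB) * pb" using evs by (intro sum_bounded_above) auto
    finally show ?thesis by simp
  qed
  show thesis
  proof (rule that[of "space (model n G0) - X"])
    have Xs: "X \<in> sets (model n G0)" using X1 by (simp add: X_def)
    then show "space (model n G0) - X \<in> sets (model n G0)" by auto
    have "real (card CB) * pb \<le> (7 * r ^ (2 * K) / \<epsilon>) ^ (2 * K + 1) * pb"
      using cardCB by (intro mult_right_mono) (auto simp: pb_def)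
    then show "measure (model n G0) (space (model n G0) - X) \<ge> 1 - (real n * (2 * exp (2 * M) * exp (- R)) +
        (7 * r ^ (2 * K) / \<epsilon>) ^ (2 * K + 1) * exp (1 - E / (2 * opn) + real n * sqrt \<eta> * noise_level.sqrt_const M))"
      using model.prob_compl[OF Xs] mX by (simp add: pb_def)
    fix \<omega> G assume \<omega>: "\<omega> \<in> space (model n G0) - X" and G: "G \<in> npmle_set n \<sigma> (observation n S \<omega>)"
    have UR: "\<bar>U \<omega> j\<bar> \<le> R" if "j < n" for j
      using \<omega> that by (auto simp: X_def T_def not_less)
    have "total_hell2 G < E"
    proof (rule ccontr)
      assume "\<not> total_hell2 G < E"
      then have GB: "G \<in> Bad" using npmle_loglik(1)[OF G] by (simp add: Bad_def)
      define c where "c = moment_class r K \<epsilon> G"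
      have c: "c \<in> CB" using GB by (simp add: c_def CB_def)
      have H: "real_distribution (rep c)" using rep(1)[OF c] by (simp add: Bad_def)
      have "exp (- 1) \<le> lik_prod \<eta> (rep c) \<omega>"
      proof (rule npmle_lik_prod_ge[OF G H _ \<rho>0 _ \<eta>])
        fix j assume j: "j < n"
        show "\<rho> \<le> mix 0 G0 (\<sigma> j) (U \<omega> j)" by (rule \<rho>[OF j UR[OF j]])
        have "mix 0 G (\<sigma> j) (U \<omega> j) \<le> mix 0 (rep c) (\<sigma> j) (U \<omega> j) + cover_error M R r K \<epsilon>"
        proof (rule noise_level.mix_close[OF noise_level_\<sigma>[OF j] npmle_loglik(1)[OF G] H UR[OF j] R(2)])
          fix l assume "l \<le> 2 * K"
          then show "\<bar>trunc_moment r G l - trunc_moment r (rep c) l\<bar> \<le> \<epsilon>"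
            using moment_class_eqD[of r K \<epsilon> G "rep c" l] rep(2)[OF c] \<epsilon>(1) by (simp add: c_def)
        qed
        then show "mix 0 G (\<sigma> j) (U \<omega> j) \<le> mix 0 (rep c) (\<sigma> j) (U \<omega> j) + \<eta>" using ce by linarith
      qed
      then have "\<omega> \<in> ev c" using \<omega> by (simp add: ev_def)
      then show False using \<omega> c by (auto simp: X_def)
    qed
    then show "(\<forall>j<n. \<bar>U \<omega> j\<bar> \<le> R) \<and> total_hell2 G < E" using UR by auto
  qed
qed

end

section \<open>Regret of the estimator\<close>

context noise_level
begin

lemma mix_0_ge_mass:
  assumes G: "real_distribution G" and w: "0 \<le> w" "w \<le> measure G {-r..r}" and r: "r \<ge> 0"
  shows "w * (exp (- ((\<bar>x\<bar> + r)\<^sup>2 * M / 2)) / sqrt (2 * pi * M)) \<le> mix 0 G s x"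
proof -
  interpret G: real_distribution G by fact
  define k where "k = exp (- ((\<bar>x\<bar> + r)\<^sup>2 * M / 2)) / sqrt (2 * pi * M)"
  have k0: "k \<ge> 0" using M1 by (simp add: k_def)
  have pw: "k * indicator {-r..r} u \<le> gauss_deriv 0 s (x - u)" for u
  proof (cases "u \<in> {-r..r}")
    case True
    then have "\<bar>x - u\<bar> \<le> \<bar>x\<bar> + r" by (auto simp: abs_real_def split: if_splits)
    then have "(x - u)\<^sup>2 \<le> (\<bar>x\<bar> + r)\<^sup>2" using power_mono[of "\<bar>x - u\<bar>" "\<bar>x\<bar> + r" 2] by simp
    then have "(x - u)\<^sup>2 * (1 / s\<^sup>2) \<le> (\<bar>x\<bar> + r)\<^sup>2 * M" using inv_s2_le by (intro mult_mono) auto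
    then have "exp (- ((\<bar>x\<bar> + r)\<^sup>2 * M / 2)) \<le> exp (- (x - u)\<^sup>2 / (2 * s\<^sup>2))" by simp
    moreover have "sqrt (2 * pi * s\<^sup>2) \<le> sqrt (2 * pi * M)" using s2_upper by simp
    ultimately have "k \<le> exp (- (x - u)\<^sup>2 / (2 * s\<^sup>2)) / sqrt (2 * pi * s\<^sup>2)"
      unfolding k_def using s0 by (intro frac_le) auto
    then show ?thesis using True by (simp add: normal_density_def)
  qed simp
  have "w * k \<le> k * measure G {-r..r}" using mult_right_mono[OF w(2) k0] by (simp add: mult.commute)
  also have "\<dots> = (\<integral>u. k * indicator {-r..r} u \<partial>G)" by simp
  also have "\<dots> \<le> mix 0 G s x" unfolding mix_def
    by (intro integral_mono mix_integrand_integrable[OF G] pw)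
       (auto intro!: integrable_real_indicator simp: G.emeasure_eq_measure)
  finally show ?thesis by (simp add: k_def)
qed

text \<open>The score of a Gaussian mixture is at most of the order of the root of the log of the
  inverse density, whatever the mixing measure; Tweedie's formula transfers this to the posterior
  mean.\<close>

lemma abs_posterior_mean_le:
  assumes G: "real_distribution G" and e: "e \<ge> 0" "exp (- e) \<le> mix 0 G s x"
  shows "\<bar>posterior_mean G s x\<bar> \<le> \<bar>x\<bar> + M * (M * sqrt (4 * M * (e + gauss_const 1)) + 1)"
proof -
  \<comment> \<open>Chosen so that the truncation error in \<open>abs_mix_1_le\<close> falls below
    \<open>exp (- e)\<close>, hence below the density; the summand \<open>gauss_const 1\<close> in
    the exponent cancels the prefactor.\<close>
  define T where "T = sqrt (4 * M * (e + gauss_const 1))"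
  define f where "f = mix 0 G s x"
  have f: "f > 0" unfolding f_def by (rule mix_0_pos[OF G])
  have g0: "gauss_const 1 > 0" by (rule gauss_const_pos)
  have T: "T \<ge> 0" using M1 e g0 by (simp add: T_def)
  have T2: "T\<^sup>2 / (4 * M) = e + gauss_const 1" using M1 e g0 by (simp add: T_def)
  have "gauss_const 1 \<le> exp (gauss_const 1)" using exp_ge_add_one_self[of "gauss_const 1"] by linarith
  then have "gauss_const 1 * exp (- T\<^sup>2 / (4 * M)) \<le> exp (gauss_const 1) * exp (- (e + gauss_const 1))"
    using T2 by (intro mult_mono) auto
  also have "\<dots> = exp (- e)" by (simp add: mult_exp_exp)
  finally have "\<bar>mix 1 G s x\<bar> \<le> M * T * f + f"
    using abs_mix_1_le[OF G T, of x] e(2) unfolding f_def by linarith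
  then have "\<bar>mix 1 G s x\<bar> / f \<le> (M * T + 1) * f / f"
    using f by (intro divide_right_mono) (auto simp: distrib_right)
  then have q: "\<bar>mix 1 G s x / f\<bar> \<le> M * T + 1" using f by simp
  have "\<bar>posterior_mean G s x\<bar> \<le> \<bar>x\<bar> + s\<^sup>2 * \<bar>mix 1 G s x / f\<bar>"
    unfolding posterior_mean_eq(1)[OF G] f_def[symmetric]
    by (rule order_trans[OF abs_triangle_ineq]) (simp only: abs_mult abs_power2 order_refl)
  also have "s\<^sup>2 * \<bar>mix 1 G s x / f\<bar> \<le> M * (M * T + 1)"
    using q s2_upper M1 by (intro mult_mono) auto
  finally show ?thesis by (simp add: T_def)
qed

end

lemma le_exp_self: "(x::real) \<le> exp x"
  using exp_ge_add_one_self[of x] by linarith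

lemma sqrt_le_exp:
  fixes x :: real
  assumes "1 \<le> x"
  shows "sqrt x \<le> exp x"
proof -
  have "x \<le> x\<^sup>2" using assms power_increasing[of 1 2 x] by simp
  then have "sqrt x \<le> x" using assms by (intro real_le_lsqrt) auto
  then show ?thesis using le_exp_self[of x] by linarith
qed

section \<open>The parameters as functions of log n\<close>

locale corr_bound = corr_model +
  fixes D :: real
  assumes D0: "D > 0" and L1: "ln (real n) \<ge> 1"
begin

abbreviation L :: real where "L \<equiv> ln (real n)"

text \<open>
  Every parameter \<open>v\<dots>\<close> below is a fixed function of \<open>L\<close> whose coefficient \<open>c\<dots>\<close> depends on \<open>M\<close> and \<open>D\<close>
  only; hence so does \<open>rate_const\<close>, which can therefore be chosen before \<open>n\<close> and the model.
\<close>

definition "cR = D + 2"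
definition "c\<rho> = (cR + M)\<^sup>2 * M / 2 + 2 * pi * M"
text \<open>Beyond c\<rho>, the 2 pays for a factor n even after a square root is taken, and the
  last summand pays for \<open>sqrt_const\<close>.\<close>

definition "c\<eta> = c\<rho> + 2 + 2 * noise_level.sqrt_const M"
definition "cr = cR + 2 * M * (c\<eta> + 6 * M) + 1"
definition "cB = (cR + cr)\<^sup>2 * M / 2"
text \<open>The factor \<open>exp 3\<close> places the Taylor order far beyond the size of the
  argument, where the factorial already dominates the power.\<close>

definition "cK = exp 3 * cB + c\<eta> + 6 * M"
definition "c\<epsilon> = c\<eta> + 6 * M + (1 + cR)\<^sup>2 * M / 2"
definition "cN = (2 * cK + 3) * (7 + 2 * (cK + 1) * cr + c\<epsilon>)"
definition "cE = cN + 2 + D"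
definition "cm = c\<rho> + 2 * M + 2 * pi * M + (1 + cr)\<^sup>2 * M / 2"
definition "c\<Lambda> = 1 + M + M\<^sup>2 * sqrt (4 * M * (cm + noise_level.gauss_const M 1))"
definition "cT = 4 * M * (c\<rho> + 2 * noise_level.gauss_const M 1) + 1"
definition "cQ = 16 * (sqrt 2 * M * exp (1 + M)) * M * exp (c\<rho> / 2 + 1 / 2)"
definition "cI = 2 * M * cT + cQ"
definition "cF = 32 * M\<^sup>2 * cI\<^sup>2 + 64 * M ^ 4 * c\<Lambda>\<^sup>2 * (1 + cR)\<^sup>2 + 4 * c\<Lambda>\<^sup>2 * regret_const M"
definition "rate_const = cF * (2 * cE + 1)"

text \<open>Orders of magnitude: observations lie within a multiple of L, where Gaussian densities
  are at least exp(-c L^2); this dictates the sizes of \<rho>, \<eta> and \<epsilon> and a Taylor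
  order of L^2. The logarithm of the number of classes is then of order L^5, and \<open>vE\<close>
  exceeds it after division by \<open>2 * opn\<close>.\<close>

definition "vR = cR * L"
definition "v\<rho> = exp (- (c\<rho> * L\<^sup>2))"
definition "v\<eta> = exp (- (c\<eta> * L\<^sup>2))"
definition "vr = cr * L"
definition "vK = nat \<lceil>cK * L\<^sup>2\<rceil>"
definition "v\<epsilon> = exp (- (c\<epsilon> * L\<^sup>2))"
definition "vE = 2 * opn * (cE * L ^ 5)"

lemma L_powers: "1 \<le> L" "L \<le> L\<^sup>2" "1 \<le> L\<^sup>2" "0 < L"
proof -
  show "1 \<le> L" "0 < L" using L1 by auto
  then show "L \<le> L\<^sup>2" "1 \<le> L\<^sup>2"
    using power_increasing[of 1 2 L] one_le_power[of L 2] by auto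
qed

lemma L_pow_mono: "j \<le> k \<Longrightarrow> L ^ j \<le> L ^ k"
  using L1 by (intro power_increasing) auto

lemma exp_L: "exp L = real n"
  using n1 by simp

lemma n_pos: "0 < n" using n1 by simp

lemma noise_level_0: "noise_level M (\<sigma> 0)"
  by (rule noise_level_\<sigma>[OF n_pos])

lemma gc_pos: "noise_level.gauss_const M k > 0"
  by (rule noise_level.gauss_const_pos[OF noise_level_0])

lemma const_bounds:
  "cR \<ge> 2" "c\<rho> \<ge> 0" "c\<eta> \<ge> 2" "cr \<ge> cR" "cr \<ge> 1" "cB \<ge> 0" "cK \<ge> 0" "c\<epsilon> \<ge> 0" "cN \<ge> 0" "cE \<ge> 0" "cm \<ge> 0"
  "c\<Lambda> \<ge> M" "c\<Lambda> \<ge> 0" "cT \<ge> 1" "cQ > 0" "cI \<ge> 0" "cF \<ge> 0" "rate_const \<ge> 0"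
proof -
  note sc = sqrt_const_nonneg
  show R: "cR \<ge> 2" using D0 by (simp add: cR_def)
  show \<rho>: "c\<rho> \<ge> 0" using M1 by (simp add: c\<rho>_def)
  show \<eta>: "c\<eta> \<ge> 2" using \<rho> sc by (simp add: c\<eta>_def)
  show r: "cr \<ge> cR" using M1 \<eta> by (simp add: cr_def)
  then show "cr \<ge> 1" using R by simp
  show B: "cB \<ge> 0" using M1 by (simp add: cB_def)
  show K: "cK \<ge> 0" using B \<eta> M1 by (simp add: cK_def)
  show \<epsilon>: "c\<epsilon> \<ge> 0" using \<eta> M1 by (simp add: c\<epsilon>_def)
  show N: "cN \<ge> 0" using K r R \<epsilon> by (simp add: cN_def)
  show E: "cE \<ge> 0" using N D0 by (simp add: cE_def)
  show m: "cm \<ge> 0" using \<rho> M1 by (simp add: cm_def)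
  have "0 \<le> M\<^sup>2 * sqrt (4 * M * (cm + noise_level.gauss_const M 1))"
    using M1 m gc_pos[of 1] by simp
  then show \<Lambda>: "c\<Lambda> \<ge> M" unfolding c\<Lambda>_def by linarith
  then show "c\<Lambda> \<ge> 0" using M1 by simp
  show T: "cT \<ge> 1" using M1 \<rho> gc_pos[of 1] by (simp add: cT_def)
  show Q: "cQ > 0" using M1 by (simp add: cQ_def)
  show "cI \<ge> 0" using M1 T Q by (simp add: cI_def)
  show F: "cF \<ge> 0" using M1 by (simp add: cF_def regret_const_def)
  show "rate_const \<ge> 0" using F E by (simp add: rate_const_def)
qed

lemma prior_density_ge:
  assumes j: "j < n" and x: "\<bar>x\<bar> \<le> vR"
  shows "v\<rho> \<le> mix 0 G0 (\<sigma> j) x"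
proof -
  interpret nl: noise_level M "\<sigma> j" by (rule noise_level_\<sigma>[OF j])
  interpret G0: real_distribution G0 by (rule G0)
  have "AE \<theta> in G0. \<theta> \<in> {-M..M}" using AE_G0 by eventually_elim (auto simp: abs_le_iff)
  then have "measure G0 {-M..M} = 1" by (subst G0.prob_eq_1) auto
  then have 1: "1 * (exp (- ((\<bar>x\<bar> + M)\<^sup>2 * M / 2)) / sqrt (2 * pi * M)) \<le> mix 0 G0 (\<sigma> j) x"
    using M1 by (intro nl.mix_0_ge_mass[OF G0]) auto
  have "\<bar>x\<bar> + M * 1 \<le> cR * L + M * L"
    using x M1 L_powers by (intro add_mono mult_left_mono) (auto simp: vR_def)
  then have "(\<bar>x\<bar> + M)\<^sup>2 \<le> ((cR + M) * L)\<^sup>2" using M1 by (intro power_mono) (auto simp: distrib_right)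
  then have "(\<bar>x\<bar> + M)\<^sup>2 * M / 2 \<le> (cR + M)\<^sup>2 * M / 2 * L\<^sup>2"
    using M1 by (simp add: power_mult_distrib mult_ac)
  moreover have "2 * pi * M * 1 \<le> 2 * pi * M * L\<^sup>2" using M1 L_powers by (intro mult_left_mono) auto
  ultimately have "(\<bar>x\<bar> + M)\<^sup>2 * M / 2 + 2 * pi * M \<le> c\<rho> * L\<^sup>2"
    unfolding c\<rho>_def distrib_right by linarith
  then have "v\<rho> \<le> exp (- ((\<bar>x\<bar> + M)\<^sup>2 * M / 2) - 2 * pi * M)" by (simp add: v\<rho>_def)
  also have "\<dots> = exp (- ((\<bar>x\<bar> + M)\<^sup>2 * M / 2)) / exp (2 * pi * M)" by (rule exp_diff)
  also have "\<dots> \<le> exp (- ((\<bar>x\<bar> + M)\<^sup>2 * M / 2)) / sqrt (2 * pi * M)"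
  proof (intro divide_left_mono)
    show "sqrt (2 * pi * M) \<le> exp (2 * pi * M)" using M1 by (intro sqrt_le_exp one_le_two_pi_mult) simp
  qed (use M1 in auto)
  finally show ?thesis using 1 by simp
qed

lemma eta_bounds: "real n * v\<eta> \<le> v\<rho>" "real n * sqrt v\<eta> * noise_level.sqrt_const M \<le> 1" "v\<eta> \<le> v\<rho>"
proof -
  have e: "c\<eta> * L\<^sup>2 = c\<rho> * L\<^sup>2 + 2 * L\<^sup>2 + 2 * noise_level.sqrt_const M * L\<^sup>2" by (simp add: c\<eta>_def distrib_right)
  have s: "0 \<le> noise_level.sqrt_const M * L\<^sup>2" "0 \<le> c\<rho> * L\<^sup>2" using sqrt_const_nonneg const_bounds by auto
  have "real n * v\<eta> = exp L * exp (- (c\<eta> * L\<^sup>2))" by (simp only: v\<eta>_def exp_L)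
  also have "\<dots> = exp (L - c\<eta> * L\<^sup>2)" unfolding mult_exp_exp by simp
  also have "\<dots> \<le> v\<rho>" unfolding v\<rho>_def using e s L_powers by simp
  finally show 1: "real n * v\<eta> \<le> v\<rho>" .
  have "1 * v\<eta> \<le> real n * v\<eta>" using n1 by (intro mult_right_mono) (auto simp: v\<eta>_def)
  then show "v\<eta> \<le> v\<rho>" using 1 by simp
  have "sqrt v\<eta> = exp (- (c\<eta> * L\<^sup>2) / 2)"
  proof (rule real_sqrt_unique)
    show "(exp (- (c\<eta> * L\<^sup>2) / 2))\<^sup>2 = v\<eta>" by (simp add: v\<eta>_def flip: exp_double)
  qed simp
  then have "real n * sqrt v\<eta> * noise_level.sqrt_const M \<le> exp L * exp (- (c\<eta> * L\<^sup>2) / 2) * exp (noise_level.sqrt_const M)"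
    by (simp only: exp_L) (intro mult_left_mono le_exp_self, simp)
  also have "\<dots> = exp (L - c\<eta> * L\<^sup>2 / 2 + noise_level.sqrt_const M)" by (simp add: mult_exp_exp)
  also have "\<dots> \<le> exp 0"
  proof -
    have "noise_level.sqrt_const M * 1 \<le> noise_level.sqrt_const M * L\<^sup>2"
      using sqrt_const_nonneg L_powers by (intro mult_left_mono) auto
    then have "L - c\<eta> * L\<^sup>2 / 2 + noise_level.sqrt_const M \<le> 0" using e s L_powers by linarith
    then show ?thesis by simp
  qed
  finally show "real n * sqrt v\<eta> * noise_level.sqrt_const M \<le> 1" by simp
qed

text \<open>Each of the three parts of \<open>cover_error\<close> is kept below a third of
  \<open>v\<eta>\<close>. The resulting factor \<open>6 * M\<close> is bounded by its exponential,
  which is why \<open>6 * M\<close> recurs in the constants.\<close>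

lemma tail_small: "M * (2 * exp (- (vr - vR)\<^sup>2 / (2 * M))) \<le> v\<eta> / 3"
proof -
  define d where "d = 2 * M * (c\<eta> + 6 * M) + 1"
  have d1: "d \<ge> 1" using M1 const_bounds by (simp add: d_def)
  have "(c\<eta> + 6 * M) * L\<^sup>2 \<le> d / (2 * M) * L\<^sup>2"
    using M1 by (intro mult_right_mono) (auto simp: d_def field_simps)
  also have "\<dots> \<le> d\<^sup>2 / (2 * M) * L\<^sup>2"
    using M1 d1 power_increasing[of 1 2 d] by (intro mult_right_mono divide_right_mono) auto
  also have "\<dots> = (vr - vR)\<^sup>2 / (2 * M)" by (simp add: vr_def vR_def cr_def d_def power_mult_distrib flip: left_diff_distrib)
  finally have "exp (- (vr - vR)\<^sup>2 / (2 * M)) \<le> exp (- ((c\<eta> + 6 * M) * L\<^sup>2))" by simp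
  then have "6 * M * exp (- (vr - vR)\<^sup>2 / (2 * M)) \<le> exp (6 * M) * exp (- ((c\<eta> + 6 * M) * L\<^sup>2))"
    using le_exp_self[of "6 * M"] M1 by (intro mult_mono) auto
  also have "\<dots> \<le> v\<eta>"
    unfolding v\<eta>_def mult_exp_exp using M1 L_powers mult_left_mono[of 1 "L\<^sup>2" "6 * M"] by (simp add: distrib_right)
  finally show ?thesis by simp
qed

lemma cover_error_small: "cover_error M vR vr vK v\<epsilon> \<le> v\<eta>"
proof -
  have second: "M * (2 * (exp ((vR + vr)\<^sup>2 * M / 2) * ((vR + vr)\<^sup>2 * M / 2) ^ vK / fact vK)) \<le> v\<eta> / 3"
  proof -
    define B where "B = (vR + vr)\<^sup>2 * M / 2"
    have B: "B = cB * L\<^sup>2" by (simp add: B_def cB_def vR_def vr_def power_mult_distrib flip: distrib_right)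
    have B0: "B \<ge> 0" using const_bounds by (simp add: B)
    define k where "k = real vK"
    have k: "cK * L\<^sup>2 \<le> k" unfolding k_def vK_def using const_bounds by (simp add: real_nat_ceiling_ge)
    have cKL: "cK * L\<^sup>2 = exp 3 * B + (c\<eta> + 6 * M) * L\<^sup>2" by (simp add: cK_def B distrib_right)
    have pos: "0 \<le> (c\<eta> + 6 * M) * L\<^sup>2" using const_bounds M1 by simp
    have e3B: "exp 3 * B \<le> k" "(c\<eta> + 6 * M) * L\<^sup>2 \<le> k"
    proof -
      have "0 \<le> exp 3 * B" using B0 by simp
      then show "exp 3 * B \<le> k" "(c\<eta> + 6 * M) * L\<^sup>2 \<le> k" using k pos unfolding cKL by linarith+
    qed
    have "1 * B \<le> exp 3 * B" using B0 by (intro mult_right_mono) auto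
    then have Bk: "B \<le> k" using e3B by simp
    \<comment> \<open>From k^k at most k! e^k and \<open>exp 3 * B \<le> k\<close>. One of the two
      factors exp(-k) pays for \<open>exp B\<close>, the other remains as the error.\<close>
    have "B ^ vK / fact vK \<le> exp (- 2 * k)"
    proof -
      have "(exp 3 * B) ^ vK \<le> k ^ vK" using e3B B0 by (intro power_mono) auto
      also have "\<dots> \<le> fact vK * exp k" using power_le_fact_mult_exp[of k vK] by (simp add: k_def)
      finally have "exp (k * 3) * B ^ vK \<le> fact vK * exp k"
        by (simp add: power_mult_distrib k_def exp_of_nat_mult)
      then have "B ^ vK / fact vK \<le> exp k / exp (k * 3)" by (simp add: field_simps)
      then show ?thesis by (simp flip: exp_diff)
    qed
    then have "exp B * (B ^ vK / fact vK) \<le> exp k * exp (- 2 * k)"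
      using Bk B0 by (intro mult_mono) auto
    also have "\<dots> = exp (- k)" by (simp add: mult_exp_exp)
    also have "\<dots> \<le> exp (- ((c\<eta> + 6 * M) * L\<^sup>2))" using e3B by simp
    finally have "6 * M * (exp B * (B ^ vK / fact vK)) \<le> exp (6 * M) * exp (- ((c\<eta> + 6 * M) * L\<^sup>2))"
      using le_exp_self[of "6 * M"] M1 B0 by (intro mult_mono) auto
    also have "\<dots> \<le> v\<eta>"
      unfolding v\<eta>_def mult_exp_exp using M1 L_powers mult_left_mono[of 1 "L\<^sup>2" "6 * M"] by (simp add: distrib_right)
    finally show ?thesis by (simp add: B_def)
  qed
  have third: "M * (v\<epsilon> * exp ((1 + vR)\<^sup>2 * M / 2)) \<le> v\<eta> / 3"
  proof -
    have "1 + vR \<le> (1 + cR) * L" using L_powers by (simp add: vR_def distrib_right)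
    then have "(1 + vR)\<^sup>2 \<le> ((1 + cR) * L)\<^sup>2" using const_bounds L_powers by (intro power_mono) (auto simp: vR_def)
    then have q: "(1 + vR)\<^sup>2 * M / 2 \<le> (1 + cR)\<^sup>2 * M / 2 * L\<^sup>2" using M1 by (simp add: power_mult_distrib mult_ac)
    have "3 * M * (v\<epsilon> * exp ((1 + vR)\<^sup>2 * M / 2)) \<le> exp (6 * M) * (v\<epsilon> * exp ((1 + cR)\<^sup>2 * M / 2 * L\<^sup>2))"
      using q M1 le_exp_self[of "6 * M"] by (intro mult_mono) (auto simp: v\<epsilon>_def)
    also have "\<dots> = exp (6 * M - (c\<eta> + 6 * M) * L\<^sup>2)"
      unfolding v\<epsilon>_def mult_exp_exp by (simp add: c\<epsilon>_def algebra_simps)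
    also have "\<dots> \<le> v\<eta>"
      unfolding v\<eta>_def using M1 L_powers mult_left_mono[of 1 "L\<^sup>2" "6 * M"] by (simp add: distrib_right)
    finally show ?thesis by simp
  qed
  show ?thesis unfolding cover_error_def distrib_left using tail_small second third by linarith
qed

text \<open>The base has logarithm of order L^3, Taylor order L^2 times radius L, after the generous
  bound of the radius by its exponential. The number of moments contributes another L^2.\<close>

lemma count_bound: "(7 * vr ^ (2 * vK) / v\<epsilon>) ^ (2 * vK + 1) \<le> exp (cN * L ^ 5)"
proof -
  define k where "k = real vK"
  have "k \<le> cK * L\<^sup>2 + 1"
    unfolding k_def vK_def using const_bounds of_int_ceiling_le_add_one[of "cK * L\<^sup>2"] by (simp add: of_nat_nat)
  then have k: "k \<le> (cK + 1) * L\<^sup>2" "0 \<le> k" using L_powers(3) by (simp add: distrib_right, simp add: k_def)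
  have vr1: "vr \<ge> 0" using const_bounds L_powers by (simp add: vr_def)
  have "vr ^ (2 * vK) \<le> exp vr ^ (2 * vK)" using vr1 le_exp_self by (intro power_mono) auto
  also have "\<dots> = exp (2 * k * vr)" by (simp add: k_def flip: exp_of_nat_mult)
  finally have "7 * vr ^ (2 * vK) \<le> exp 7 * exp (2 * k * vr)"
    using le_exp_self[of 7] vr1 by (intro mult_mono) auto
  then have "7 * vr ^ (2 * vK) / v\<epsilon> \<le> exp 7 * exp (2 * k * vr) / v\<epsilon>"
    by (intro divide_right_mono) (auto simp: v\<epsilon>_def)
  also have "\<dots> = exp (7 + 2 * k * vr + c\<epsilon> * L\<^sup>2)"
    by (simp add: v\<epsilon>_def exp_minus exp_add divide_inverse)
  also have "\<dots> \<le> exp ((7 + 2 * (cK + 1) * cr + c\<epsilon>) * L ^ 3)"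
  proof -
    have "2 * k * vr \<le> 2 * ((cK + 1) * L\<^sup>2) * vr" using k vr1 by (intro mult_right_mono mult_left_mono) auto
    also have "\<dots> = 2 * (cK + 1) * cr * L ^ 3" by (simp add: vr_def power2_eq_square power3_eq_cube)
    finally have "2 * k * vr \<le> 2 * (cK + 1) * cr * L ^ 3" .
    moreover have "c\<epsilon> * L\<^sup>2 \<le> c\<epsilon> * L ^ 3" using const_bounds L_pow_mono[of 2 3] by (intro mult_left_mono) auto
    moreover have "7 \<le> 7 * L ^ 3" using L_pow_mono[of 0 3] by simp
    ultimately show ?thesis by (simp add: distrib_right)
  qed
  finally have "(7 * vr ^ (2 * vK) / v\<epsilon>) ^ (2 * vK + 1) \<le> exp ((7 + 2 * (cK + 1) * cr + c\<epsilon>) * L ^ 3) ^ (2 * vK + 1)"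
    using vr1 by (intro power_mono) (auto simp: v\<epsilon>_def)
  also have "\<dots> = exp ((2 * k + 1) * ((7 + 2 * (cK + 1) * cr + c\<epsilon>) * L ^ 3))"
    unfolding exp_of_nat_mult[symmetric] by (simp add: k_def add.commute)
  also have "\<dots> \<le> exp (cN * L ^ 5)"
  proof -
    have "2 * k + 1 \<le> (2 * cK + 3) * L\<^sup>2" using k L_powers by (simp add: algebra_simps)
    then have "(2 * k + 1) * ((7 + 2 * (cK + 1) * cr + c\<epsilon>) * L ^ 3) \<le> ((2 * cK + 3) * L\<^sup>2) * ((7 + 2 * (cK + 1) * cr + c\<epsilon>) * L ^ 3)"
      using const_bounds L_powers by (intro mult_right_mono) auto
    also have "\<dots> = cN * (L\<^sup>2 * L ^ 3)" by (simp add: cN_def mult_ac)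
    also have "L\<^sup>2 * L ^ 3 = L ^ 5" by (simp flip: power_add)
    finally show ?thesis by simp
  qed
  finally show ?thesis .
qed

text \<open>Mass \<rho> / (2 M) within radius \<open>vr\<close> keeps the density at x above exp(-c
  y^2) with y = L (1 + \<bar>x\<bar>), and the root in \<open>abs_posterior_mean_le\<close> turns
  this into linear growth in y.\<close>

lemma posterior_mean_growth:
  assumes G: "real_distribution G" and mass: "v\<rho> / (2 * M) \<le> measure G {-vr..vr}" and j: "j < n"
  shows "\<bar>posterior_mean G (\<sigma> j) x\<bar> \<le> c\<Lambda> * L * (1 + \<bar>x\<bar>)"
proof -
  interpret nl: noise_level M "\<sigma> j" by (rule noise_level_\<sigma>[OF j])
  define y where "y = L * (1 + \<bar>x\<bar>)"
  have y: "L \<le> y" "\<bar>x\<bar> \<le> y" "1 \<le> y" "0 \<le> y"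
  proof -
    show "L \<le> y" using L_powers by (simp add: y_def)
    then show "1 \<le> y" "0 \<le> y" using L_powers by auto
    have "1 * (1 + \<bar>x\<bar>) \<le> y" unfolding y_def using L_powers by (intro mult_right_mono) auto
    then show "\<bar>x\<bar> \<le> y" by simp
  qed
  have vr0: "vr \<ge> 0" using const_bounds L_powers by (simp add: vr_def)
  define e where "e = cm * y\<^sup>2"
  have e0: "e \<ge> 0" using const_bounds by (simp add: e_def)
  have "v\<rho> / (2 * M) * (exp (- ((\<bar>x\<bar> + vr)\<^sup>2 * M / 2)) / sqrt (2 * pi * M)) \<le> mix 0 G (\<sigma> j) x"
    using M1 by (intro nl.mix_0_ge_mass[OF G _ mass vr0]) (auto simp: v\<rho>_def)
  moreover have "exp (- e) \<le> v\<rho> / (2 * M) * (exp (- ((\<bar>x\<bar> + vr)\<^sup>2 * M / 2)) / sqrt (2 * pi * M))"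
  proof -
    have s: "sqrt (2 * pi * M) \<le> exp (2 * pi * M)" using M1 by (intro sqrt_le_exp one_le_two_pi_mult) simp
    have "\<bar>x\<bar> + vr \<le> 1 * y + cr * y"
      using y const_bounds by (intro add_mono) (auto simp: vr_def intro!: mult_left_mono)
    then have "(\<bar>x\<bar> + vr)\<^sup>2 \<le> ((1 + cr) * y)\<^sup>2" using vr0 by (intro power_mono) (auto simp: distrib_right)
    then have 1: "(\<bar>x\<bar> + vr)\<^sup>2 * M / 2 \<le> (1 + cr)\<^sup>2 * M / 2 * y\<^sup>2" using M1 by (simp add: power_mult_distrib mult_ac)
    have y2: "1 \<le> y\<^sup>2" "L\<^sup>2 \<le> y\<^sup>2" using y L_powers by (auto intro: power_mono one_le_power)
    have 2: "c\<rho> * L\<^sup>2 \<le> c\<rho> * y\<^sup>2" "2 * M * 1 \<le> 2 * M * y\<^sup>2" "2 * pi * M * 1 \<le> 2 * pi * M * y\<^sup>2"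
      using y2 const_bounds M1 by (auto intro!: mult_left_mono)
    have "exp (- e) \<le> exp (- (c\<rho> * L\<^sup>2) - 2 * M - ((\<bar>x\<bar> + vr)\<^sup>2 * M / 2) - 2 * pi * M)"
      unfolding exp_le_cancel_iff e_def cm_def distrib_right using 1 2 by linarith
    also have "\<dots> = v\<rho> / exp (2 * M) * (exp (- ((\<bar>x\<bar> + vr)\<^sup>2 * M / 2)) / exp (2 * pi * M))"
    proof -
      have "exp (- a - b - c - d) = exp (- a) / exp b * (exp (- c) / exp d)" for a b c d :: real
        by (simp add: exp_diff exp_minus divide_inverse)
      then show ?thesis unfolding v\<rho>_def .
    qed
    also have "\<dots> \<le> v\<rho> / (2 * M) * (exp (- ((\<bar>x\<bar> + vr)\<^sup>2 * M / 2)) / sqrt (2 * pi * M))"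
      using s M1 le_exp_self[of "2 * M"] by (intro mult_mono divide_left_mono) (auto simp: v\<rho>_def)
    finally show ?thesis .
  qed
  ultimately have "exp (- e) \<le> mix 0 G (\<sigma> j) x" by linarith
  from nl.abs_posterior_mean_le[OF G e0 this]
  have "\<bar>posterior_mean G (\<sigma> j) x\<bar> \<le> \<bar>x\<bar> + M * (M * sqrt (4 * M * (e + noise_level.gauss_const M 1)) + 1)" .
  also have "\<dots> \<le> y + M * (M * (sqrt (4 * M * (cm + noise_level.gauss_const M 1)) * y) + y)"
  proof -
    have "1 \<le> y\<^sup>2" using y by (simp add: one_le_power)
    then have "e + noise_level.gauss_const M 1 * 1 \<le> cm * y\<^sup>2 + noise_level.gauss_const M 1 * y\<^sup>2"
      unfolding e_def using gc_pos[of 1] by (intro add_left_mono mult_left_mono) auto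
    then have "4 * M * (e + noise_level.gauss_const M 1) \<le> 4 * M * (cm + noise_level.gauss_const M 1) * y\<^sup>2"
      using M1 by (simp add: distrib_right)
    then have "sqrt (4 * M * (e + noise_level.gauss_const M 1)) \<le> sqrt (4 * M * (cm + noise_level.gauss_const M 1) * y\<^sup>2)"
      by (rule real_sqrt_le_mono)
    also have "\<dots> = sqrt (4 * M * (cm + noise_level.gauss_const M 1)) * y" using y by (simp add: real_sqrt_mult)
    finally show ?thesis using M1 y by (intro add_mono mult_left_mono) auto
  qed
  also have "\<dots> = c\<Lambda> * y" by (simp add: c\<Lambda>_def algebra_simps power2_eq_square)
  finally show ?thesis by (simp add: y_def mult.assoc)
qed

end

section \<open>From the likelihood event to the regret\<close>

context corr_bound
begin

text \<open>Having at least the likelihood of the prior, the estimator must match the prior density,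
  hence \<rho>, at one observation at least. Mass beyond \<open>vr\<close> accounts for at most half
  of that.\<close>

lemma npmle_mass:
  assumes G: "G \<in> npmle_set n \<sigma> (observation n S \<omega>)" and U: "\<And>j. j < n \<Longrightarrow> \<bar>U \<omega> j\<bar> \<le> vR"
  shows "v\<rho> / (2 * M) \<le> measure G {-vr..vr}"
proof -
  note Gd = npmle_loglik[OF G]
  interpret G: real_distribution G by (rule Gd(1))
  have "\<exists>j<n. ln (mix 0 G0 (\<sigma> j) (U \<omega> j)) \<le> ln (mix 0 G (\<sigma> j) (U \<omega> j))"
  proof (rule ccontr)
    assume "\<not> ?thesis"
    then have "(\<Sum>j<n. ln (mix 0 G (\<sigma> j) (U \<omega> j))) < (\<Sum>j<n. ln (mix 0 G0 (\<sigma> j) (U \<omega> j)))"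
      using n_pos by (intro sum_strict_mono) (auto simp: not_le)
    with Gd(2) show False by simp
  qed
  then obtain j where j: "j < n" and le: "ln (mix 0 G0 (\<sigma> j) (U \<omega> j)) \<le> ln (mix 0 G (\<sigma> j) (U \<omega> j))" by blast
  interpret nl: noise_level M "\<sigma> j" by (rule noise_level_\<sigma>[OF j])
  have R: "\<bar>U \<omega> j\<bar> \<le> vR" "vR \<le> vr"
    using U[OF j] const_bounds L_powers by (auto simp: vR_def vr_def intro: mult_right_mono)
  have "v\<rho> \<le> mix 0 G0 (\<sigma> j) (U \<omega> j)" by (rule prior_density_ge[OF j R(1)])
  also have "\<dots> \<le> mix 0 G (\<sigma> j) (U \<omega> j)" using le nl.mix_0_pos[OF G0] nl.mix_0_pos[OF Gd(1)] by simp
  also have "\<dots> \<le> nl.inner_mix vr G (U \<omega> j) + M * exp (- (vr - vR)\<^sup>2 / (2 * M))"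
    using nl.mix_inner_mix(2)[OF Gd(1) R] by simp
  also have "M * exp (- (vr - vR)\<^sup>2 / (2 * M)) \<le> v\<rho> / 2"
  proof -
    have "0 \<le> v\<eta>" by (simp add: v\<eta>_def)
    then show ?thesis using tail_small eta_bounds(3) by linarith
  qed
  also have "nl.inner_mix vr G (U \<omega> j) \<le> M * measure G {-vr..vr}"
  proof -
    have "nl.inner_mix vr G (U \<omega> j) \<le> (\<integral>u. M * indicator {-vr..vr} u \<partial>G)"
      unfolding nl.inner_mix_def
    proof (rule integral_mono[OF nl.mix_inner_mix(3)[OF Gd(1) R]])
      show "integrable G (\<lambda>u. M * indicator {-vr..vr} u)"
        by (intro integrable_mult_right integrable_real_indicator) (auto simp: G.emeasure_eq_measure)
      show "normal_density 0 (\<sigma> j) (U \<omega> j - u) * indicator {-vr..vr} u \<le> M * indicator {-vr..vr} u" for u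
        using nl.normal_density_le_tail[of 0 "U \<omega> j - u"] by (intro mult_right_mono) auto
    qed
    then show ?thesis by simp
  qed
  finally show ?thesis using M1 by (simp add: field_simps)
qed

text \<open>With about L^2 integrations by parts the K-th roots of 1 / sqrt \<rho> and of sqrt n are
  constants. The squared factorial in \<open>gauss_const K\<close> leaves a root of order K^2, that
  is L^4, and the final square gives L^8.\<close>

lemma interpolation:
  assumes G: "real_distribution G" and j: "j < n"
  shows "noise_level.wnorm2 (\<sigma> j) G G0 v\<rho> 1 \<le> cI\<^sup>2 * L ^ 8 * (2 * hell2 G G0 (\<sigma> j) + 1 / real n)"
proof -
  interpret nl: noise_level M "\<sigma> j" by (rule noise_level_\<sigma>[OF j])
  define K where "K = nat \<lceil>L\<^sup>2\<rceil>"
  define k where "k = real K"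
  have k: "L\<^sup>2 \<le> k" "k \<le> L\<^sup>2 + 1"
    unfolding k_def K_def using of_int_ceiling_le_add_one[of "L\<^sup>2"] by (auto simp: real_nat_ceiling_ge of_nat_nat)
  have k2: "k \<le> 2 * L\<^sup>2" "1 \<le> k" "L \<le> k" using k L_powers by linarith+
  have K1: "K \<ge> 1" using k2(2) by (simp add: k_def)
  define T where "T = cT * L"
  have T0: "T \<ge> 0" using const_bounds L_powers by (simp add: T_def)
  define g1 where "g1 = noise_level.gauss_const M 1"
  have g1: "g1 > 0" unfolding g1_def by (rule gc_pos)
  have v\<rho>0: "v\<rho> > 0" by (simp add: v\<rho>_def)
  have cond: "2 * nl.gauss_const 1 * exp (- T\<^sup>2 / (4 * M)) \<le> M * T * v\<rho>"
  proof -
    have "4 * M * (c\<rho> + 2 * g1) \<le> cT" by (simp add: cT_def g1_def)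
    also have "\<dots> \<le> cT\<^sup>2" using const_bounds power_increasing[of 1 2 cT] by simp
    finally have "4 * M * (c\<rho> + 2 * g1) * L\<^sup>2 \<le> cT\<^sup>2 * L\<^sup>2" by (rule mult_right_mono) simp
    then have "(c\<rho> + 2 * g1) * L\<^sup>2 \<le> T\<^sup>2 / (4 * M)" using M1 by (simp add: T_def power_mult_distrib field_simps)
    moreover have "2 * g1 * 1 \<le> 2 * g1 * L\<^sup>2" using g1 L_powers by (intro mult_left_mono) auto
    ultimately have "c\<rho> * L\<^sup>2 + 2 * g1 \<le> T\<^sup>2 / (4 * M)" by (simp add: distrib_right)
    then have "exp (- T\<^sup>2 / (4 * M)) \<le> exp (- (2 * g1)) * v\<rho>"
      unfolding v\<rho>_def mult_exp_exp by simp
    then have "2 * g1 * exp (- T\<^sup>2 / (4 * M)) \<le> exp (2 * g1) * (exp (- (2 * g1)) * v\<rho>)"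
      using le_exp_self[of "2 * g1"] g1 by (intro mult_mono) auto
    also have "\<dots> = 1 * v\<rho>" by (simp add: mult.assoc[symmetric] mult_exp_exp)
    also have "\<dots> \<le> M * T * v\<rho>"
    proof (rule mult_right_mono)
      have "1 * (1 * 1) \<le> M * (cT * L)" using M1 const_bounds L_powers by (intro mult_mono) auto
      then show "1 \<le> M * T" by (simp add: T_def)
    qed (use v\<rho>0 in simp)
    finally show ?thesis by (simp add: g1_def)
  qed
  \<comment> \<open>The margin n^(-1/2): its square 1/n is below the target rate, and its K-th root
    stays bounded.\<close>
  define \<tau> where "\<tau> = exp (- L / 2)"
  have \<tau>2: "\<tau>\<^sup>2 = 1 / real n"
  proof -
    have "\<tau>\<^sup>2 = exp (2 * (- L / 2))" unfolding \<tau>_def by (rule exp_double[symmetric])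
    also have "\<dots> = 1 / real n" by (simp add: exp_minus exp_L inverse_eq_divide)
    finally show ?thesis .
  qed
  define C0 where "C0 = sqrt 2 * M * exp (1 + M)"
  have C0: "C0 \<ge> 1"
  proof -
    have "1 * 1 * 1 \<le> sqrt 2 * M * exp (1 + M)" using M1 by (intro mult_mono) auto
    then show ?thesis by (simp add: C0_def)
  qed
  define Q where "Q = cQ * L ^ 4"
  have Q: "Q > 0" using const_bounds L_powers by (simp add: Q_def)
  have QK: "2 * nl.gauss_const K / sqrt v\<rho> \<le> Q ^ K * \<tau>"
  proof -
    define F where "F = (2 * L\<^sup>2) ^ K"
    have "fact K \<le> real (K ^ K)" by (metis fact_le_power of_nat_fact of_nat_le_iff order_refl of_nat_id)
    also have "\<dots> = k ^ K" by (simp add: k_def)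
    also have "\<dots> \<le> F" unfolding F_def using k2 by (intro power_mono) auto
    finally have fK: "fact K \<le> F" .
    have sq: "sqrt v\<rho> = exp (- (c\<rho> * L\<^sup>2) / 2)"
    proof (rule real_sqrt_unique)
      show "(exp (- (c\<rho> * L\<^sup>2) / 2))\<^sup>2 = v\<rho>" by (simp add: v\<rho>_def flip: exp_double)
    qed simp
    have inv: "1 / exp (- z / 2) = exp (z / 2)" for z :: real
      by (simp add: divide_eq_eq mult_exp_exp)
    have "1 / sqrt v\<rho> = exp (c\<rho> * L\<^sup>2 / 2)" unfolding sq by (rule inv)
    also have "\<dots> \<le> exp (k * (c\<rho> / 2))" using mult_left_mono[OF k(1) const_bounds(2)] by (simp add: mult.commute)
    also have "\<dots> = exp (c\<rho> / 2) ^ K" by (simp only: k_def exp_of_nat_mult)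
    finally have r1: "1 / sqrt v\<rho> \<le> exp (c\<rho> / 2) ^ K" .
    have "1 / \<tau> = exp (L / 2)" unfolding \<tau>_def by (rule inv)
    also have "\<dots> \<le> exp (k * (1 / 2))" using k2 by simp
    also have "\<dots> = exp (1 / 2) ^ K" by (simp only: k_def exp_of_nat_mult)
    finally have r2: "1 / \<tau> \<le> exp (1 / 2) ^ K" .
    \<comment> \<open>Every factor is brought to the form of a K-th power, so that the base can be
      read off as \<open>Q\<close>.\<close>
    have "2 * C0 \<le> (2 * C0) ^ K" using C0 K1 power_increasing[of 1 K "2 * C0"] by simp
    then have "2 * C0 * (2 * M) ^ K * (fact K)\<^sup>2 * (1 / sqrt v\<rho>) * (1 / \<tau>)
      \<le> (2 * C0) ^ K * (2 * M) ^ K * F\<^sup>2 * exp (c\<rho> / 2) ^ K * exp (1 / 2) ^ K"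
      using fK r1 r2 C0 M1 v\<rho>0 by (intro mult_mono power_mono) (auto simp: \<tau>_def)
    also have "\<dots> = Q ^ K"
    proof -
      have "(2 * C0) * (2 * M) * (2 * L\<^sup>2)\<^sup>2 * exp (c\<rho> / 2) * exp (1 / 2) = Q"
        by (simp add: Q_def cQ_def C0_def exp_add power_mult_distrib flip: power_mult)
      then have "Q ^ K = ((2 * C0) * (2 * M) * (2 * L\<^sup>2)\<^sup>2 * exp (c\<rho> / 2) * exp (1 / 2)) ^ K" by simp
      also have "\<dots> = (2 * C0) ^ K * (2 * M) ^ K * F\<^sup>2 * exp (c\<rho> / 2) ^ K * exp (1 / 2) ^ K"
      proof -
        have "F\<^sup>2 = ((2 * L\<^sup>2)\<^sup>2) ^ K" unfolding F_def by (simp only: power_mult[symmetric] mult.commute)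
        then show ?thesis by (simp only: power_mult_distrib)
      qed
      finally show ?thesis by simp
    qed
    finally have fin: "2 * nl.gauss_const K / sqrt v\<rho> * (1 / \<tau>) \<le> Q ^ K"
      by (simp add: nl.gauss_const_def C0_def mult_ac)
    have "x \<le> b * t" if "x * (1 / t) \<le> b" "0 < t" for x b t :: real
      using that by (simp add: divide_le_eq)
    from this[OF fin] show ?thesis by (simp add: \<tau>_def)
  qed
  have h0: "0 \<le> hell2 G G0 (\<sigma> j)" by (simp add: hell2_def)
  have "nl.wnorm2 G G0 v\<rho> 1 \<le> (real K * (M * T) + Q)\<^sup>2 * (2 * hell2 G G0 (\<sigma> j) + \<tau>\<^sup>2)"
    by (rule nl.wnorm2_1_le[OF G G0 v\<rho>0 T0 cond K1 Q _ QK]) (simp add: \<tau>_def)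
  also have "\<dots> \<le> (cI * L ^ 4)\<^sup>2 * (2 * hell2 G G0 (\<sigma> j) + \<tau>\<^sup>2)"
  proof (intro mult_right_mono power_mono)
    have "real K * (M * T) \<le> 2 * L\<^sup>2 * (M * T)" using k2 M1 T0 by (intro mult_right_mono) (auto simp: k_def)
    also have "\<dots> = 2 * M * cT * L ^ 3" by (simp add: T_def power2_eq_square power3_eq_cube)
    also have "\<dots> \<le> 2 * M * cT * L ^ 4" using M1 const_bounds L_pow_mono[of 3 4] by (intro mult_left_mono) auto
    finally show "real K * (M * T) + Q \<le> cI * L ^ 4" by (simp add: cI_def Q_def distrib_right)
  qed (use M1 T0 Q h0 in auto)
  also have "\<dots> = cI\<^sup>2 * L ^ 8 * (2 * hell2 G G0 (\<sigma> j) + 1 / real n)"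
    by (simp add: \<tau>2 power_mult_distrib flip: power_mult)
  finally show ?thesis .
qed

lemma bayes_risk_excess:
  assumes G: "real_distribution G" and mass: "v\<rho> / (2 * M) \<le> measure G {-vr..vr}" and j: "j < n"
  shows "0 \<le> bayes_risk G G0 (\<sigma> j) - bayes_risk G0 G0 (\<sigma> j)"
    and "bayes_risk G G0 (\<sigma> j) - bayes_risk G0 G0 (\<sigma> j) \<le> cF * L ^ 8 * (hell2 G G0 (\<sigma> j) + 1 / real n)"
proof -
  interpret nl: noise_level M "\<sigma> j" by (rule noise_level_\<sigma>[OF j])
  note growth = posterior_mean_growth[OF G mass j]
  show "0 \<le> bayes_risk G G0 (\<sigma> j) - bayes_risk G0 G0 (\<sigma> j)"
    by (rule nl.bayes_risk_diff_nonneg[OF G0 AE_G0 G growth])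
  have v\<rho>0: "v\<rho> > 0" by (simp add: v\<rho>_def)
  have vR0: "vR \<ge> 0" using const_bounds L_powers by (simp add: vR_def)
  define h where "h = hell2 G G0 (\<sigma> j)"
  have h0: "h \<ge> 0" by (simp add: h_def hell2_def)
  have "M * 1 \<le> c\<Lambda> * L" using const_bounds M1 L_powers by (intro mult_mono) auto
  then have \<Lambda>: "M \<le> c\<Lambda> * L" by simp
  have dens: "mix 0 G (\<sigma> j) x + mix 0 G0 (\<sigma> j) x \<ge> v\<rho>" if "\<bar>x\<bar> \<le> vR" for x
    using prior_density_ge[OF j that] nl.mix_0_pos[OF G, of x] by linarith
  have "bayes_risk G G0 (\<sigma> j) - bayes_risk G0 G0 (\<sigma> j) \<le> 16 * M\<^sup>2 * nl.wnorm2 G G0 v\<rho> 1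
    + 64 * M ^ 4 * (c\<Lambda> * L)\<^sup>2 * (1 + vR)\<^sup>2 * h + 4 * (c\<Lambda> * L)\<^sup>2 * regret_const M * exp (- vR)"
    unfolding h_def by (rule nl.bayes_risk_diff_le[OF G0 AE_G0 G growth \<Lambda> vR0 v\<rho>0 dens])
  also have "\<dots> \<le> 16 * M\<^sup>2 * (cI\<^sup>2 * L ^ 8 * (2 * (h + 1 / real n)))
    + 64 * M ^ 4 * c\<Lambda>\<^sup>2 * (1 + cR)\<^sup>2 * L ^ 8 * (h + 1 / real n) + 4 * c\<Lambda>\<^sup>2 * regret_const M * L ^ 8 * (h + 1 / real n)"
  proof (intro add_mono)
    have "2 * h + q \<le> 2 * (h + q)" if "0 \<le> q" for q :: real using that by simp
    from this[of "1 / real n"] have "cI\<^sup>2 * L ^ 8 * (2 * h + 1 / real n) \<le> cI\<^sup>2 * L ^ 8 * (2 * (h + 1 / real n))"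
      using L_powers by (intro mult_left_mono) auto
    then have "nl.wnorm2 G G0 v\<rho> 1 \<le> cI\<^sup>2 * L ^ 8 * (2 * (h + 1 / real n))"
      using interpolation[OF G j] unfolding h_def by linarith
    then show "16 * M\<^sup>2 * nl.wnorm2 G G0 v\<rho> 1 \<le> 16 * M\<^sup>2 * (cI\<^sup>2 * L ^ 8 * (2 * (h + 1 / real n)))"
      by (intro mult_left_mono) auto
    have "1 + vR \<le> (1 + cR) * L" using L_powers by (simp add: vR_def distrib_right)
    then have "(1 + vR)\<^sup>2 \<le> ((1 + cR) * L)\<^sup>2" using vR0 by (intro power_mono) auto
    then have "64 * M ^ 4 * (c\<Lambda> * L)\<^sup>2 * (1 + vR)\<^sup>2 * h \<le> 64 * M ^ 4 * (c\<Lambda> * L)\<^sup>2 * ((1 + cR) * L)\<^sup>2 * (h + 1 / real n)"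
      using h0 by (intro mult_mono) auto
    also have "\<dots> = 64 * M ^ 4 * c\<Lambda>\<^sup>2 * (1 + cR)\<^sup>2 * L ^ 4 * (h + 1 / real n)"
      by (simp add: power_mult_distrib power2_eq_square power4_eq_xxxx)
    also have "\<dots> \<le> 64 * M ^ 4 * c\<Lambda>\<^sup>2 * (1 + cR)\<^sup>2 * L ^ 8 * (h + 1 / real n)"
      using L_pow_mono[of 4 8] h0 by (intro mult_right_mono mult_left_mono) auto
    finally show "64 * M ^ 4 * (c\<Lambda> * L)\<^sup>2 * (1 + vR)\<^sup>2 * h \<le> 64 * M ^ 4 * c\<Lambda>\<^sup>2 * (1 + cR)\<^sup>2 * L ^ 8 * (h + 1 / real n)" .
    have "1 * L \<le> cR * L" using const_bounds L_powers by (intro mult_right_mono) auto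
    then have "exp (- vR) \<le> exp (- L)" by (simp add: vR_def)
    also have "\<dots> = 1 / real n" by (simp add: exp_minus exp_L inverse_eq_divide)
    finally have e: "exp (- vR) \<le> h + 1 / real n" using h0 by simp
    have rc: "regret_const M \<ge> 0" using M1 by (simp add: regret_const_def)
    have "4 * (c\<Lambda> * L)\<^sup>2 * regret_const M * exp (- vR) = 4 * c\<Lambda>\<^sup>2 * regret_const M * L\<^sup>2 * exp (- vR)"
      by (simp add: power_mult_distrib mult_ac)
    also have "\<dots> \<le> 4 * c\<Lambda>\<^sup>2 * regret_const M * L ^ 8 * (h + 1 / real n)"
      using e L_pow_mono[of 2 8] rc L_powers by (intro mult_mono mult_left_mono) auto
    finally show "4 * (c\<Lambda> * L)\<^sup>2 * regret_const M * exp (- vR) \<le> 4 * c\<Lambda>\<^sup>2 * regret_const M * L ^ 8 * (h + 1 / real n)" .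
  qed
  also have "\<dots> = cF * L ^ 8 * (h + 1 / real n)" by (simp add: cF_def algebra_simps)
  finally show "bayes_risk G G0 (\<sigma> j) - bayes_risk G0 G0 (\<sigma> j) \<le> cF * L ^ 8 * (hell2 G G0 (\<sigma> j) + 1 / real n)"
    by (simp add: h_def)
qed

lemma n_star_eq: "1 / n_star n Cov = opn / real n"
  by (simp add: n_star_def opn_def)

text \<open>The power 13 is 8 from the score interpolation plus 5 from the number of classes. The
  additive 1/n terms sum to 1, which \<open>opn * L ^ 5 \<ge> 1\<close> absorbs.\<close>

lemma regret_bound:
  assumes G: "G \<in> npmle_set n \<sigma> (observation n S \<omega>)" and U: "\<And>j. j < n \<Longrightarrow> \<bar>U \<omega> j\<bar> \<le> vR"
    and h: "total_hell2 G < vE"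
  shows "0 \<le> regret n \<sigma> G G0" "regret n \<sigma> G G0 \<le> rate_const * L ^ 13 / n_star n Cov"
proof -
  note Gd = npmle_loglik(1)[OF G]
  note ex = bayes_risk_excess[OF Gd npmle_mass[OF G U]]
  show "0 \<le> regret n \<sigma> G G0" unfolding regret_def using ex(1) by (intro mult_nonneg_nonneg sum_nonneg) auto
  have "regret n \<sigma> G G0 \<le> 1 / real n * (\<Sum>j<n. cF * L ^ 8 * (hell2 G G0 (\<sigma> j) + 1 / real n))"
    unfolding regret_def using ex(2) by (intro mult_left_mono sum_mono) auto
  also have "\<dots> = 1 / real n * (cF * L ^ 8 * (total_hell2 G + 1))"
    using n_pos by (simp add: sum.distrib flip: sum_distrib_left)
  also have "\<dots> \<le> 1 / real n * (cF * L ^ 8 * ((2 * cE + 1) * opn * L ^ 5))"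
  proof (intro mult_left_mono)
    have "1 * 1 \<le> opn * L ^ 5" using opn_ge_1 L_pow_mono[of 0 5] by (intro mult_mono) auto
    then show "total_hell2 G + 1 \<le> (2 * cE + 1) * opn * L ^ 5"
      using h by (simp add: vE_def algebra_simps)
  qed (use const_bounds L_powers in auto)
  also have "\<dots> = rate_const * (L ^ 8 * L ^ 5) * (opn / real n)" by (simp add: rate_const_def mult_ac)
  also have "L ^ 8 * L ^ 5 = L ^ 13" by (simp flip: power_add)
  finally show "regret n \<sigma> G G0 \<le> rate_const * L ^ 13 / n_star n Cov"
    unfolding n_star_eq[symmetric] by simp
qed

theorem npmle_regret_event:
  obtains A where "A \<in> sets (model n G0)"
    and "measure (model n G0) A \<ge> 1 - (2 * exp (2 * M) + 1) * real n powr (- D)"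
    and "\<And>\<omega> G. \<omega> \<in> A \<Longrightarrow> G \<in> npmle_set n \<sigma> (observation n S \<omega>) \<Longrightarrow>
        0 \<le> regret n \<sigma> G G0 \<and> regret n \<sigma> G G0 \<le> rate_const * L ^ 13 / n_star n Cov"
proof -
  have nD: "real n powr (- D) = exp (- (D * L))" using n_pos by (simp add: powr_def)
  have R: "0 \<le> vR" "vR \<le> vr" "1 \<le> vr"
  proof -
    show "0 \<le> vR" "vR \<le> vr" using const_bounds L_powers by (auto simp: vR_def vr_def intro: mult_right_mono)
    have "1 * 1 \<le> cr * L" using const_bounds L_powers by (intro mult_mono) auto
    then show "1 \<le> vr" by (simp add: vr_def)
  qed
  have \<epsilon>: "0 < v\<epsilon>" "v\<epsilon> \<le> 1" using const_bounds by (auto simp: v\<epsilon>_def)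
  have \<eta>: "0 < v\<eta>" by (simp add: v\<eta>_def)
  define P1 where "P1 = real n * (2 * exp (2 * M) * exp (- vR))"
  define P2 where "P2 = (7 * vr ^ (2 * vK) / v\<epsilon>) ^ (2 * vK + 1) * exp (1 - vE / (2 * opn) + real n * sqrt v\<eta> * noise_level.sqrt_const M)"
  have P1: "P1 \<le> 2 * exp (2 * M) * real n powr (- D)"
  proof -
    \<comment> \<open>Since \<open>cR = D + 2\<close>, a union over n tails still leaves a smaller
      power than n^(-D).\<close>
    have "P1 = 2 * exp (2 * M) * (exp L * exp (- vR))" by (simp add: P1_def exp_L)
    also have "exp L * exp (- vR) \<le> exp (- (D * L))"
      unfolding mult_exp_exp using L_powers by (simp add: vR_def cR_def algebra_simps)
    finally show ?thesis by (simp add: nD)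
  qed
  have P2: "P2 \<le> real n powr (- D)"
  proof -
    \<comment> \<open>In \<open>cE\<close> the summand \<open>cN\<close> cancels the number of
      classes, 2 covers the two additive units in the exponent, and \<open>D\<close> gives the
      required power of n.\<close>
    have "P2 \<le> exp (cN * L ^ 5) * exp (1 - cE * L ^ 5 + 1)"
      unfolding P2_def using count_bound eta_bounds(2) opn_ge_1 R \<epsilon>
      by (intro mult_mono) (auto simp: vE_def)
    also have "\<dots> = exp (2 - (2 + D) * L ^ 5)" unfolding mult_exp_exp by (simp add: cE_def algebra_simps)
    also have "\<dots> \<le> exp (- (D * L))"
    proof -
      have "D * L \<le> D * L ^ 5" using D0 L_pow_mono[of 1 5] by (intro mult_left_mono) auto
      moreover have "1 \<le> L ^ 5" using L_pow_mono[of 0 5] by simp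
      ultimately have "2 - (2 + D) * L ^ 5 \<le> - (D * L)" by (simp add: distrib_right)
      then show ?thesis by simp
    qed
    finally show ?thesis by (simp add: nD)
  qed
  from npmle_event[OF R \<epsilon> \<eta> eta_bounds(1) cover_error_small prior_density_ge, of vE]
  obtain A where A: "A \<in> sets (model n G0)" "measure (model n G0) A \<ge> 1 - (P1 + P2)"
    and good: "\<And>\<omega> G. \<omega> \<in> A \<Longrightarrow> G \<in> npmle_set n \<sigma> (observation n S \<omega>) \<Longrightarrow>
        (\<forall>j<n. \<bar>U \<omega> j\<bar> \<le> vR) \<and> total_hell2 G < vE"
    unfolding P1_def P2_def by metis
  show thesis
  proof (rule that[OF A(1)])
    show "measure (model n G0) A \<ge> 1 - (2 * exp (2 * M) + 1) * real n powr (- D)"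
      using A(2) P1 P2 by (simp add: distrib_right)
  qed (use good regret_bound in blast)
qed

end

theorem proposition2p5:
  fixes M D :: real
  assumes "M > 1" and "D > 0"
  shows "\<exists>c1>1. \<forall>(n::nat) (G0 :: real measure) (Cov :: real mat) (S :: real mat)
           (Ghat :: (nat \<Rightarrow> real) \<times> (nat \<Rightarrow> real) \<Rightarrow> real measure).
      n \<ge> 1 \<longrightarrow>
      real_distribution G0 \<longrightarrow> supp G0 \<subseteq> {-M..M} \<longrightarrow>
      pos_semidef n Cov \<longrightarrow> psd_sqrt n Cov S \<longrightarrow>
      (\<forall>j<n. Cov $$ (j, j) \<in> {1 / M..M}) \<longrightarrow>
      (\<forall>\<omega> \<in> space (model n G0).
         Ghat \<omega> \<in> npmle_set n (marginal_sd Cov) (observation n S \<omega>)) \<longrightarrow>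
      n_star n Cov \<ge> (ln (real n)) powr c1 \<longrightarrow>
      (\<exists>A \<in> sets (model n G0).
         measure (model n G0) A \<ge> 1 - c1 * real n powr (- D) \<and>
         (\<forall>\<omega> \<in> A. 0 \<le> regret n (marginal_sd Cov) (Ghat \<omega>) G0 \<and>
            regret n (marginal_sd Cov) (Ghat \<omega>) G0
              \<le> (1 / n_star n Cov) * (ln (real n)) powr c1))"
proof -
  \<comment> \<open>Outside the locale \<open>rate_const\<close> depends on \<open>M\<close> and
    \<open>D\<close> alone, so it can be fixed before n and the model. Its sign is known only inside
    the locale, hence the maximum with 0.\<close>
  define kr where "kr = max 0 (corr_bound.rate_const M D)"
  \<comment> \<open>The summands serve, in order: the power of the logarithm, the multiplicative
    constant turned into a further power, the factor in the failure probability, and small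
    n.\<close>
  define c1 where "c1 = 13 + 2 * kr + (2 * exp (2 * M) + 1) + 8 powr D"
  have kr: "kr \<ge> 0" by (simp add: kr_def)
  have e: "exp (2 * M) > 0" "(8::real) powr D > 0" by auto
  have c1: "c1 > 1" "13 + 2 * kr \<le> c1" "2 * exp (2 * M) + 1 \<le> c1" "8 powr D \<le> c1"
    unfolding c1_def using kr e by linarith+
  show ?thesis
  proof (intro exI[of _ c1] conjI allI impI c1(1))
    fix n :: nat and G0 :: "real measure" and Cov S :: "real mat" and Ghat :: "(nat \<Rightarrow> real) \<times> (nat \<Rightarrow> real) \<Rightarrow> real measure"
    assume n1: "n \<ge> 1" and G0: "real_distribution G0" and supp: "supp G0 \<subseteq> {-M..M}"
      and Cov: "pos_semidef n Cov" and S: "psd_sqrt n Cov S" and diag: "\<forall>j<n. Cov $$ (j, j) \<in> {1 / M..M}"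
      and Ghat: "\<forall>\<omega> \<in> space (model n G0). Ghat \<omega> \<in> npmle_set n (marginal_sd Cov) (observation n S \<omega>)"
    show "\<exists>A \<in> sets (model n G0).
         measure (model n G0) A \<ge> 1 - c1 * real n powr (- D) \<and>
         (\<forall>\<omega> \<in> A. 0 \<le> regret n (marginal_sd Cov) (Ghat \<omega>) G0 \<and>
            regret n (marginal_sd Cov) (Ghat \<omega>) G0
              \<le> (1 / n_star n Cov) * (ln (real n)) powr c1)"
    \<comment> \<open>For small n the required probability is at most 0 and the empty event will do.
      From 8 on, \<open>ln (real n) \<ge> 2\<close> because exp(2) is below 8.\<close>
    proof (cases "n < 8")
      case True
      have "real n powr D \<le> 8 powr D" using True assms(2) by (intro powr_mono2) auto
      then have "real n powr D \<le> c1" using c1(4) by linarith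
      then have "real n powr D * real n powr (- D) \<le> c1 * real n powr (- D)" by (intro mult_right_mono) auto
      then have "1 \<le> c1 * real n powr (- D)" using n1 by (simp flip: powr_add)
      then show ?thesis by (intro bexI[of _ "{}"]) auto
    next
      case False
      have L2: "ln (real n) \<ge> 2"
      proof -
        have "exp 2 = exp 1 * exp (1::real)" by (simp flip: exp_add)
        also have "\<dots> \<le> 2.8 * 2.8" using e_less_272 by (intro mult_mono) auto
        also have "\<dots> \<le> real n" using False by simp
        finally have "ln (exp 2) \<le> ln (real n)" by (subst ln_le_cancel_iff) (use n1 in auto)
        then show ?thesis by simp
      qed
      have "corr_model M n G0 Cov S"
        unfolding corr_model_def using assms(1) n1 G0 supp Cov S diag by blast
      moreover have "1 \<le> ln (real n)" using L2 by linarith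
      ultimately interpret corr_bound M n G0 Cov S D
        by (intro corr_bound.intro corr_bound_axioms.intro assms(2))
      obtain A where A: "A \<in> sets (model n G0)"
        "measure (model n G0) A \<ge> 1 - (2 * exp (2 * M) + 1) * real n powr (- D)"
        and good: "\<And>\<omega> G. \<omega> \<in> A \<Longrightarrow> G \<in> npmle_set n \<sigma> (observation n S \<omega>) \<Longrightarrow>
          0 \<le> regret n \<sigma> G G0 \<and> regret n \<sigma> G G0 \<le> rate_const * L ^ 13 / n_star n Cov"
        using npmle_regret_event by metis
      have ns: "1 / n_star n Cov \<ge> 0" unfolding n_star_eq using opn_ge_1 by simp
      have rate: "rate_const * L ^ 13 \<le> L powr c1"
      proof -
        \<comment> \<open>A constant becomes a power of the logarithm:
          \<open>kr \<le> exp kr \<le> 2 powr (2 * kr)\<close> as \<open>2 * ln 2 \<ge> 1\<close>,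
          and the base 2 is at most \<open>L\<close>.\<close>
        have "rate_const \<le> kr" by (simp add: kr_def)
        also have "\<dots> \<le> exp kr" by (rule le_exp_self)
        also have "\<dots> \<le> exp (2 * kr * ln 2)"
        proof -
          have "kr * 1 \<le> kr * (2 * ln 2)" using ln2_ge_two_thirds kr by (intro mult_left_mono) auto
          then show ?thesis by (simp add: mult_ac)
        qed
        also have "\<dots> = 2 powr (2 * kr)" by (simp add: powr_def)
        also have "\<dots> \<le> L powr (2 * kr)" using L2 kr by (intro powr_mono2) auto
        finally have "rate_const * L ^ 13 \<le> L powr (2 * kr) * L powr 13"
          using L2 by (intro mult_mono) (auto simp: powr_numeral)
        also have "\<dots> = L powr (2 * kr + 13)" by (simp add: powr_add)
        also have "\<dots> \<le> L powr c1" using L2 c1(2) by (intro powr_mono) auto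
        finally show ?thesis .
      qed
      show ?thesis
      proof (intro bexI[of _ A] conjI ballI)
        have "(2 * exp (2 * M) + 1) * real n powr (- D) \<le> c1 * real n powr (- D)"
          using c1(3) by (intro mult_right_mono) auto
        then show "1 - c1 * real n powr (- D) \<le> measure (model n G0) A" using A(2) by linarith
        fix \<omega> assume \<omega>: "\<omega> \<in> A"
        then have "\<omega> \<in> space (model n G0)" using sets.sets_into_space[OF A(1)] by blast
        then have g: "0 \<le> regret n \<sigma> (Ghat \<omega>) G0 \<and> regret n \<sigma> (Ghat \<omega>) G0 \<le> rate_const * L ^ 13 / n_star n Cov"
          using good[OF \<omega>] Ghat by blast
        show "0 \<le> regret n (marginal_sd Cov) (Ghat \<omega>) G0" using g by simp
        have "rate_const * L ^ 13 / n_star n Cov \<le> (1 / n_star n Cov) * L powr c1"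
          using mult_right_mono[OF rate ns] by (simp add: mult.commute)
        with g show "regret n (marginal_sd Cov) (Ghat \<omega>) G0 \<le> (1 / n_star n Cov) * (ln (real n)) powr c1" by linarith
      qed (rule A(1))
    qed
  qed
qed

end
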